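(* Let $\mathcal H$ be a Hilbert space (finite- or infinite-dimensional), $\mathbb P:=B(\mathcal H)^{++}$, $n\ge2$, let $M:\mathbb P^n\to\mathbb P$ be a map satisfying (A) joint monotonicity, (B) homogeneity, (C) monotone continuity and (D) normalization, and let $\sigma_1,\dots,\sigma_n$ be operator means with $\sigma_j\ne\mathfrak l$ for all $j$. Then the deformed mean $M_{(\sigma_1,\dots,\sigma_n)}:\mathbb P^n\to\mathbb P$ also satisfies (A), (B), (C) and (D).
   Context: $B(\mathcal H)^{++}=\mathbb P$ is the set of positive invertible bounded operators on $\mathcal H$. Properties of a map $M:\mathbb P^n\to\mathbb P$: (A) if $A_j\le B_j$ in $\mathbb P$ for $1\le j\le n$, then $M(A_1,\dots,A_n)\le M(B_1,\dots,B_n)$; (B) $M(\alpha A_1,\dots,\alpha A_n)=\alpha M(A_1,\dots,A_n)$ for $A_j\in\mathbb P$, $\alpha>0$; (C) if $A_{j,k}\in\mathbb P$ ($k\in\mathbb N$) and $A_{j,k}\searrow A_j\in\mathbb P$ as $k\to\infty$ for $1\le j\le n$, then $M(A_{1,k},\dots,A_{n,k})\to M(A_1,\dots,A_n)$ in the strong operator topology, and the same holds if $A_{j,k}\nearrow A_j\in\mathbb P$ for $1\le j\le n$ (here $\searrow$, $\nearrow$ denote decreasing, increasing sequences converging in the strong operator topology); (D) $M(I,\dots,I)=I$. Operator means are in the sense of Kubo–Ando: each operator mean $\sigma$ is given by its representing function $f_\sigma$, a non-negative operator monotone function on $[0,\infty)$ with $f_\sigma(1)=1$, through $A\sigma B=A^{1/2}f_\sigma(A^{-1/2}BA^{-1/2})A^{1/2}$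 for $A,B\in\mathbb P$. $\mathfrak l$ is the left trivial mean $A\mathfrak lB=A$ ($f_{\mathfrak l}\equiv1$). Deformed mean: for $A_1,\dots,A_n\in\mathbb P$, $M_{(\sigma_1,\dots,\sigma_n)}(A_1,\dots,A_n)$ denotes the unique solution $X\in\mathbb P$ (which is known to exist) of $X=M(X\sigma_1A_1,\dots,X\sigma_nA_n)$. *)

theory Defs
  imports "HOL-Analysis.Analysis" "HOL-Computational_Algebra.Polynomial"
begin

section \<open>Complex Hilbert spaces\<close>

text \<open>
  A complex Hilbert space is a real one (for \<open>Re \<langle>x, y\<rangle>\<close>) with a compatible complex structure,
  so the norm and the type of bounded operators are the ones of the library.
  The complex inner product is linear in its second argument.
\<close>

class complex_hilbert = real_inner + complete_space +
  fixes scaleC :: "complex \<Rightarrow> 'a \<Rightarrow> 'a" (infixr \<open>*\<^sub>C\<close> 75)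
    and cinner :: "'a \<Rightarrow> 'a \<Rightarrow> complex"
  assumes scaleC_add_right: "c *\<^sub>C (x + y) = c *\<^sub>C x + c *\<^sub>C y"
    and scaleC_add_left: "(c + d) *\<^sub>C x = c *\<^sub>C x + d *\<^sub>C x"
    and scaleC_scaleC: "c *\<^sub>C (d *\<^sub>C x) = (c * d) *\<^sub>C x"
    and scaleC_of_real: "complex_of_real r *\<^sub>C x = r *\<^sub>R x"
    and cinner_commute: "cinner x y = cnj (cinner y x)"
    and cinner_add_right: "cinner x (y + z) = cinner x y + cinner x z"
    and cinner_scaleC_right: "cinner x (c *\<^sub>C y) = c * cinner x y"
    and inner_eq_Re_cinner: "inner x y = Re (cinner x y)"


section \<open>The Hilbert space of square-summable complex sequences\<close>

typedef ell2 = "{x :: nat \<Rightarrow> complex. summable (\<lambda>i. (cmod (x i))\<^sup>2)}"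
  morphisms ell2_nth Abs_ell2
  by (rule exI[of _ "\<lambda>_. 0"]) simp

setup_lifting type_definition_ell2

lemma summable_cnj_mult:
  assumes "summable (\<lambda>i. (cmod (x i))\<^sup>2)" "summable (\<lambda>i. (cmod (y i))\<^sup>2)"
  shows "summable (\<lambda>i::nat. cnj (x i) * y i)"
proof (rule summable_comparison_test')
  show "summable (\<lambda>i. (cmod (x i))\<^sup>2 + (cmod (y i))\<^sup>2)"
    using assms by (rule summable_add)
  show "norm (cnj (x i) * y i) \<le> (cmod (x i))\<^sup>2 + (cmod (y i))\<^sup>2" for i
  proof -
    have "2 * (cmod (x i) * cmod (y i)) \<le> (cmod (x i))\<^sup>2 + (cmod (y i))\<^sup>2"
      using sum_squares_bound[of "cmod (x i)" "cmod (y i)"] by simp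
    moreover have "0 \<le> cmod (x i) * cmod (y i)" by simp
    ultimately show ?thesis unfolding norm_mult complex_mod_cnj by linarith
  qed
qed

lemma summable_square_add:
  assumes "summable (\<lambda>i. (cmod (x i))\<^sup>2)" "summable (\<lambda>i. (cmod (y i))\<^sup>2)"
  shows "summable (\<lambda>i::nat. (cmod (x i + y i))\<^sup>2)"
proof (rule summable_comparison_test')
  show "summable (\<lambda>i. 2 * ((cmod (x i))\<^sup>2 + (cmod (y i))\<^sup>2))"
    using assms by (intro summable_mult summable_add)
  show "norm ((cmod (x i + y i))\<^sup>2) \<le> 2 * ((cmod (x i))\<^sup>2 + (cmod (y i))\<^sup>2)" for i
  proof -
    have "(cmod (x i + y i))\<^sup>2 \<le> (cmod (x i) + cmod (y i))\<^sup>2"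
      by (intro power_mono norm_triangle_ineq) simp
    also have "\<dots> \<le> 2 * ((cmod (x i))\<^sup>2 + (cmod (y i))\<^sup>2)"
      using sum_squares_bound[of "cmod (x i)" "cmod (y i)"] by (simp add: power2_sum)
    finally show ?thesis by simp
  qed
qed

lemma summable_square_scale:
  assumes "summable (\<lambda>i::nat. (cmod (x i))\<^sup>2)"
  shows "summable (\<lambda>i. (cmod (c * x i))\<^sup>2)"
  unfolding norm_mult power_mult_distrib by (rule summable_mult[OF assms])

lemma ell2_summable: "summable (\<lambda>i. (cmod (ell2_nth x i))\<^sup>2)"
  using ell2_nth[of x] by simp

instantiation ell2 :: real_inner
begin

lift_definition zero_ell2 :: ell2 is "\<lambda>_. 0" by simp
lift_definition plus_ell2 :: "ell2 \<Rightarrow> ell2 \<Rightarrow> ell2" is "\<lambda>x y i. x i + y i"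
  by (rule summable_square_add)
lift_definition uminus_ell2 :: "ell2 \<Rightarrow> ell2" is "\<lambda>x i. - x i" by simp
definition minus_ell2 :: "ell2 \<Rightarrow> ell2 \<Rightarrow> ell2" where "minus_ell2 x y = x + - y"
lift_definition scaleR_ell2 :: "real \<Rightarrow> ell2 \<Rightarrow> ell2" is "\<lambda>r x i. complex_of_real r * x i"
  by (rule summable_square_scale)
definition inner_ell2 :: "ell2 \<Rightarrow> ell2 \<Rightarrow> real" where
  "inner_ell2 x y = Re (\<Sum>i. cnj (ell2_nth x i) * ell2_nth y i)"
definition norm_ell2 :: "ell2 \<Rightarrow> real" where "norm_ell2 x = sqrt (inner x x)"
definition dist_ell2 :: "ell2 \<Rightarrow> ell2 \<Rightarrow> real" where "dist_ell2 x y = norm (x - y)"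
definition sgn_ell2 :: "ell2 \<Rightarrow> ell2" where "sgn_ell2 x = scaleR (inverse (norm x)) x"
definition uniformity_ell2 :: "(ell2 \<times> ell2) filter" where
  "uniformity_ell2 = (INF e\<in>{0 <..}. principal {(x, y). dist x y < e})"
definition open_ell2 :: "ell2 set \<Rightarrow> bool" where
  "open_ell2 U \<longleftrightarrow> (\<forall>x\<in>U. \<forall>\<^sub>F (x', y) in uniformity. x' = x \<longrightarrow> y \<in> U)"

lemma ell2_inner_sums:
  "(\<lambda>i. Re (cnj (ell2_nth x i) * ell2_nth y i)) sums inner x y"
  unfolding inner_ell2_def
  by (rule sums_Re[OF summable_sums[OF summable_cnj_mult[OF ell2_summable ell2_summable]]])

lemma ell2_norm_sums: "(\<lambda>i. (cmod (ell2_nth x i))\<^sup>2) sums inner x x"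
proof -
  have "Re (cnj z * z) = (cmod z)\<^sup>2" for z
    by (simp add: cmod_power2 flip: power2_eq_square)
  then show ?thesis using ell2_inner_sums[of x x] by simp
qed

instance
proof
  fix x y z :: ell2 and a b :: real
  show "x + y + z = x + (y + z)" by transfer (simp add: add.assoc)
  show "x + y = y + x" by transfer (simp add: add.commute)
  show "0 + x = x" by transfer simp
  show "- x + x = 0" by transfer simp
  show "x - y = x + - y" by (rule minus_ell2_def)
  show "a *\<^sub>R (x + y) = a *\<^sub>R x + a *\<^sub>R y" by transfer (simp add: distrib_left)
  show "(a + b) *\<^sub>R x = a *\<^sub>R x + b *\<^sub>R x" by transfer (simp add: distrib_right)
  show "a *\<^sub>R b *\<^sub>R x = (a * b) *\<^sub>R x" by transfer (simp add: mult.assoc)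
  show "1 *\<^sub>R x = x" by transfer simp
  show "dist x y = norm (x - y)" by (rule dist_ell2_def)
  show "sgn x = scaleR (inverse (norm x)) x" by (rule sgn_ell2_def)
  show "uniformity = (INF e\<in>{0 <..}. principal {(x :: ell2, y). dist x y < e})"
    by (rule uniformity_ell2_def)
  show "open U \<longleftrightarrow> (\<forall>x\<in>U. \<forall>\<^sub>F (x', y) in uniformity. x' = x \<longrightarrow> y \<in> U)" for U :: "ell2 set"
    by (rule open_ell2_def)
  have "(\<lambda>i. Re (cnj (ell2_nth y i) * ell2_nth x i)) = (\<lambda>i. Re (cnj (ell2_nth x i) * ell2_nth y i))"
    by (rule ext) (simp add: mult.commute)
  then show "inner x y = inner y x"
    by (metis ell2_inner_sums sums_unique2)
  have "(\<lambda>i. Re (cnj (ell2_nth (x + y) i) * ell2_nth z i)) sums (inner x z + inner y z)"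
    using sums_add[OF ell2_inner_sums[of x z] ell2_inner_sums[of y z]]
    by (simp add: plus_ell2.rep_eq algebra_simps)
  then show "inner (x + y) z = inner x z + inner y z"
    by (rule sums_unique2[OF ell2_inner_sums])
  have "(\<lambda>i. Re (cnj (ell2_nth (a *\<^sub>R x) i) * ell2_nth y i)) sums (a * inner x y)"
    using sums_mult[OF ell2_inner_sums[of x y], of a]
    by (simp add: scaleR_ell2.rep_eq algebra_simps)
  then show "inner (a *\<^sub>R x) y = a * inner x y"
    by (rule sums_unique2[OF ell2_inner_sums])
  have nn: "0 \<le> (\<Sum>i. (cmod (ell2_nth x i))\<^sup>2)"
    by (intro suminf_nonneg ell2_summable) simp
  have eq: "inner x x = (\<Sum>i. (cmod (ell2_nth x i))\<^sup>2)"
    by (rule sums_unique[OF ell2_norm_sums])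
  show "0 \<le> inner x x" using nn eq by simp
  have "inner x x = 0 \<longleftrightarrow> (\<forall>i. (cmod (ell2_nth x i))\<^sup>2 = 0)"
    unfolding eq by (intro suminf_eq_zero_iff ell2_summable) simp
  also have "\<dots> \<longleftrightarrow> x = 0" by transfer auto
  finally show "inner x x = 0 \<longleftrightarrow> x = 0" .
  show "norm x = sqrt (inner x x)" by (rule norm_ell2_def)
qed

end

lemma ell2_nth_diff: "ell2_nth (x - y) i = ell2_nth x i - ell2_nth y i"
  unfolding minus_ell2_def plus_ell2.rep_eq uminus_ell2.rep_eq by simp

lemma ell2_sum_le_norm: "(\<Sum>i<N. (cmod (ell2_nth x i))\<^sup>2) \<le> (norm x)\<^sup>2"
proof -
  have "(\<Sum>i<N. (cmod (ell2_nth x i))\<^sup>2) \<le> (\<Sum>i. (cmod (ell2_nth x i))\<^sup>2)"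
    by (rule sum_le_suminf[OF ell2_summable]) auto
  also have "\<dots> = inner x x" by (rule sums_unique[OF ell2_norm_sums, symmetric])
  finally show ?thesis by (simp add: power2_norm_eq_inner)
qed

lemma ell2_norm_le:
  assumes "\<And>N. (\<Sum>i<N. (cmod (ell2_nth x i))\<^sup>2) \<le> e\<^sup>2" "0 \<le> e"
  shows "norm x \<le> e"
proof -
  have "inner x x = (\<Sum>i. (cmod (ell2_nth x i))\<^sup>2)" by (rule sums_unique[OF ell2_norm_sums])
  also have "\<dots> \<le> e\<^sup>2" by (rule suminf_le_const[OF ell2_summable assms(1)])
  finally show ?thesis unfolding norm_eq_sqrt_inner by (rule real_le_lsqrt[OF assms(2)])
qed

lemma ell2_nth_le_norm: "cmod (ell2_nth x i) \<le> norm x"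
proof -
  have "(cmod (ell2_nth x i))\<^sup>2 \<le> (\<Sum>j<Suc i. (cmod (ell2_nth x j))\<^sup>2)"
    by (simp add: sum_nonneg)
  also have "\<dots> \<le> (norm x)\<^sup>2" by (rule ell2_sum_le_norm)
  finally show ?thesis by (rule power2_le_imp_le) simp
qed

instance ell2 :: complete_space
proof
  fix X :: "nat \<Rightarrow> ell2"
  assume X: "Cauchy X"
  have "Cauchy (\<lambda>n. ell2_nth (X n) i)" for i
  proof (rule metric_CauchyI)
    fix e :: real assume "0 < e"
    then obtain K where K: "\<And>m n. K \<le> m \<Longrightarrow> K \<le> n \<Longrightarrow> dist (X m) (X n) < e"
      using X unfolding Cauchy_def by blast
    have "dist (ell2_nth (X m) i) (ell2_nth (X n) i) < e" if "K \<le> m" "K \<le> n" for m n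
      using ell2_nth_le_norm[of "X m - X n" i] K[OF that]
      by (simp add: dist_norm ell2_nth_diff)
    then show "\<exists>K. \<forall>m\<ge>K. \<forall>n\<ge>K. dist (ell2_nth (X m) i) (ell2_nth (X n) i) < e" by blast
  qed
  then have "\<forall>i. \<exists>l. (\<lambda>n. ell2_nth (X n) i) \<longlonglongrightarrow> l"
    by (simp add: Cauchy_convergent_iff convergent_def)
  then obtain g where g: "\<And>i. (\<lambda>n. ell2_nth (X n) i) \<longlonglongrightarrow> g i" by metis
  have tail: "\<exists>K. \<forall>m\<ge>K. \<forall>N. (\<Sum>i<N. (cmod (ell2_nth (X m) i - g i))\<^sup>2) \<le> e\<^sup>2"
    if "0 < e" for e :: real
  proof -
    obtain K where K: "\<And>m n. K \<le> m \<Longrightarrow> K \<le> n \<Longrightarrow> dist (X m) (X n) < e"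
      using X \<open>0 < e\<close> unfolding Cauchy_def by blast
    have "(\<Sum>i<N. (cmod (ell2_nth (X m) i - g i))\<^sup>2) \<le> e\<^sup>2" if "K \<le> m" for m N
    proof (rule LIMSEQ_le_const2)
      show "(\<lambda>n. \<Sum>i<N. (cmod (ell2_nth (X m) i - ell2_nth (X n) i))\<^sup>2)
              \<longlonglongrightarrow> (\<Sum>i<N. (cmod (ell2_nth (X m) i - g i))\<^sup>2)"
        by (intro tendsto_intros g)
      have "(\<Sum>i<N. (cmod (ell2_nth (X m) i - ell2_nth (X n) i))\<^sup>2) \<le> e\<^sup>2" if "K \<le> n" for n
      proof -
        have "(\<Sum>i<N. (cmod (ell2_nth (X m - X n) i))\<^sup>2) \<le> (norm (X m - X n))\<^sup>2"
          by (rule ell2_sum_le_norm)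
        also have "\<dots> \<le> e\<^sup>2"
          using K[OF \<open>K \<le> m\<close> that] by (intro power_mono) (auto simp: dist_norm)
        finally show ?thesis by (simp add: ell2_nth_diff)
      qed
      then show "\<exists>M. \<forall>n\<ge>M. (\<Sum>i<N. (cmod (ell2_nth (X m) i - ell2_nth (X n) i))\<^sup>2) \<le> e\<^sup>2"
        by blast
    qed
    then show ?thesis by blast
  qed
  obtain K where K: "\<And>N. (\<Sum>i<N. (cmod (ell2_nth (X K) i - g i))\<^sup>2) \<le> 1\<^sup>2"
    using tail[OF zero_less_one] by blast
  have "summable (\<lambda>i. (cmod (ell2_nth (X K) i - g i))\<^sup>2)"
    by (rule summableI_nonneg_bounded[of _ "1\<^sup>2"]) (use K in auto)
  then have "summable (\<lambda>i. (cmod (- 1 * (ell2_nth (X K) i - g i)))\<^sup>2)"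
    by (rule summable_square_scale)
  then have "summable (\<lambda>i. (cmod (ell2_nth (X K) i + - 1 * (ell2_nth (X K) i - g i)))\<^sup>2)"
    by (rule summable_square_add[OF ell2_summable])
  then have G: "ell2_nth (Abs_ell2 g) = g" by (simp add: Abs_ell2_inverse)
  have "X \<longlonglongrightarrow> Abs_ell2 g"
  proof (rule metric_LIMSEQ_I)
    fix r :: real assume "0 < r"
    then obtain K where "\<And>m N. K \<le> m \<Longrightarrow> (\<Sum>i<N. (cmod (ell2_nth (X m) i - g i))\<^sup>2) \<le> (r/2)\<^sup>2"
      using tail[of "r/2"] half_gt_zero by blast
    then have "dist (X m) (Abs_ell2 g) \<le> r/2" if "K \<le> m" for m
      unfolding dist_norm using that \<open>0 < r\<close>
      by (intro ell2_norm_le) (simp_all add: ell2_nth_diff G)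
    moreover have "r/2 < r" using \<open>0 < r\<close> by simp
    ultimately show "\<exists>K. \<forall>m\<ge>K. dist (X m) (Abs_ell2 g) < r" by (meson le_less_trans)
  qed
  then show "convergent X" by (rule convergentI)
qed

instantiation ell2 :: complex_hilbert
begin

lift_definition scaleC_ell2 :: "complex \<Rightarrow> ell2 \<Rightarrow> ell2" is "\<lambda>c x i. c * x i"
  by (rule summable_square_scale)
definition cinner_ell2 :: "ell2 \<Rightarrow> ell2 \<Rightarrow> complex" where
  "cinner_ell2 x y = (\<Sum>i. cnj (ell2_nth x i) * ell2_nth y i)"

instance
proof
  fix x y z :: ell2 and c d :: complex and r :: real
  have s: "summable (\<lambda>i. cnj (ell2_nth x i) * ell2_nth y i)" for x y
    by (intro summable_cnj_mult ell2_summable)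
  show "c *\<^sub>C (x + y) = c *\<^sub>C x + c *\<^sub>C y" by transfer (simp add: distrib_left)
  show "(c + d) *\<^sub>C x = c *\<^sub>C x + d *\<^sub>C x" by transfer (simp add: distrib_right)
  show "c *\<^sub>C (d *\<^sub>C x) = (c * d) *\<^sub>C x" by transfer (simp add: mult.assoc)
  show "complex_of_real r *\<^sub>C x = r *\<^sub>R x" by transfer simp
  have "(\<lambda>i. cnj (cnj (ell2_nth y i) * ell2_nth x i)) sums cnj (cinner y x)"
    unfolding cinner_ell2_def sums_cnj using s by (rule summable_sums)
  then show "cinner x y = cnj (cinner y x)"
    by (simp add: cinner_ell2_def mult.commute sums_iff)
  show "cinner x (y + z) = cinner x y + cinner x z"
    by (simp add: cinner_ell2_def plus_ell2.rep_eq distrib_left suminf_add[OF s s])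
  show "cinner x (c *\<^sub>C y) = c * cinner x y"
    by (simp add: cinner_ell2_def scaleC_ell2.rep_eq mult.left_commute suminf_mult[OF s])
  show "inner x y = Re (cinner x y)" by (simp add: inner_ell2_def cinner_ell2_def)
qed

end


section \<open>Bounded operators\<close>

text \<open>The type \<open>'h \<Rightarrow>\<^sub>L 'h\<close> contains all bounded real-linear maps; \<open>B(H)\<close> is cut out of it.\<close>

definition bounded_ops :: "('h::complex_hilbert \<Rightarrow>\<^sub>L 'h) set" where
  "bounded_ops = {T. \<forall>c x. blinfun_apply T (c *\<^sub>C x) = c *\<^sub>C blinfun_apply T x}"

definition positive_op :: "('h::complex_hilbert \<Rightarrow>\<^sub>L 'h) \<Rightarrow> bool" where
  "positive_op T \<longleftrightarrow> T \<in> bounded_ops \<and> (\<forall>x. cinner x (blinfun_apply T x) \<in> \<real>\<^sub>\<ge>\<^sub>0)"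

definition op_le :: "('h::complex_hilbert \<Rightarrow>\<^sub>L 'h) \<Rightarrow> ('h \<Rightarrow>\<^sub>L 'h) \<Rightarrow> bool" (infix \<open>\<le>\<^sub>o\<^sub>p\<close> 50) where
  "A \<le>\<^sub>o\<^sub>p B \<longleftrightarrow> positive_op (B - A)"

definition invertible_op :: "('h::complex_hilbert \<Rightarrow>\<^sub>L 'h) \<Rightarrow> bool" where
  "invertible_op T \<longleftrightarrow> (\<exists>S\<in>bounded_ops. S o\<^sub>L T = id_blinfun \<and> T o\<^sub>L S = id_blinfun)"

definition pos_inv_ops :: "('h::complex_hilbert \<Rightarrow>\<^sub>L 'h) set" where
  "pos_inv_ops = {T. positive_op T \<and> invertible_op T}"


section \<open>Continuous functional calculus\<close>

text \<open>
  Only real spectral values are recorded: the functional calculus is applied to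
  self-adjoint operators only, whose spectrum is contained in the real line.
\<close>

definition real_spectrum :: "('h::complex_hilbert \<Rightarrow>\<^sub>L 'h) \<Rightarrow> real set" where
  "real_spectrum A = {t. \<not> invertible_op (A - t *\<^sub>R id_blinfun)}"

definition poly_op :: "real poly \<Rightarrow> ('h::complex_hilbert \<Rightarrow>\<^sub>L 'h) \<Rightarrow> ('h \<Rightarrow>\<^sub>L 'h)" where
  "poly_op p A = (\<Sum>i\<le>degree p. coeff p i *\<^sub>R ((\<lambda>T. A o\<^sub>L T) ^^ i) id_blinfun)"

text \<open>
  For self-adjoint \<open>A\<close> and \<open>f\<close> continuous on its spectrum, \<open>f(A)\<close> is the norm limit of \<open>p\<^sub>k(A)\<close>
  for any real polynomials \<open>p\<^sub>k\<close> converging to \<open>f\<close> uniformly on the spectrum.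
\<close>

definition cfc :: "(real \<Rightarrow> real) \<Rightarrow> ('h::complex_hilbert \<Rightarrow>\<^sub>L 'h) \<Rightarrow> ('h \<Rightarrow>\<^sub>L 'h)" where
  "cfc f A = (THE T. \<forall>p. uniform_limit (real_spectrum A) (\<lambda>k. poly (p k)) f sequentially
                        \<longrightarrow> (\<lambda>k. poly_op (p k) A) \<longlonglongrightarrow> T)"


section \<open>Operator means\<close>

text \<open>
  Operator monotonicity refers to operators on an infinite-dimensional Hilbert space, here \<open>\<ell>\<^sup>2\<close>,
  and never to the space on which the means act: on a space of finite dimension \<open>d\<close> the
  condition would only say that \<open>f\<close> is matrix monotone of order \<open>d\<close>.
\<close>

definition operator_monotone :: "(real \<Rightarrow> real) \<Rightarrow> bool" where
  "operator_monotone f \<longleftrightarrow> continuous_on {0..} f \<and>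
     (\<forall>A B :: ell2 \<Rightarrow>\<^sub>L ell2. positive_op A \<longrightarrow> positive_op B \<longrightarrow> A \<le>\<^sub>o\<^sub>p B \<longrightarrow> cfc f A \<le>\<^sub>o\<^sub>p cfc f B)"

definition representing_function :: "(real \<Rightarrow> real) \<Rightarrow> bool" where
  "representing_function f \<longleftrightarrow> operator_monotone f \<and> (\<forall>t\<ge>0. 0 \<le> f t) \<and> f 1 = 1"

definition mean_of ::
    "(real \<Rightarrow> real) \<Rightarrow> ('h::complex_hilbert \<Rightarrow>\<^sub>L 'h) \<Rightarrow> ('h \<Rightarrow>\<^sub>L 'h) \<Rightarrow> ('h \<Rightarrow>\<^sub>L 'h)" where
  "mean_of f A B =
     (let R = cfc sqrt A; S = cfc (\<lambda>t. 1 / sqrt t) A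
      in R o\<^sub>L cfc f (S o\<^sub>L B o\<^sub>L S) o\<^sub>L R)"

text \<open>
  An operator mean is given by its representing function, and two representing functions give
  the same mean iff they agree on \<open>[0, \<infinity>)\<close>; the left trivial mean has the constant function 1.
\<close>

definition is_left_trivial :: "(real \<Rightarrow> real) \<Rightarrow> bool" where
  "is_left_trivial f \<longleftrightarrow> (\<forall>t\<ge>0. f t = 1)"


section \<open>Means of several operators\<close>

text \<open>
  An \<open>n\<close>-tuple is a function on a finite index type with \<open>n\<close> elements.
\<close>

type_synonym ('i, 'h) op_map = "('i \<Rightarrow> 'h \<Rightarrow>\<^sub>L 'h) \<Rightarrow> ('h \<Rightarrow>\<^sub>L 'h)"

definition maps_pos_inv :: "('i::finite, 'h::complex_hilbert) op_map \<Rightarrow> bool" where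
  "maps_pos_inv M \<longleftrightarrow> (\<forall>A. (\<forall>j. A j \<in> pos_inv_ops) \<longrightarrow> M A \<in> pos_inv_ops)"

definition jointly_monotone :: "('i::finite, 'h::complex_hilbert) op_map \<Rightarrow> bool" where
  "jointly_monotone M \<longleftrightarrow>
     (\<forall>A B. (\<forall>j. A j \<in> pos_inv_ops) \<longrightarrow> (\<forall>j. B j \<in> pos_inv_ops) \<longrightarrow> (\<forall>j. A j \<le>\<^sub>o\<^sub>p B j)
        \<longrightarrow> M A \<le>\<^sub>o\<^sub>p M B)"

definition homogeneous_map :: "('i::finite, 'h::complex_hilbert) op_map \<Rightarrow> bool" where
  "homogeneous_map M \<longleftrightarrow>
     (\<forall>A (\<alpha>::real). (\<forall>j. A j \<in> pos_inv_ops) \<longrightarrow> 0 < \<alpha> \<longrightarrow> M (\<lambda>j. \<alpha> *\<^sub>R A j) = \<alpha> *\<^sub>R M A)"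

definition sot_lim :: "(nat \<Rightarrow> 'h::complex_hilbert \<Rightarrow>\<^sub>L 'h) \<Rightarrow> ('h \<Rightarrow>\<^sub>L 'h) \<Rightarrow> bool" where
  "sot_lim T L \<longleftrightarrow> limitin strong_operator_topology T L sequentially"

definition sot_decreasing :: "(nat \<Rightarrow> 'h::complex_hilbert \<Rightarrow>\<^sub>L 'h) \<Rightarrow> ('h \<Rightarrow>\<^sub>L 'h) \<Rightarrow> bool" where
  "sot_decreasing T L \<longleftrightarrow> (\<forall>k. T (Suc k) \<le>\<^sub>o\<^sub>p T k) \<and> sot_lim T L"

definition sot_increasing :: "(nat \<Rightarrow> 'h::complex_hilbert \<Rightarrow>\<^sub>L 'h) \<Rightarrow> ('h \<Rightarrow>\<^sub>L 'h) \<Rightarrow> bool" where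
  "sot_increasing T L \<longleftrightarrow> (\<forall>k. T k \<le>\<^sub>o\<^sub>p T (Suc k)) \<and> sot_lim T L"

definition monotone_continuous :: "('i::finite, 'h::complex_hilbert) op_map \<Rightarrow> bool" where
  "monotone_continuous M \<longleftrightarrow>
     (\<forall>A L. (\<forall>j k. A j k \<in> pos_inv_ops) \<longrightarrow> (\<forall>j. L j \<in> pos_inv_ops) \<longrightarrow>
        ((\<forall>j. sot_decreasing (A j) (L j)) \<or> (\<forall>j. sot_increasing (A j) (L j))) \<longrightarrow>
        sot_lim (\<lambda>k. M (\<lambda>j. A j k)) (M L))"

definition normalized_map :: "('i::finite, 'h::complex_hilbert) op_map \<Rightarrow> bool" where
  "normalized_map M \<longleftrightarrow> M (\<lambda>_. id_blinfun) = id_blinfun"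

definition deformed_mean ::
    "('i::finite, 'h::complex_hilbert) op_map \<Rightarrow> ('i \<Rightarrow> real \<Rightarrow> real) \<Rightarrow> ('i, 'h) op_map" where
  "deformed_mean M f A = (THE X. X \<in> pos_inv_ops \<and> X = M (\<lambda>j. mean_of (f j) X (A j)))"

end

theory Submission
  imports Defs "HOL-Computational_Algebra.Fundamental_Theorem_Algebra"
begin

text \<open>
  Put \<open>F\<^sub>A(X) = M(X \<sigma>\<^sub>1 A\<^sub>1, \<dots>, X \<sigma>\<^sub>n A\<^sub>n)\<close>. This map is increasing in \<open>X\<close> and in \<open>A\<close>; monotonicity in \<open>X\<close>
  is Hansen's inequality \<open>K\<^sup>* f(T) K \<le> f(K\<^sup>* T K)\<close> for the contraction \<open>K = X\<^sup>1\<^sup>/\<^sup>2 Y\<^sup>-\<^sup>1\<^sup>/\<^sup>2\<close>, \<open>X \<le> Y\<close>.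
  If \<open>a I \<le> A\<^sub>j \<le> b I\<close> for all \<open>j\<close>, then \<open>F\<^sub>A(b I) \<le> b I\<close> and \<open>F\<^sub>A(a I) \<ge> a I\<close>, so the iterates of \<open>b I\<close>
  decrease strongly to a fixed point. Since no \<open>f\<^sub>j\<close> is constant, each is strictly increasing and
  \<open>F\<^sub>A(\<alpha> X) \<le> r \<alpha> F\<^sub>A(X)\<close> with \<open>r < 1\<close> for \<open>\<alpha> > 1\<close>; hence every sub-solution lies below every
  super-solution. This comparison gives uniqueness and (A), and uniqueness gives (B) and (D). For (C),
  the fixed points of a monotone sequence form a monotone sequence, whose strong limit solves the
  limiting equation.
\<close>

section \<open>Hermitian operators\<close>

text \<open>Several obstacles shape the development. \<open>cfc\<close> is a definite description
  over all polynomial approximations, so even its existence rests on bounding the norm of p(A) by p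
  on the real spectrum; this needs spectral mapping, obtained by factoring real polynomials.
  Operator monotonicity is given on \<open>ell2\<close> only, whereas Hansen's inequality needs it
  on H x H for an arbitrary H; it is transported by compressing to finitely many vectors. Strict
  monotonicity of f is drawn from rank-one perturbations of scalars on \<open>ell2\<close>, without
  an integral representation. The factor r comes from (\<alpha> X) \<sigma> A = \<alpha> (X \<sigma>
  (A/\<alpha>)): enlarging X shrinks the argument of f to t/\<alpha>, and f(t/\<alpha>)/f(t) has a
  maximum below 1 on a compact interval of positive t. Finally, (C) is the only continuity available
  for M, so every limit is taken along families that are monotone in all arguments and in the same
  direction, although the binary means are strongly continuous on all sequences with common positive
  bounds.\<close>

instance complex_hilbert \<subseteq> banach ..

lemma bounded_ops_id: "id_blinfun \<in> bounded_ops"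
  by (simp add: bounded_ops_def)

lemma bounded_ops_zero: "0 \<in> bounded_ops"
  by (simp add: bounded_ops_def) (metis add_cancel_left_left scaleC_add_right)

lemma bounded_ops_add: "S \<in> bounded_ops \<Longrightarrow> T \<in> bounded_ops \<Longrightarrow> S + T \<in> bounded_ops"
  by (simp add: bounded_ops_def blinfun.add_left scaleC_add_right)

lemma scaleR_scaleC_commute: "r *\<^sub>R (c *\<^sub>C (x :: 'a::complex_hilbert)) = c *\<^sub>C (r *\<^sub>R x)"
  by (simp add: scaleC_of_real[symmetric] scaleC_scaleC mult.commute)

lemma bounded_ops_scaleR: "S \<in> bounded_ops \<Longrightarrow> r *\<^sub>R S \<in> bounded_ops"
  by (simp add: bounded_ops_def blinfun.scaleR_left scaleR_scaleC_commute)

lemma bounded_ops_diff: "S \<in> bounded_ops \<Longrightarrow> T \<in> bounded_ops \<Longrightarrow> S - T \<in> bounded_ops"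
  using bounded_ops_add[of S "(-1) *\<^sub>R T"] bounded_ops_scaleR[of T "-1"] by simp

lemma bounded_ops_compose: "S \<in> bounded_ops \<Longrightarrow> T \<in> bounded_ops \<Longrightarrow> S o\<^sub>L T \<in> bounded_ops"
  by (simp add: bounded_ops_def)

lemma scaleC_zero_right [simp]: "c *\<^sub>C (0 :: 'a::complex_hilbert) = 0"
  by (metis add_cancel_left_left scaleC_add_right)

lemma cinner_self: "cinner x x = complex_of_real (inner x x)"
proof -
  have "Im (cinner x x) = 0"
    using arg_cong[OF cinner_commute[of x x], of Im] by simp
  then show ?thesis by (simp add: complex_eq_iff inner_eq_Re_cinner)
qed

lemma inner_scaleC_right: "inner x (c *\<^sub>C y) = Re (c * cinner x y)"
  by (simp add: inner_eq_Re_cinner cinner_scaleC_right)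

lemma cinner_add_left: "cinner (x + y) z = cinner x z + cinner y z"
  by (metis cinner_add_right cinner_commute complex_cnj_add)

lemma cinner_scaleC_left: "cinner (c *\<^sub>C x) y = cnj c * cinner x y"
  by (metis cinner_commute cinner_scaleC_right complex_cnj_cnj complex_cnj_mult)

lemma norm_scaleC: "norm (c *\<^sub>C x) = cmod c * norm x"
proof -
  have "inner (c *\<^sub>C x) (c *\<^sub>C x) = Re (cnj c * c * cinner x x)"
    by (simp add: inner_eq_Re_cinner cinner_scaleC_left cinner_scaleC_right mult_ac)
  also have "\<dots> = (cmod c)\<^sup>2 * inner x x"
    using cmod_power2[of c] by (simp add: cinner_self power2_eq_square)
  finally show ?thesis
    by (simp add: norm_eq_sqrt_inner real_sqrt_mult)
qed

text \<open>Since Im z = Re (- i z), the complex product is determined by the real one, and adjoint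
  relations need to be checked for \<open>inner\<close> only.\<close>

lemma cinner_conv_inner: "cinner x y = Complex (inner x y) (inner x ((- \<i>) *\<^sub>C y))"
  by (simp add: complex_eq_iff inner_eq_Re_cinner cinner_scaleC_right)

text \<open>Symmetry for the real product is enough: members of \<open>bounded_ops\<close> are
  complex-linear, which upgrades it to the complex product in
  \<open>hermitian_op_cinner\<close>.\<close>

definition hermitian_op :: "('h::complex_hilbert \<Rightarrow>\<^sub>L 'h) \<Rightarrow> bool" where
  "hermitian_op T \<longleftrightarrow> T \<in> bounded_ops \<and>
     (\<forall>x y. inner (blinfun_apply T x) y = inner x (blinfun_apply T y))"

lemma hermitian_opI:
  "T \<in> bounded_ops \<Longrightarrow> (\<And>x y. inner (blinfun_apply T x) y = inner x (blinfun_apply T y)) \<Longrightarrow> hermitian_op T"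
  by (simp add: hermitian_op_def)

lemma hermitian_op_bounded: "hermitian_op T \<Longrightarrow> T \<in> bounded_ops"
  and hermitian_op_inner: "hermitian_op T \<Longrightarrow> inner (blinfun_apply T x) y = inner x (blinfun_apply T y)"
  by (simp_all add: hermitian_op_def)

lemma hermitian_op_id: "hermitian_op id_blinfun"
  by (simp add: hermitian_op_def bounded_ops_id)

lemma hermitian_op_zero: "hermitian_op 0"
  by (simp add: hermitian_op_def bounded_ops_zero)

lemma hermitian_op_add: "hermitian_op S \<Longrightarrow> hermitian_op T \<Longrightarrow> hermitian_op (S + T)"
  by (simp add: hermitian_op_def bounded_ops_add blinfun.add_left inner_add_left inner_add_right)

lemma hermitian_op_scaleR: "hermitian_op S \<Longrightarrow> hermitian_op (r *\<^sub>R S)"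
  by (simp add: hermitian_op_def bounded_ops_scaleR blinfun.scaleR_left)

lemma hermitian_op_diff: "hermitian_op S \<Longrightarrow> hermitian_op T \<Longrightarrow> hermitian_op (S - T)"
  by (simp add: hermitian_op_def bounded_ops_diff blinfun.diff_left inner_diff_left inner_diff_right)

lemma hermitian_op_minus: "hermitian_op S \<Longrightarrow> hermitian_op (- S)"
  using hermitian_op_scaleR[of S "-1"] by simp

lemma hermitian_op_sandwich:
  "hermitian_op S \<Longrightarrow> hermitian_op T \<Longrightarrow> hermitian_op (S o\<^sub>L T o\<^sub>L S)"
  by (simp add: hermitian_op_def bounded_ops_compose)

lemma hermitian_op_compose:
  "hermitian_op S \<Longrightarrow> hermitian_op T \<Longrightarrow> S o\<^sub>L T = T o\<^sub>L S \<Longrightarrow> hermitian_op (S o\<^sub>L T)"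
  by (simp add: hermitian_op_def bounded_ops_compose)
     (metis blinfun_apply_blinfun_compose)

lemma hermitian_op_cinner:
  assumes "hermitian_op T"
  shows "cinner (blinfun_apply T x) y = cinner x (blinfun_apply T y)"
  using assms
  by (simp add: cinner_conv_inner hermitian_op_def bounded_ops_def)

text \<open>On a complex space a real-valued quadratic form already forces symmetry, by
  polarization. This allows the order to be handled through real quadratic forms from here
  on.\<close>

lemma positive_op_iff:
  "positive_op T \<longleftrightarrow> hermitian_op T \<and> (\<forall>x. 0 \<le> inner x (blinfun_apply T x))"
proof
  assume T: "positive_op T"
  then have TB: "T \<in> bounded_ops" and ge: "\<And>x. cinner x (blinfun_apply T x) \<in> \<real>\<^sub>\<ge>\<^sub>0"
    by (simp_all add: positive_op_def)
  have re: "Im (cinner x (blinfun_apply T x)) = 0" "0 \<le> Re (cinner x (blinfun_apply T x))" for x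
    using ge[of x] by (simp_all add: complex_nonneg_Reals_iff)
  have TC: "blinfun_apply T (c *\<^sub>C x) = c *\<^sub>C blinfun_apply T x" for c x
    using TB by (simp add: bounded_ops_def)
  have sym: "Im (cinner x (blinfun_apply T y)) + Im (cinner y (blinfun_apply T x)) = 0" for x y
    using re(1)[of "x + y"] re(1)[of x] re(1)[of y]
    by (simp add: blinfun.add_right cinner_add_right cinner_add_left)
  have "inner (blinfun_apply T x) y = inner x (blinfun_apply T y)" for x y
    \<comment> \<open>Replacing y by i y turns the relation between imaginary parts into one between
      real parts, which is the symmetry.\<close>
    using sym[of x "\<i> *\<^sub>C y"] inner_commute[of y "blinfun_apply T x"]
    by (simp add: TC cinner_scaleC_right cinner_scaleC_left inner_eq_Re_cinner)
  then show "hermitian_op T \<and> (\<forall>x. 0 \<le> inner x (blinfun_apply T x))"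
    using TB re(2) by (simp add: hermitian_op_def inner_eq_Re_cinner)
next
  assume T: "hermitian_op T \<and> (\<forall>x. 0 \<le> inner x (blinfun_apply T x))"
  have "cinner x (blinfun_apply T x) = cnj (cinner x (blinfun_apply T x))" for x
    using T hermitian_op_cinner[of T x x] cinner_commute[of "blinfun_apply T x" x] by simp
  from arg_cong[OF this, of Im] have "Im (cinner x (blinfun_apply T x)) = 0" for x
    by simp
  then show "positive_op T"
    using T by (simp add: positive_op_def hermitian_op_def complex_nonneg_Reals_iff inner_eq_Re_cinner)
qed

lemma op_le_iff:
  assumes "hermitian_op A" "hermitian_op B"
  shows "A \<le>\<^sub>o\<^sub>p B \<longleftrightarrow> (\<forall>x. inner x (blinfun_apply A x) \<le> inner x (blinfun_apply B x))"
  using hermitian_op_diff[OF assms(2,1)]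
  by (simp add: op_le_def positive_op_iff blinfun.diff_left inner_diff_right)

lemma op_le_inner: "A \<le>\<^sub>o\<^sub>p B \<Longrightarrow> inner x (blinfun_apply A x) \<le> inner x (blinfun_apply B x)"
  by (simp add: op_le_def positive_op_iff blinfun.diff_left inner_diff_right)

lemma op_le_refl: "A \<le>\<^sub>o\<^sub>p A"
  by (simp add: op_le_def positive_op_iff hermitian_op_zero)

lemma op_le_trans: "A \<le>\<^sub>o\<^sub>p B \<Longrightarrow> B \<le>\<^sub>o\<^sub>p C \<Longrightarrow> A \<le>\<^sub>o\<^sub>p C"
  unfolding op_le_def positive_op_iff
  using hermitian_op_add[of "B - A" "C - B"]
  by (auto simp: blinfun.diff_left inner_diff_right intro: order_trans)

lemma op_le_scaleR:
  assumes "A \<le>\<^sub>o\<^sub>p B" "0 \<le> c"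
  shows "c *\<^sub>R A \<le>\<^sub>o\<^sub>p c *\<^sub>R B"
  using assms hermitian_op_scaleR[of "B - A" c] 
  by (simp add: op_le_def positive_op_iff scaleR_diff_right[symmetric] blinfun.scaleR_left)

lemma hermitian_op_eqI:
  assumes "hermitian_op A" "hermitian_op B" "\<And>x. inner x (blinfun_apply A x) = inner x (blinfun_apply B x)"
  shows "A = B"
proof (rule blinfun_eqI)
  fix x
  define T where "T = A - B"
  have T: "hermitian_op T" and z: "inner x (blinfun_apply T x) = 0" for x
    using assms by (simp_all add: T_def hermitian_op_diff blinfun.diff_left inner_diff_right)
  \<comment> \<open>At x + T x the pure terms vanish and both mixed terms equal |T x|^2.\<close>
  have "inner (x + blinfun_apply T x) (blinfun_apply T (x + blinfun_apply T x)) = 0" by (rule z)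
  then have "inner (blinfun_apply T x) (blinfun_apply T x) = 0"
    using z[of x] z[of "blinfun_apply T x"] hermitian_op_inner[OF T, of x "blinfun_apply T x"]
    by (simp add: blinfun.add_right inner_add_left inner_add_right)
  then show "blinfun_apply A x = blinfun_apply B x" by (simp add: T_def blinfun.diff_left)
qed

lemma op_le_antisym: "hermitian_op A \<Longrightarrow> hermitian_op B \<Longrightarrow> A \<le>\<^sub>o\<^sub>p B \<Longrightarrow> B \<le>\<^sub>o\<^sub>p A \<Longrightarrow> A = B"
  by (rule hermitian_op_eqI) (auto simp: op_le_iff intro: antisym)

text \<open>The relation a I <= A <= b I in terms of quadratic forms. Such an interval survives
  limits, scaling and compression more easily than the spectrum, which it contains by
  \<open>real_spectrum_between\<close>; the laws of the calculus are stated with it.\<close>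

definition op_between :: "real \<Rightarrow> real \<Rightarrow> ('h::complex_hilbert \<Rightarrow>\<^sub>L 'h) \<Rightarrow> bool" where
  "op_between a b A \<longleftrightarrow> hermitian_op A \<and>
     (\<forall>x. a * inner x x \<le> inner x (blinfun_apply A x) \<and> inner x (blinfun_apply A x) \<le> b * inner x x)"

lemma op_between_hermitian: "op_between a b A \<Longrightarrow> hermitian_op A"
  and op_between_lower: "op_between a b A \<Longrightarrow> a * inner x x \<le> inner x (blinfun_apply A x)"
  and op_between_upper: "op_between a b A \<Longrightarrow> inner x (blinfun_apply A x) \<le> b * inner x x"
  by (simp_all add: op_between_def)

lemma op_between_mono:
  assumes "op_between a b A" "a' \<le> a" "b \<le> b'"
  shows "op_between a' b' A"
  using assms unfolding op_between_def
  by (meson inner_ge_zero mult_right_mono order_trans)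

lemma op_between_scaleR:
  assumes "op_between a b A" "0 \<le> c"
  shows "op_between (c * a) (c * b) (c *\<^sub>R A)"
  using assms
  by (auto simp: op_between_def hermitian_op_scaleR blinfun.scaleR_left mult.assoc intro!: mult_left_mono)

lemma hermitian_op_between_norm:
  assumes "hermitian_op A"
  shows "op_between (- norm A) (norm A) A"
proof -
  have "\<bar>inner x (blinfun_apply A x)\<bar> \<le> norm A * inner x x" for x
  proof -
    have "\<bar>inner x (blinfun_apply A x)\<bar> \<le> norm x * norm (blinfun_apply A x)"
      by (rule Cauchy_Schwarz_ineq2)
    also have "\<dots> \<le> norm x * (norm A * norm x)"
      by (intro mult_left_mono norm_blinfun) simp
    finally show ?thesis by (simp add: mult_ac dot_square_norm power2_eq_square)
  qed
  then show ?thesis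
    using assms unfolding op_between_def by (metis abs_le_D1 abs_le_D2 minus_le_iff mult_minus_left)
qed

lemma positive_op_between: "positive_op A \<Longrightarrow> op_between 0 (norm A) A"
  using hermitian_op_between_norm[of A] by (simp add: positive_op_iff op_between_def)

lemma op_between_positive: "op_between a b A \<Longrightarrow> 0 \<le> a \<Longrightarrow> positive_op A"
  unfolding op_between_def positive_op_iff
  by (meson inner_ge_zero mult_nonneg_nonneg order_trans)

text \<open>Lax--Milgram: \<open>x \<mapsto> x - s (T x - y)\<close> is a contraction for small \<open>s > 0\<close>.\<close>

lemma coercive_surj:
  fixes T :: "'h::complex_hilbert \<Rightarrow>\<^sub>L 'h"
  assumes "0 < c" "\<And>x. c * inner x x \<le> inner x (blinfun_apply T x)"
  shows "\<exists>x. blinfun_apply T x = y"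
proof -
  \<comment> \<open>Adding c makes N positive and at least c, so that q >= 0 below. The step s
    minimizes 1 - 2 c s + N^2 s^2, and q is the minimum.\<close>
  define N where "N = norm T + c"
  define s where "s = c / N\<^sup>2"
  have N: "0 < N" "norm T \<le> N" "c \<le> N" using assms(1) by (simp_all add: N_def add_nonneg_pos)
  then have s: "0 < s" using assms(1) by (simp add: s_def)
  define q where "q = 1 - c\<^sup>2 / N\<^sup>2"
  have q: "0 \<le> q" "q < 1"
    using N assms(1) by (simp_all add: q_def power_mono)
  have contr: "norm (x - s *\<^sub>R blinfun_apply T x) \<le> sqrt q * norm x" for x
  proof -
    have "inner (blinfun_apply T x) (blinfun_apply T x) \<le> N\<^sup>2 * inner x x"
    proof -
      have "norm (blinfun_apply T x) \<le> N * norm x"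
        using norm_blinfun[of T x] N(2) by (meson mult_right_mono norm_ge_zero order_trans)
      then have "(norm (blinfun_apply T x))\<^sup>2 \<le> (N * norm x)\<^sup>2" by (intro power_mono) auto
      then show ?thesis by (simp add: power2_norm_eq_inner power_mult_distrib)
    qed
    then have "s\<^sup>2 * inner (blinfun_apply T x) (blinfun_apply T x) \<le> s\<^sup>2 * (N\<^sup>2 * inner x x)"
      by (intro mult_left_mono) auto
    moreover have "s * (c * inner x x) \<le> s * inner x (blinfun_apply T x)"
      using s assms(2) by (intro mult_left_mono) auto
    moreover have "inner (x - s *\<^sub>R blinfun_apply T x) (x - s *\<^sub>R blinfun_apply T x)
      = inner x x - 2 * (s * inner x (blinfun_apply T x)) + s\<^sup>2 * inner (blinfun_apply T x) (blinfun_apply T x)"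
      by (simp add: inner_diff_left inner_diff_right inner_commute power2_eq_square algebra_simps)
    moreover have "s\<^sup>2 * (N\<^sup>2 * inner x x) = s * (c * inner x x)"
      using N by (simp add: s_def power2_eq_square)
    moreover have "s * (c * inner x x) = c\<^sup>2 / N\<^sup>2 * inner x x"
      by (simp add: s_def power2_eq_square)
    ultimately have "inner (x - s *\<^sub>R blinfun_apply T x) (x - s *\<^sub>R blinfun_apply T x) \<le> q * inner x x"
      unfolding q_def left_diff_distrib by linarith
    then show ?thesis
      by (simp add: norm_eq_sqrt_inner real_sqrt_mult[symmetric])
  qed
  have "\<exists>!x. x - s *\<^sub>R (blinfun_apply T x - y) = x"
  proof (rule banach_fix_type)
    show "0 \<le> sqrt q" "sqrt q < 1" using q by simp_all
    show "\<forall>x z. dist (x - s *\<^sub>R (blinfun_apply T x - y)) (z - s *\<^sub>R (blinfun_apply T z - y)) \<le> sqrt q * dist x z"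
    proof (intro allI)
      fix x z
      have "(x - s *\<^sub>R (blinfun_apply T x - y)) - (z - s *\<^sub>R (blinfun_apply T z - y))
          = (x - z) - s *\<^sub>R blinfun_apply T (x - z)"
        by (simp add: blinfun.diff_right algebra_simps)
      then show "dist (x - s *\<^sub>R (blinfun_apply T x - y)) (z - s *\<^sub>R (blinfun_apply T z - y)) \<le> sqrt q * dist x z"
        using contr[of "x - z"] by (simp only: dist_norm)
    qed
  qed
  then obtain x where "x - s *\<^sub>R (blinfun_apply T x - y) = x" by blast
  then show ?thesis using s by auto
qed

section \<open>Invertibility and quantitative lower bounds\<close>

lemma invertible_opI:
  assumes "T \<in> bounded_ops" "0 < c" "\<And>x. c * norm x \<le> norm (blinfun_apply T x)"
    "\<And>y. \<exists>x. blinfun_apply T x = y"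
  shows "invertible_op T"
proof -
  define g where "g y = (SOME x. blinfun_apply T x = y)" for y
  have g: "blinfun_apply T (g y) = y" for y
    unfolding g_def using assms(4)[of y] by (rule someI_ex)
  have inj: "x = y" if "blinfun_apply T x = blinfun_apply T y" for x y
  proof -
    have "c * norm (x - y) \<le> 0" using that assms(3)[of "x - y"] by (simp add: blinfun.diff_right)
    then show ?thesis using assms(2) by (simp add: mult_le_0_iff)
  qed
  have lin: "g (T x) = x" for x by (rule inj) (rule g)
  have bl: "bounded_linear g"
  proof (rule bounded_linear_intro)
    show "g (x + y) = g x + g y" for x y by (rule inj) (simp add: g blinfun.add_right)
    show "g (r *\<^sub>R x) = r *\<^sub>R g x" for r x by (rule inj) (simp add: g blinfun.scaleR_right)
    show "norm (g x) \<le> norm x * (1 / c)" for x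
      using assms(3)[of "g x"] assms(2) by (simp add: g field_simps)
  qed
  have "g (c *\<^sub>C x) = c *\<^sub>C g x" for c x
    by (rule inj) (use assms(1) in \<open>simp add: g bounded_ops_def\<close>)
  then have "Blinfun g \<in> bounded_ops"
    by (simp add: bounded_ops_def bounded_linear_Blinfun_apply[OF bl])
  moreover have "Blinfun g o\<^sub>L T = id_blinfun" "T o\<^sub>L Blinfun g = id_blinfun"
    by (rule blinfun_eqI, simp add: bounded_linear_Blinfun_apply[OF bl] lin g)+
  ultimately show ?thesis unfolding invertible_op_def by blast
qed

lemma coercive_invertible:
  assumes "T \<in> bounded_ops" "0 < c" "\<And>x. c * inner x x \<le> inner x (blinfun_apply T x)"
  shows "invertible_op T"
proof (rule invertible_opI[OF assms(1,2)])
  show "\<exists>x. blinfun_apply T x = y" for y by (rule coercive_surj[OF assms(2,3)])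
  show "c * norm x \<le> norm (blinfun_apply T x)" for x
  proof (cases "x = 0")
    case False
    have "norm x * (c * norm x) \<le> inner x (blinfun_apply T x)"
      using assms(3)[of x] by (simp add: dot_square_norm power2_eq_square mult_ac)
    also have "\<dots> \<le> norm x * norm (blinfun_apply T x)"
      by (rule norm_cauchy_schwarz)
    finally show ?thesis using False by simp
  qed simp
qed

lemma invertible_op_minus: "invertible_op (- T)" if "invertible_op T"
proof -
  from that obtain S where "S \<in> bounded_ops" "S o\<^sub>L T = id_blinfun" "T o\<^sub>L S = id_blinfun"
    by (auto simp: invertible_op_def)
  then show ?thesis
    using bounded_ops_scaleR[of S "-1"] unfolding invertible_op_def
    by (intro bexI[of _ "- S"])
       (simp_all add: bounded_bilinear.minus_left[OF bounded_bilinear_blinfun_compose]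
        bounded_bilinear.minus_right[OF bounded_bilinear_blinfun_compose])
qed

lemma invertible_op_compose:
  assumes "invertible_op S" "invertible_op T"
  shows "invertible_op (S o\<^sub>L T)"
proof -
  from assms obtain S' T' where
    B: "S' \<in> bounded_ops" "T' \<in> bounded_ops" and
    I: "S' o\<^sub>L S = id_blinfun" "S o\<^sub>L S' = id_blinfun"
    "T' o\<^sub>L T = id_blinfun" "T o\<^sub>L T' = id_blinfun"
    by (auto simp: invertible_op_def)
  have "S' (S x) = x" "S (S' x) = x" "T' (T x) = x" "T (T' x) = x" for x
    using I[THEN arg_cong[of _ _ "\<lambda>U. blinfun_apply U x"]] by simp_all
  then show ?thesis unfolding invertible_op_def
    using bounded_ops_compose[OF B(2,1)]
    by (intro bexI[of _ "T' o\<^sub>L S'"]) (auto intro!: blinfun_eqI)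
qed

text \<open>This is A^2 <= c A, before any square root is available: positivity of A is tested at x
  - A x / c, and the cubic term is estimated by A <= c I.\<close>

lemma op_between_norm_apply:
  assumes "op_between 0 c A" "0 < c"
  shows "inner (blinfun_apply A x) (blinfun_apply A x) \<le> c * inner x (blinfun_apply A x)"
proof -
  note A = assms(1)
  have "0 \<le> inner (x - (1/c) *\<^sub>R A x) (A (x - (1/c) *\<^sub>R A x))"
    using op_between_lower[OF A, of "x - (1/c) *\<^sub>R A x"] by simp
  also have "\<dots> = inner x (A x) - 2 / c * inner (A x) (A x) + 1 / c\<^sup>2 * inner (A x) (A (A x))"
    using hermitian_op_inner[OF op_between_hermitian[OF A], of x "A x"]
    by (simp add: blinfun.diff_right blinfun.scaleR_right inner_diff_left inner_diff_right
        power2_eq_square inner_commute algebra_simps)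
  also have "\<dots> \<le> inner x (A x) - 2 / c * inner (A x) (A x) + 1 / c\<^sup>2 * (c * inner (A x) (A x))"
    using op_between_upper[OF A, of "A x"] assms(2) by (intro add_mono mult_left_mono) auto
  also have "\<dots> = inner x (A x) - inner (A x) (A x) / c"
    using assms(2) by (simp add: power2_eq_square)
  finally show ?thesis using assms(2) by (simp add: field_simps)
qed

lemma invertible_op_bounded_below:
  assumes "invertible_op T"
  shows "\<exists>c>0. \<forall>x. c * inner x x \<le> inner (blinfun_apply T x) (blinfun_apply T x)"
proof -
  from assms obtain S where "S o\<^sub>L T = id_blinfun" by (auto simp: invertible_op_def)
  then have ST: "S (T x) = x" for x by (metis blinfun_apply_blinfun_compose blinfun_apply_id_blinfun)
  define N where "N = norm S + 1"
  have N: "0 < N" by (simp add: N_def add_nonneg_pos)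
  have "(1 / N\<^sup>2) * inner x x \<le> inner (T x) (T x)" for x
  proof -
    have "norm x \<le> norm S * norm (T x)" using norm_blinfun[of S "T x"] by (simp add: ST)
    also have "\<dots> \<le> N * norm (T x)" by (intro mult_right_mono) (simp_all add: N_def)
    finally have "(norm x)\<^sup>2 \<le> (N * norm (T x))\<^sup>2" by (intro power_mono) auto
    then show ?thesis using N by (simp add: power_mult_distrib power2_norm_eq_inner field_simps)
  qed
  then show ?thesis using N by (intro exI[of _ "1 / N\<^sup>2"]) auto
qed

text \<open>Invertibility gives |A x|^2 >= c |x|^2, and A^2 <= N A turns this into A >= (c/N) I. The
  summand 1 in N keeps it positive when A = 0.\<close>

lemma pos_inv_ops_between:
  assumes "A \<in> pos_inv_ops"
  shows "\<exists>a b. 0 < a \<and> 0 < b \<and> op_between a b A"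
proof -
  from assms have A: "positive_op A" "invertible_op A" by (simp_all add: pos_inv_ops_def)
  define N where "N = norm A + 1"
  have N: "0 < N" by (simp add: N_def add_nonneg_pos)
  have b: "op_between 0 N A"
    by (rule op_between_mono[OF positive_op_between[OF A(1)]]) (simp_all add: N_def)
  obtain c where c: "0 < c" "\<And>x. c * inner x x \<le> inner (A x) (A x)"
    using invertible_op_bounded_below[OF A(2)] by blast
  have "c / N * inner x x \<le> inner x (A x)" for x
    using order_trans[OF c(2)[of x] op_between_norm_apply[OF b N, of x]] N by (simp add: field_simps)
  then have "op_between (c / N) N A"
    using b by (auto simp: op_between_def)
  moreover have "0 < c / N" using c(1) N by simp
  ultimately show ?thesis using N by blast
qed

lemma op_between_pos_inv:
  assumes "op_between a b A" "0 < a"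
  shows "A \<in> pos_inv_ops"
proof -
  have "invertible_op A"
    using coercive_invertible[of A a] assms op_between_lower[OF assms(1)]
      hermitian_op_bounded[OF op_between_hermitian[OF assms(1)]] by blast
  then show ?thesis using op_between_positive[OF assms(1)] assms(2) by (simp add: pos_inv_ops_def)
qed

lemma pos_inv_hermitian: "A \<in> pos_inv_ops \<Longrightarrow> hermitian_op A"
  by (simp add: pos_inv_ops_def positive_op_iff)

lemma pos_inv_opsI:
  assumes "hermitian_op A" "0 < a" "\<And>x. a * inner x x \<le> inner x (blinfun_apply A x)"
  shows "A \<in> pos_inv_ops"
  using assms hermitian_op_between_norm[OF assms(1)]
  by (intro op_between_pos_inv[of a "norm A"]) (auto simp: op_between_def)

lemma pos_inv_ops_scaleR: "A \<in> pos_inv_ops \<Longrightarrow> 0 < c \<Longrightarrow> c *\<^sub>R A \<in> pos_inv_ops"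
  by (metis less_imp_le mult_pos_pos op_between_pos_inv op_between_scaleR pos_inv_ops_between)

section \<open>Polynomials of Hermitian operators\<close>

lemma blinfun_compose_simps:
  "(A + B) o\<^sub>L C = (A o\<^sub>L C) + (B o\<^sub>L C)" "A o\<^sub>L (C + D) = (A o\<^sub>L C) + (A o\<^sub>L D)"
  "(A - B) o\<^sub>L C = (A o\<^sub>L C) - (B o\<^sub>L C)" "A o\<^sub>L (C - D) = (A o\<^sub>L C) - (A o\<^sub>L D)"
  "(r *\<^sub>R A) o\<^sub>L C = r *\<^sub>R (A o\<^sub>L C)" "A o\<^sub>L (r *\<^sub>R C) = r *\<^sub>R (A o\<^sub>L C)"
  "id_blinfun o\<^sub>L A = A" "A o\<^sub>L id_blinfun = A"
  by (rule blinfun_eqI, simp add: blinfun.bilinear_simps)+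

lemma blinfun_compose_assoc: "A o\<^sub>L B o\<^sub>L C = A o\<^sub>L (B o\<^sub>L C)"
  by (rule blinfun_eqI) simp

lemma poly_op_altdef:
  assumes "degree p \<le> n"
  shows "poly_op p A = (\<Sum>i\<le>n. coeff p i *\<^sub>R ((\<lambda>T. A o\<^sub>L T) ^^ i) id_blinfun)"
  unfolding poly_op_def using assms
  by (intro sum.mono_neutral_left) (auto simp: coeff_eq_0)

lemma poly_op_0 [simp]: "poly_op 0 A = 0"
  by (simp add: poly_op_def)

lemma poly_op_pCons: "poly_op (pCons a p) A = a *\<^sub>R id_blinfun + (A o\<^sub>L poly_op p A)"
proof -
  have "poly_op (pCons a p) A = (\<Sum>i\<le>Suc (degree p). coeff (pCons a p) i *\<^sub>R ((\<lambda>T. A o\<^sub>L T) ^^ i) id_blinfun)"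
    by (rule poly_op_altdef) (rule degree_pCons_le)
  also have "\<dots> = a *\<^sub>R id_blinfun + (\<Sum>i\<le>degree p. coeff p i *\<^sub>R (A o\<^sub>L ((\<lambda>T. A o\<^sub>L T) ^^ i) id_blinfun))"
    unfolding sum.atMost_Suc_shift by simp
  also have "(\<Sum>i\<le>degree p. coeff p i *\<^sub>R (A o\<^sub>L ((\<lambda>T. A o\<^sub>L T) ^^ i) id_blinfun)) = A o\<^sub>L poly_op p A"
    unfolding poly_op_def
    by (simp add: bounded_bilinear.sum_right[OF bounded_bilinear_blinfun_compose] blinfun_compose_simps)
  finally show ?thesis .
qed

lemma poly_op_const: "poly_op [:c:] A = c *\<^sub>R id_blinfun"
  by (simp add: poly_op_pCons)

lemma poly_op_X: "poly_op [:0, 1:] A = A"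
  by (simp add: poly_op_pCons blinfun_compose_simps)

lemma poly_op_add: "poly_op (p + q) A = poly_op p A + poly_op q A"
  unfolding poly_op_altdef[of p "max (degree p) (degree q)", simplified]
    poly_op_altdef[of q "max (degree p) (degree q)", simplified]
  by (subst poly_op_altdef[of _ "max (degree p) (degree q)"])
     (simp_all add: degree_add_le_max sum.distrib scaleR_left_distrib)

lemma poly_op_smult: "poly_op (smult c p) A = c *\<^sub>R poly_op p A"
  by (induction p) (simp_all add: poly_op_pCons blinfun_compose_simps scaleR_right_distrib)

lemma poly_op_diff: "poly_op (p - q) A = poly_op p A - poly_op q A"
  using poly_op_add[of "p - q" q A] by simp

lemma poly_op_mult: "poly_op (p * q) A = poly_op p A o\<^sub>L poly_op q A"
  by (induction p) (simp_all add: poly_op_pCons poly_op_add poly_op_smult blinfun_compose_simps blinfun_compose_assoc)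

lemma poly_op_pcompose_scale: "poly_op p (c *\<^sub>R A) = poly_op (pcompose p [:0, c:]) A"
  by (induction p)
     (simp_all add: pcompose_pCons poly_op_add poly_op_mult poly_op_pCons blinfun_compose_simps
       del: mult_pCons_left)

text \<open>V may connect two different spaces. Besides commutation (A = B = V), this yields the
  reduction of an operator to the range of an isometry.\<close>

lemma poly_op_intertwine:
  assumes "A o\<^sub>L V = V o\<^sub>L B"
  shows "poly_op p A o\<^sub>L V = V o\<^sub>L poly_op p B"
proof (induction p)
  case (pCons a p)
  have "A o\<^sub>L (poly_op p A o\<^sub>L V) = V o\<^sub>L (B o\<^sub>L poly_op p B)"
    by (simp add: pCons assms blinfun_compose_assoc[symmetric])
  then show ?case by (simp add: poly_op_pCons blinfun_compose_simps blinfun_compose_assoc assms)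
qed (simp add: blinfun_compose_simps)

lemma hermitian_poly_op: "hermitian_op A \<Longrightarrow> hermitian_op (poly_op p A)"
proof (induction p)
  case (pCons a p)
  then have "hermitian_op (A o\<^sub>L poly_op p A)"
    using poly_op_intertwine[of A A A p] by (intro hermitian_op_compose) auto
  then show ?case
    by (simp add: poly_op_pCons hermitian_op_add hermitian_op_scaleR hermitian_op_id)
qed (simp add: hermitian_op_zero)

lemma hermitian_shift: "hermitian_op A \<Longrightarrow> hermitian_op (A - t *\<^sub>R id_blinfun)"
  by (simp add: hermitian_op_diff hermitian_op_scaleR hermitian_op_id)

lemma real_spectrum_between:
  assumes "op_between a b A"
  shows "real_spectrum A \<subseteq> {a..b}"
proof
  fix t assume t: "t \<in> real_spectrum A"
  have h: "A - t *\<^sub>R id_blinfun \<in> bounded_ops" "- (A - t *\<^sub>R id_blinfun) \<in> bounded_ops"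
    using hermitian_op_bounded hermitian_shift[OF op_between_hermitian[OF assms]] hermitian_op_minus
    by blast+
  have ni: "\<not> invertible_op (A - t *\<^sub>R id_blinfun)"
    using t by (simp add: real_spectrum_def)
  have "\<not> t < a"
  proof
    assume "t < a"
    then have "invertible_op (A - t *\<^sub>R id_blinfun)"
      using op_between_lower[OF assms]
      by (intro coercive_invertible[OF h(1), of "a - t"])
         (auto simp: blinfun.diff_left blinfun.scaleR_left inner_diff_right left_diff_distrib)
    with ni show False by simp
  qed
  moreover have "\<not> b < t"
  proof
    assume "b < t"
    then have "invertible_op (- (A - t *\<^sub>R id_blinfun))"
      using op_between_upper[OF assms]
      by (intro coercive_invertible[OF h(2), of "t - b"])
         (auto simp: blinfun.diff_left blinfun.minus_left blinfun.scaleR_left inner_diff_right left_diff_distrib)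
    with ni invertible_op_minus show False by fastforce
  qed
  ultimately show "t \<in> {a..b}" by simp
qed

text \<open>Otherwise \<open>\<lambda>\<^sup>2 - T\<^sup>2\<close>, \<open>\<lambda> = \<parallel>T\<parallel>\<close>, would be invertible and positive, hence bounded below by some
  \<open>\<delta> > 0\<close>, and \<open>\<parallel>T x\<parallel>\<^sup>2 \<le> (\<lambda>\<^sup>2 - \<delta>) \<parallel>x\<parallel>\<^sup>2\<close> contradicts the choice of \<open>\<lambda>\<close>.\<close>

lemma norm_mem_real_spectrum:
  assumes T: "hermitian_op T" and "T \<noteq> 0"
  shows "norm T \<in> real_spectrum T \<or> - norm T \<in> real_spectrum T"
proof (rule ccontr)
  define l where "l = norm T"
  have l: "0 < l" using assms(2) by (simp add: l_def)
  assume "\<not> ?thesis"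
  then have inv: "invertible_op (T - l *\<^sub>R id_blinfun)" "invertible_op (T - (- l) *\<^sub>R id_blinfun)"
    by (auto simp: real_spectrum_def l_def)
  define R where "R = l\<^sup>2 *\<^sub>R id_blinfun - (T o\<^sub>L T)"
  have "R = - ((T - l *\<^sub>R id_blinfun) o\<^sub>L (T - (- l) *\<^sub>R id_blinfun))"
    by (rule blinfun_eqI)
       (simp add: R_def blinfun.bilinear_simps power2_eq_square algebra_simps)
  then have Rinv: "invertible_op R"
    using invertible_op_minus invertible_op_compose inv by metis
  have Rh: "hermitian_op R"
    unfolding R_def using T
    by (intro hermitian_op_diff hermitian_op_scaleR hermitian_op_id hermitian_op_compose) auto
  have Rin: "inner x (R x) = l\<^sup>2 * inner x x - inner (T x) (T x)" for x
    using hermitian_op_inner[OF T, of x "T x"]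
    by (simp add: R_def blinfun.bilinear_simps inner_diff_right)
  have "inner (T x) (T x) \<le> l\<^sup>2 * inner x x" for x
    using power_mono[OF norm_blinfun[of T x], of 2]
    by (simp add: l_def power_mult_distrib power2_norm_eq_inner)
  then have Rb: "op_between 0 (l\<^sup>2) R"
    using Rh by (simp add: op_between_def Rin)
  obtain c where c: "0 < c" "\<And>x. c * inner x x \<le> inner (R x) (R x)"
    using invertible_op_bounded_below[OF Rinv] by blast
  define d where "d = c / l\<^sup>2"
  have d: "0 < d" using c(1) l by (simp add: d_def)
  have Tx: "inner (T x) (T x) \<le> (l\<^sup>2 - d) * inner x x" for x
  proof -
    have "c * inner x x \<le> l\<^sup>2 * inner x (R x)"
      using c(2)[of x] op_between_norm_apply[OF Rb, of x] l by auto
    then have "d * inner x x \<le> inner x (R x)"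
      using l by (simp add: d_def field_simps)
    then show ?thesis by (simp add: Rin left_diff_distrib)
  qed
  \<comment> \<open>Nothing so far excludes l^2 < d, hence the maximum with 0; either value is below
    l^2.\<close>
  have "norm T \<le> sqrt (max 0 (l\<^sup>2 - d))"
  proof (rule norm_blinfun_bound)
    show "norm (T x) \<le> sqrt (max 0 (l\<^sup>2 - d)) * norm x" for x
      unfolding norm_eq_sqrt_inner real_sqrt_mult[symmetric]
      by (rule real_sqrt_le_mono) (rule order_trans[OF Tx], intro mult_right_mono, auto)
  qed simp
  then have "l\<^sup>2 \<le> max 0 (l\<^sup>2 - d)"
    using l l_def by (metis less_imp_le max.cobounded1 power_mono real_sqrt_pow2)
  then show False using l d by (auto simp: max_def split: if_splits)
qed

section \<open>Factorization of real polynomials and spectral mapping\<close>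

lemma poly_map_of_real_add:
  "poly (map_poly complex_of_real (p + q)) z = poly (map_poly of_real p) z + poly (map_poly of_real q) z"
proof -
  have "map_poly complex_of_real (p + q) = map_poly of_real p + map_poly of_real q"
    by (rule poly_eqI) (simp add: coeff_map_poly)
  then show ?thesis by simp
qed

lemma poly_map_of_real_mult:
  "poly (map_poly complex_of_real (p * q)) z = poly (map_poly of_real p) z * poly (map_poly of_real q) z"
proof (induction p)
  case (pCons a p)
  have "poly (map_poly complex_of_real (smult a q)) z = of_real a * poly (map_poly of_real q) z"
    by (simp add: map_poly_smult)
  then show ?case using pCons
    by (simp add: mult_pCons_left poly_map_of_real_add map_poly_pCons algebra_simps)
qed simp

text \<open>The factors stay real because \<open>poly_op\<close> takes real polynomials and only
  real spectral values are recorded: a non-real root a + i b contributes the factor (X - a)^2 +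
  b^2.\<close>

lemma real_poly_factor:
  fixes q :: "real poly"
  assumes "0 < degree q"
  shows "(\<exists>t. [:-t, 1:] dvd q) \<or> (\<exists>a b. b \<noteq> 0 \<and> [:a\<^sup>2 + b\<^sup>2, -2 * a, 1:] dvd q)"
proof -
  have "degree (map_poly complex_of_real q) = degree q"
    by (rule degree_map_poly) simp
  then have "\<not> constant (poly (map_poly complex_of_real q))"
    using assms by (simp add: constant_degree)
  then obtain z where z: "poly (map_poly complex_of_real q) z = 0"
    using fundamental_theorem_of_algebra by blast
  show ?thesis
  proof (cases "Im z = 0")
    case True
    have "poly (map_poly complex_of_real q) (of_real t) = of_real (poly q t)" for t
      by (induction q) (simp_all add: map_poly_pCons)
    then have "poly q (Re z) = 0"
      using z True by (metis complex_is_Real_iff of_real_Re of_real_eq_0_iff)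
    then show ?thesis using poly_eq_0_iff_dvd by blast
  next
    case False
    define d where "d = [:(Re z)\<^sup>2 + (Im z)\<^sup>2, -2 * Re z, 1:]"
    have d: "poly (map_poly complex_of_real d) z = 0"
      by (simp add: d_def map_poly_pCons complex_eq_iff power2_eq_square algebra_simps)
    define r where "r = q mod d"
    have "q = d * (q div d) + r" by (simp add: r_def)
    then have "poly (map_poly complex_of_real r) z = 0"
      using z d poly_map_of_real_add[of "d * (q div d)" r z] poly_map_of_real_mult[of d "q div d" z] by simp
    \<comment> \<open>The remainder is a real polynomial of degree at most 1 with the non-real root
      z, hence it is 0.\<close>
    have "degree r < 2"
      using degree_mod_less[of d q] by (auto simp: r_def d_def)
    have "r = [:coeff r 0, coeff r 1:]"
    proof (rule poly_eqI)
      fix n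
      show "coeff r n = coeff [:coeff r 0, coeff r 1:] n"
        using \<open>degree r < 2\<close> coeff_eq_0[of r n]
        by (cases "n < 2") (auto simp: less_2_cases_iff coeff_pCons split: nat.splits)
    qed
    then obtain c0 c1 where r: "r = [:c0, c1:]" by blast
    with \<open>poly (map_poly complex_of_real r) z = 0\<close> have "c1 * Im z = 0 \<and> c0 + c1 * Re z = 0"
      by (simp add: map_poly_pCons complex_eq_iff mult.commute)
    then have "r = 0" using False r by auto
    then have "d dvd q" by (simp add: r_def dvd_eq_mod_eq_0)
    then show ?thesis using False d_def by blast
  qed
qed

text \<open>One half of the spectral mapping theorem. A root outside the spectrum gives an
  invertible linear factor, while a quadratic factor becomes (A - a)^2 + b^2 >= b^2 > 0, invertible
  whatever the spectrum is.\<close>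

lemma poly_op_invertible:
  fixes q :: "real poly"
  assumes A: "hermitian_op A"
  shows "q \<noteq> 0 \<Longrightarrow> (\<And>t. t \<in> real_spectrum A \<Longrightarrow> poly q t \<noteq> 0) \<Longrightarrow> invertible_op (poly_op q A)"
proof (induction "degree q" arbitrary: q rule: less_induct)
  case less
  have factor: "invertible_op (poly_op q A)"
    if "d dvd q" "0 < degree d" "invertible_op (poly_op d A)" for d
  proof -
    from that(1) obtain e where e: "q = d * e" by (elim dvdE)
    then have "d \<noteq> 0" "e \<noteq> 0" using less.prems(1) by auto
    then have "degree e < degree q" using that(2) by (simp add: e degree_mult_eq)
    moreover have "poly e t \<noteq> 0" if "t \<in> real_spectrum A" for t
      using less.prems(2)[OF that] by (simp add: e)
    ultimately have "invertible_op (poly_op e A)" using \<open>e \<noteq> 0\<close> by (intro less.hyps)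
    then show ?thesis using that(3) by (simp add: e poly_op_mult invertible_op_compose)
  qed
  show ?case
  proof (cases "degree q = 0")
    case True
    then obtain c where c: "q = [:c:]" by (elim degree_eq_zeroE)
    then have "c \<noteq> 0" using less.prems(1) by simp
    then show ?thesis
      using bounded_ops_scaleR[OF bounded_ops_id, of "1 / c"] unfolding invertible_op_def c poly_op_const
      by (intro bexI[of _ "(1 / c) *\<^sub>R id_blinfun"]) (simp_all add: blinfun_compose_simps)
  next
    case False
    then consider t where "[:-t, 1:] dvd q" | a b where "b \<noteq> 0" "[:a\<^sup>2 + b\<^sup>2, -2 * a, 1:] dvd q"
      using real_poly_factor by blast
    then show ?thesis
    proof cases
      case 1
      have "poly q t = 0" using 1 poly_eq_0_iff_dvd by blast
      then have "t \<notin> real_spectrum A" using less.prems(2) by blast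
      moreover have "poly_op [:-t, 1:] A = A - t *\<^sub>R id_blinfun"
        by (simp add: poly_op_pCons blinfun_compose_simps)
      ultimately show ?thesis
        using 1 by (intro factor[of "[:-t, 1:]"]) (simp_all add: real_spectrum_def)
    next
      case 2
      define B where "B = A - a *\<^sub>R id_blinfun"
      have B: "hermitian_op B" using A by (simp add: B_def hermitian_shift)
      have eq: "poly_op [:a\<^sup>2 + b\<^sup>2, -2 * a, 1:] A = (B o\<^sub>L B) + b\<^sup>2 *\<^sub>R id_blinfun"
        by (rule blinfun_eqI, simp add: B_def poly_op_pCons blinfun.bilinear_simps power2_eq_square
            algebra_simps) (simp flip: scaleR_left_distrib)
      have "invertible_op ((B o\<^sub>L B) + b\<^sup>2 *\<^sub>R id_blinfun)"
      proof (rule coercive_invertible)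
        show "(B o\<^sub>L B) + b\<^sup>2 *\<^sub>R id_blinfun \<in> bounded_ops"
          using hermitian_op_bounded[OF B]
          by (intro bounded_ops_add bounded_ops_compose bounded_ops_scaleR bounded_ops_id)
        show "0 < b\<^sup>2" using 2 by simp
        show "b\<^sup>2 * inner x x \<le> inner x (((B o\<^sub>L B) + b\<^sup>2 *\<^sub>R id_blinfun) x)" for x
          using hermitian_op_inner[OF B, of x "B x"] inner_ge_zero[of "B x"]
          by (simp add: blinfun.bilinear_simps inner_add_right)
      qed
      then show ?thesis using 2 eq by (intro factor[of "[:a\<^sup>2 + b\<^sup>2, -2 * a, 1:]"]) simp_all
    qed
  qed
qed

text \<open>The norm of the Hermitian operator p(A) is, up to sign, one of its spectral values l. If
  p omitted the value l on the spectrum of A, then p(A) - l would be invertible by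
  \<open>poly_op_invertible\<close>.\<close>

lemma poly_op_norm_le:
  assumes A: "hermitian_op A" and "0 \<le> c" and p: "\<And>t. t \<in> real_spectrum A \<Longrightarrow> \<bar>poly p t\<bar> \<le> c"
  shows "norm (poly_op p A) \<le> c"
proof (cases "poly_op p A = 0")
  case False
  define T where "T = poly_op p A"
  have T: "hermitian_op T" "T \<noteq> 0" using False A by (simp_all add: T_def hermitian_poly_op)
  obtain l where l: "\<bar>l\<bar> = norm T" "l \<in> real_spectrum T"
    using norm_mem_real_spectrum[OF T] by (metis abs_minus_cancel abs_norm_cancel)
  have "poly_op (p - [:l:]) A = T - l *\<^sub>R id_blinfun"
    by (simp add: poly_op_diff poly_op_const T_def)
  then have ni: "\<not> invertible_op (poly_op (p - [:l:]) A)" using l by (simp add: real_spectrum_def)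
  have "\<exists>t\<in>real_spectrum A. poly p t = l"
  proof (cases "p - [:l:] = 0")
    \<comment> \<open>\<open>poly_op_invertible\<close> excludes the zero polynomial, so p = l is
      treated apart. Only some point of the spectrum is wanted here, and it exists unless the space
      is zero, where T would be 0.\<close>
    case True
    have "\<exists>t. t \<in> real_spectrum A"
    proof (cases "A = 0")
      case True
      have "\<not> invertible_op (0 :: 'a \<Rightarrow>\<^sub>L 'a)"
      proof
        assume "invertible_op (0 :: 'a \<Rightarrow>\<^sub>L 'a)"
        then have id0: "id_blinfun = (0 :: 'a \<Rightarrow>\<^sub>L 'a)" by (auto simp: invertible_op_def)
        have "blinfun_apply T x = 0" for x
        proof -
          have "x = 0" using arg_cong[OF id0, of "\<lambda>T. blinfun_apply T x"] by simp
          then show ?thesis by simp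
        qed
        with T(2) show False by (auto intro: blinfun_eqI)
      qed
      then show ?thesis using True by (intro exI[of _ 0]) (simp add: real_spectrum_def)
    qed (use norm_mem_real_spectrum[OF A] in blast)
    moreover have "p = [:l:]" using True by simp
    ultimately show ?thesis by auto
  next
    case False
    show ?thesis
    proof (rule ccontr)
      assume "\<not> ?thesis"
      then have "poly (p - [:l:]) t \<noteq> 0" if "t \<in> real_spectrum A" for t using that by auto
      with poly_op_invertible[OF A False] ni show False by blast
    qed
  qed
  then obtain t where "t \<in> real_spectrum A" "poly p t = l" by blast
  then show ?thesis using p[of t] l(1) by (simp add: T_def)
qed (use assms in simp)

section \<open>Continuous functional calculus\<close>

lemma hermitian_op_tendsto:
  assumes "\<And>k. hermitian_op (T k)" "\<And>x. (\<lambda>k. blinfun_apply (T k) x) \<longlonglongrightarrow> blinfun_apply L x"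
  shows "hermitian_op L"
proof (rule hermitian_opI)
  have "blinfun_apply L (c *\<^sub>C x) = c *\<^sub>C blinfun_apply L x" for c x
  proof (rule LIMSEQ_unique[OF assms(2)])
    have "bounded_linear (\<lambda>x. c *\<^sub>C (x :: 'a))"
      by (rule bounded_linear_intro[of _ "cmod c"])
         (simp_all add: scaleC_add_right scaleR_scaleC_commute norm_scaleC)
    then have "(\<lambda>k. c *\<^sub>C blinfun_apply (T k) x) \<longlonglongrightarrow> c *\<^sub>C blinfun_apply L x"
      by (rule bounded_linear.tendsto) (rule assms(2))
    then show "(\<lambda>k. blinfun_apply (T k) (c *\<^sub>C x)) \<longlonglongrightarrow> c *\<^sub>C blinfun_apply L x"
      using hermitian_op_bounded[OF assms(1)] by (simp add: bounded_ops_def)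
  qed
  then show "L \<in> bounded_ops" by (simp add: bounded_ops_def)
  show "inner (L x) y = inner x (L y)" for x y
  proof (rule LIMSEQ_unique)
    show "(\<lambda>k. inner (T k x) y) \<longlonglongrightarrow> inner (L x) y" by (intro tendsto_intros assms(2))
    show "(\<lambda>k. inner (T k x) y) \<longlonglongrightarrow> inner x (L y)"
      unfolding hermitian_op_inner[OF assms(1)] by (intro tendsto_intros assms(2))
  qed
qed

lemma op_between_tendsto:
  assumes "\<And>k. op_between a b (T k)" "\<And>x. (\<lambda>k. blinfun_apply (T k) x) \<longlonglongrightarrow> blinfun_apply L x"
  shows "op_between a b L"
proof -
  have lim: "(\<lambda>k. inner x (T k x)) \<longlonglongrightarrow> inner x (L x)" for x
    by (intro tendsto_intros assms(2))
  have "a * inner x x \<le> inner x (L x)" "inner x (L x) \<le> b * inner x x" for x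
    using op_between_lower[OF assms(1)] op_between_upper[OF assms(1)]
    by (blast intro: LIMSEQ_le_const[OF lim] LIMSEQ_le_const2[OF lim])+
  moreover have "hermitian_op L"
    by (rule hermitian_op_tendsto[OF op_between_hermitian[OF assms(1)] assms(2)])
  ultimately show ?thesis by (simp add: op_between_def)
qed

lemma tendsto_blinfun_apply: "T \<longlonglongrightarrow> L \<Longrightarrow> (\<lambda>k. blinfun_apply (T k) x) \<longlonglongrightarrow> blinfun_apply L x"
  by (intro blinfun.tendsto tendsto_const)

text \<open>The case p(t) = t of \<open>poly_op_norm_le\<close>. The sum of absolute values is crude
  but spares sign cases; it is the source of the factor 2 in \<open>cfc_poly_approx\<close>.\<close>

lemma op_between_norm_le:
  assumes "op_between a b A"
  shows "norm A \<le> \<bar>a\<bar> + \<bar>b\<bar>"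
  using poly_op_norm_le[OF op_between_hermitian[OF assms], of "\<bar>a\<bar> + \<bar>b\<bar>" "[:0, 1:]"]
    real_spectrum_between[OF assms]
  by (fastforce simp: poly_op_X)

text \<open>Makes the definite description in \<open>cfc\<close> meaningful:
  \<open>poly_op_norm_le\<close>, applied to differences, shows that all approximating sequences
  have one common limit. The given sequence \<open>p\<close> also secures uniqueness, since without
  any such sequence every operator would qualify.\<close>

lemma cfc_tendsto_spectrum:
  fixes A :: "'h::complex_hilbert \<Rightarrow>\<^sub>L 'h"
  assumes A: "hermitian_op A" and p: "uniform_limit (real_spectrum A) (\<lambda>k. poly (p k)) f sequentially"
  shows "(\<lambda>k. poly_op (p k) A) \<longlonglongrightarrow> cfc f A"
proof -
  have close: "\<exists>K. \<forall>m\<ge>K. \<forall>n\<ge>K. norm (poly_op (q m) A - poly_op (r n) A) \<le> e"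
    if q: "uniform_limit (real_spectrum A) (\<lambda>k. poly (q k)) f sequentially"
      and r: "uniform_limit (real_spectrum A) (\<lambda>k. poly (r k)) f sequentially" and "0 < e"
    for q r e
  proof -
    obtain K1 where K1: "\<And>n t. n \<ge> K1 \<Longrightarrow> t \<in> real_spectrum A \<Longrightarrow> dist (poly (q n) t) (f t) < e / 2"
      using q \<open>0 < e\<close> unfolding uniform_limit_sequentially_iff by (meson half_gt_zero)
    obtain K2 where K2: "\<And>n t. n \<ge> K2 \<Longrightarrow> t \<in> real_spectrum A \<Longrightarrow> dist (poly (r n) t) (f t) < e / 2"
      using r \<open>0 < e\<close> unfolding uniform_limit_sequentially_iff by (meson half_gt_zero)
    have "norm (poly_op (q m) A - poly_op (r n) A) \<le> e" if "max K1 K2 \<le> m" "max K1 K2 \<le> n" for m n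
      unfolding poly_op_diff[symmetric]
    proof (rule poly_op_norm_le[OF A])
      show "\<bar>poly (q m - r n) t\<bar> \<le> e" if "t \<in> real_spectrum A" for t
        using K1[of m t, OF _ that] K2[of n t, OF _ that] \<open>max K1 K2 \<le> m\<close> \<open>max K1 K2 \<le> n\<close>
        unfolding dist_real_def poly_diff by linarith
    qed (use \<open>0 < e\<close> in simp)
    then show ?thesis by blast
  qed
  have "Cauchy (\<lambda>k. poly_op (p k) A)"
  proof (rule metric_CauchyI)
    fix e :: real assume "0 < e"
    then obtain K where "\<And>m n. m \<ge> K \<Longrightarrow> n \<ge> K \<Longrightarrow> norm (poly_op (p m) A - poly_op (p n) A) \<le> e / 2"
      using close[OF p p, of "e / 2"] by auto
    moreover have "e / 2 < e" using \<open>0 < e\<close> by simp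
    ultimately show "\<exists>K. \<forall>m\<ge>K. \<forall>n\<ge>K. dist (poly_op (p m) A) (poly_op (p n) A) < e"
      unfolding dist_norm by (meson le_less_trans)
  qed
  then obtain L where L: "(\<lambda>k. poly_op (p k) A) \<longlonglongrightarrow> L"
    using Cauchy_convergent_iff convergent_def by blast
  have all: "(\<lambda>k. poly_op (q k) A) \<longlonglongrightarrow> L"
    if q: "uniform_limit (real_spectrum A) (\<lambda>k. poly (q k)) f sequentially" for q
  proof -
    have "(\<lambda>k. poly_op (q k) A - poly_op (p k) A) \<longlonglongrightarrow> 0"
    proof (rule LIMSEQ_I)
      fix e :: real assume "0 < e"
      then obtain K where "\<And>m n. m \<ge> K \<Longrightarrow> n \<ge> K \<Longrightarrow> norm (poly_op (q m) A - poly_op (p n) A) \<le> e / 2"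
        using close[OF q p, of "e / 2"] by auto
      moreover have "e / 2 < e" using \<open>0 < e\<close> by simp
      ultimately show "\<exists>K. \<forall>n\<ge>K. norm (poly_op (q n) A - poly_op (p n) A - 0) < e"
        by (metis diff_zero le_less_trans)
    qed
    from tendsto_add[OF this L] show ?thesis by simp
  qed
  have "cfc f A = L"
    unfolding cfc_def
  proof (rule the_equality)
    show "T = L" if "\<forall>q. uniform_limit (real_spectrum A) (\<lambda>k. poly (q k)) f sequentially \<longrightarrow>
        (\<lambda>k. poly_op (q k) A) \<longlonglongrightarrow> T" for T
      using that p L LIMSEQ_unique by blast
  qed (use all in blast)
  with L show ?thesis by simp
qed

lemma cfc_tendsto:
  assumes "op_between a b A" "uniform_limit {a..b} (\<lambda>k. poly (p k)) f sequentially"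
  shows "(\<lambda>k. poly_op (p k) A) \<longlonglongrightarrow> cfc f A"
  using assms
  by (intro cfc_tendsto_spectrum op_between_hermitian uniform_limit_on_subset[OF _ real_spectrum_between])

lemma weierstrass_poly:
  fixes f :: "real \<Rightarrow> real"
  assumes "continuous_on {a..b} f" "0 < e"
  obtains p where "\<And>t. t \<in> {a..b} \<Longrightarrow> \<bar>f t - poly p t\<bar> < e"
proof -
  obtain g where g: "real_polynomial_function g" "\<And>t. t \<in> {a..b} \<Longrightarrow> \<bar>f t - g t\<bar> < e"
    using Stone_Weierstrass_real_polynomial_function[OF _ assms] by blast
  obtain c n where c: "g = (\<lambda>x. \<Sum>i\<le>n. c i * x ^ i)"
    using real_polynomial_function_imp_sum[OF g(1)] by blast
  have "g t = poly (\<Sum>i\<le>n. monom (c i) i) t" for t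
    by (simp add: c poly_sum poly_monom)
  then show ?thesis using g(2) that[of "\<Sum>i\<le>n. monom (c i) i"] by simp
qed

lemma weierstrass_poly_limit:
  fixes f :: "real \<Rightarrow> real"
  assumes "continuous_on {a..b} f"
  obtains p where "uniform_limit {a..b} (\<lambda>k. poly (p k)) f sequentially"
proof -
  have "\<exists>p. \<forall>t\<in>{a..b}. \<bar>f t - poly p t\<bar> < 1 / real (Suc k)" for k
    using weierstrass_poly[OF assms, of "1 / real (Suc k)"] by (metis of_nat_0_less_iff zero_less_Suc zero_less_divide_1_iff)
  then obtain p where p: "\<And>k t. t \<in> {a..b} \<Longrightarrow> \<bar>f t - poly (p k) t\<bar> < 1 / real (Suc k)"
    by metis
  have "uniform_limit {a..b} (\<lambda>k. poly (p k)) f sequentially"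
  proof (rule uniform_limitI)
    fix e :: real assume "0 < e"
    then have "\<forall>\<^sub>F k in sequentially. 1 / real (Suc k) < e"
      using LIMSEQ_inverse_real_of_nat order_tendstoD(2) by (fastforce simp: inverse_eq_divide)
    then show "\<forall>\<^sub>F k in sequentially. \<forall>t\<in>{a..b}. dist (poly (p k) t) (f t) < e"
    proof eventually_elim
      case (elim k)
      then show ?case
        using p[of _ k] less_trans unfolding dist_real_def abs_minus_commute by blast
    qed
  qed
  then show ?thesis by (rule that)
qed

section \<open>Laws of the calculus over an interval containing the spectrum\<close>

lemma cfc_hermitian:
  assumes "op_between a b A" "continuous_on {a..b} f"
  shows "hermitian_op (cfc f A)"
proof -
  obtain p where "uniform_limit {a..b} (\<lambda>k. poly (p k)) f sequentially"
    using weierstrass_poly_limit[OF assms(2)] .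
  from tendsto_blinfun_apply[OF cfc_tendsto[OF assms(1) this]] show ?thesis
    by (rule hermitian_op_tendsto[OF hermitian_poly_op[OF op_between_hermitian[OF assms(1)]]])
qed

lemma cfc_cong:
  assumes "op_between a b A" "continuous_on {a..b} f" "\<And>t. t \<in> {a..b} \<Longrightarrow> f t = g t"
  shows "cfc f A = cfc g A"
proof -
  obtain p where p: "uniform_limit {a..b} (\<lambda>k. poly (p k)) f sequentially"
    using weierstrass_poly_limit[OF assms(2)] .
  have "uniform_limit {a..b} (\<lambda>k. poly (p k)) g sequentially"
    by (rule uniform_limit_cong'[THEN iffD1, OF _ _ p]) (use assms(3) in auto)
  from LIMSEQ_unique[OF cfc_tendsto[OF assms(1) p] cfc_tendsto[OF assms(1) this]] show ?thesis .
qed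

lemma cfc_poly: "op_between a b A \<Longrightarrow> cfc (poly p) A = poly_op p A"
  using cfc_tendsto[of a b A "\<lambda>_. p" "poly p"] uniform_limit_const LIMSEQ_unique tendsto_const by blast

lemma cfc_const: "op_between a b A \<Longrightarrow> cfc (\<lambda>_. c) A = c *\<^sub>R id_blinfun"
proof -
  have "(\<lambda>_. c) = poly [:c:]" by auto
  then show "op_between a b A \<Longrightarrow> cfc (\<lambda>_. c) A = c *\<^sub>R id_blinfun"
    by (simp only: cfc_poly poly_op_const)
qed

lemma cfc_ident: "op_between a b A \<Longrightarrow> cfc (\<lambda>t. t) A = A"
proof -
  have "(\<lambda>t. t) = poly [:0, 1 :: real:]" by (simp add: fun_eq_iff)
  then show "op_between a b A \<Longrightarrow> cfc (\<lambda>t. t) A = A"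
    by (simp only: cfc_poly poly_op_X)
qed

lemma cfc_add:
  assumes A: "op_between a b A" and f: "continuous_on {a..b} f" and g: "continuous_on {a..b} g"
  shows "cfc (\<lambda>t. f t + g t) A = cfc f A + cfc g A"
proof -
  obtain p where p: "uniform_limit {a..b} (\<lambda>k. poly (p k)) f sequentially"
    using weierstrass_poly_limit[OF f] .
  obtain q where q: "uniform_limit {a..b} (\<lambda>k. poly (q k)) g sequentially"
    using weierstrass_poly_limit[OF g] .
  have "uniform_limit {a..b} (\<lambda>k. poly (p k + q k)) (\<lambda>t. f t + g t) sequentially"
    unfolding poly_add by (rule uniform_limit_add[OF p q])
  from cfc_tendsto[OF A this] tendsto_add[OF cfc_tendsto[OF A p] cfc_tendsto[OF A q]] show ?thesis
    unfolding poly_op_add by (rule LIMSEQ_unique)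
qed

lemma cfc_mult:
  assumes A: "op_between a b A" and f: "continuous_on {a..b} f" and g: "continuous_on {a..b} g"
  shows "cfc (\<lambda>t. f t * g t) A = cfc f A o\<^sub>L cfc g A"
proof -
  obtain p where p: "uniform_limit {a..b} (\<lambda>k. poly (p k)) f sequentially"
    using weierstrass_poly_limit[OF f] .
  obtain q where q: "uniform_limit {a..b} (\<lambda>k. poly (q k)) g sequentially"
    using weierstrass_poly_limit[OF g] .
  have "bounded (f ` {a..b})" "bounded (g ` {a..b})"
    using f g by (auto intro: compact_imp_bounded compact_continuous_image)
  then have "uniform_limit {a..b} (\<lambda>k. poly (p k * q k)) (\<lambda>t. f t * g t) sequentially"
    unfolding poly_mult by (rule uniform_lim_mult[OF p q])
  from cfc_tendsto[OF A this]
    bounded_bilinear.tendsto[OF bounded_bilinear_blinfun_compose cfc_tendsto[OF A p] cfc_tendsto[OF A q]]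
  show ?thesis unfolding poly_op_mult by (rule LIMSEQ_unique)
qed

lemma cfc_cmult:
  assumes "op_between a b A" "continuous_on {a..b} f"
  shows "cfc (\<lambda>t. c * f t) A = c *\<^sub>R cfc f A"
  using cfc_mult[OF assms(1) continuous_on_const assms(2), of c] cfc_const[OF assms(1), of c]
  by (simp add: blinfun_compose_simps)

lemma cfc_diff:
  assumes "op_between a b A" "continuous_on {a..b} f" "continuous_on {a..b} g"
  shows "cfc (\<lambda>t. f t - g t) A = cfc f A - cfc g A"
  using cfc_add[OF assms(1,2) continuous_on_mult_left[OF assms(3)], of "-1"]
    cfc_cmult[OF assms(1,3), of "-1"] by simp

text \<open>f(A) is the square of the Hermitian operator obtained from the root of f.\<close>

lemma cfc_nonneg:
  assumes A: "op_between a b A" and f: "continuous_on {a..b} f" "\<And>t. t \<in> {a..b} \<Longrightarrow> 0 \<le> f t"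
  shows "0 \<le> inner x (blinfun_apply (cfc f A) x)"
proof -
  have c: "continuous_on {a..b} (\<lambda>t. sqrt (f t))" by (intro continuous_on_real_sqrt f(1))
  have "cfc f A = cfc (\<lambda>t. sqrt (f t) * sqrt (f t)) A"
    by (rule cfc_cong[OF A f(1)]) (simp add: f(2))
  then have "cfc f A = cfc (\<lambda>t. sqrt (f t)) A o\<^sub>L cfc (\<lambda>t. sqrt (f t)) A"
    by (simp only: cfc_mult[OF A c c])
  then show ?thesis
    using hermitian_op_inner[OF cfc_hermitian[OF A c], of x "blinfun_apply (cfc (\<lambda>t. sqrt (f t)) A) x"]
      inner_ge_zero[of "blinfun_apply (cfc (\<lambda>t. sqrt (f t)) A) x"] by simp
qed

lemma cfc_between:
  assumes A: "op_between a b A" and f: "continuous_on {a..b} f"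
    "\<And>t. t \<in> {a..b} \<Longrightarrow> m \<le> f t" "\<And>t. t \<in> {a..b} \<Longrightarrow> f t \<le> M"
  shows "op_between m M (cfc f A)"
proof -
  have "0 \<le> inner x (blinfun_apply (cfc (\<lambda>t. f t - m) A) x)" for x
    by (rule cfc_nonneg[OF A]) (auto intro!: continuous_intros f)
  moreover have "0 \<le> inner x (blinfun_apply (cfc (\<lambda>t. M - f t) A) x)" for x
    by (rule cfc_nonneg[OF A]) (auto intro!: continuous_intros f)
  ultimately show ?thesis
    using cfc_hermitian[OF A f(1)]
    by (simp add: op_between_def cfc_diff[OF A] f(1) cfc_const[OF A] blinfun.bilinear_simps
        inner_diff_right)
qed

lemma cfc_poly_approx:
  assumes A: "op_between a b A" and f: "continuous_on {a..b} f"
    and p: "\<And>t. t \<in> {a..b} \<Longrightarrow> \<bar>f t - poly p t\<bar> < e" and "0 < e"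
  shows "norm (cfc f A - poly_op p A) \<le> 2 * e"
proof -
  have "op_between (- e) e (cfc (\<lambda>t. f t - poly p t) A)"
  proof (rule cfc_between[OF A])
    show "continuous_on {a..b} (\<lambda>t. f t - poly p t)" by (intro continuous_intros f)
    show "- e \<le> f t - poly p t" "f t - poly p t \<le> e" if "t \<in> {a..b}" for t
      using p[OF that] by (simp_all add: abs_less_iff)
  qed
  from op_between_norm_le[OF this] \<open>0 < e\<close> show ?thesis
    by (simp add: cfc_diff[OF A f] cfc_poly[OF A] continuous_on_poly)
qed

lemma cfc_intertwine:
  assumes A: "op_between a b A" and B: "op_between a b B" and f: "continuous_on {a..b} f"
    and AB: "A o\<^sub>L V = V o\<^sub>L B"
  shows "cfc f A o\<^sub>L V = V o\<^sub>L cfc f B"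
proof -
  obtain p where p: "uniform_limit {a..b} (\<lambda>k. poly (p k)) f sequentially"
    using weierstrass_poly_limit[OF f] .
  have "(\<lambda>k. poly_op (p k) A o\<^sub>L V) \<longlonglongrightarrow> (cfc f A o\<^sub>L V)"
    by (intro bounded_bilinear.tendsto[OF bounded_bilinear_blinfun_compose] cfc_tendsto[OF A p] tendsto_const)
  moreover have "(\<lambda>k. poly_op (p k) A o\<^sub>L V) \<longlonglongrightarrow> (V o\<^sub>L cfc f B)"
    unfolding poly_op_intertwine[OF AB]
    by (intro bounded_bilinear.tendsto[OF bounded_bilinear_blinfun_compose] cfc_tendsto[OF B p] tendsto_const)
  ultimately show ?thesis by (rule LIMSEQ_unique)
qed

lemma cfc_scale:
  assumes A: "op_between a b A" and f: "continuous_on {c * a..c * b} f" and "0 < c"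
  shows "cfc f (c *\<^sub>R A) = cfc (\<lambda>t. f (c * t)) A"
proof -
  have cA: "op_between (c * a) (c * b) (c *\<^sub>R A)"
    using op_between_scaleR[OF A] \<open>0 < c\<close> by simp
  obtain p where p: "uniform_limit {c * a..c * b} (\<lambda>k. poly (p k)) f sequentially"
    using weierstrass_poly_limit[OF f] .
  have eq: "(\<lambda>k. poly (pcompose (p k) [:0, c:])) = (\<lambda>k t. poly (p k) (c * t))"
    by (intro ext) (simp add: poly_pcompose mult.commute)
  have "uniform_limit {a..b} (\<lambda>k. poly (pcompose (p k) [:0, c:])) (\<lambda>t. f (c * t)) sequentially"
    unfolding eq using uniform_limit_compose'[OF p, where B = "{a..b}" and h = "\<lambda>t. c * t"] \<open>0 < c\<close>
    by simp
  from cfc_tendsto[OF A this] cfc_tendsto[OF cA p] show ?thesis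
    unfolding poly_op_pcompose_scale by (rule LIMSEQ_unique[symmetric])
qed

lemma cfc_scalar: "continuous_on {c..c} f \<Longrightarrow> cfc f (c *\<^sub>R id_blinfun) = f c *\<^sub>R id_blinfun"
proof -
  have A: "op_between c c (c *\<^sub>R id_blinfun :: 'a \<Rightarrow>\<^sub>L 'a)"
    by (simp add: op_between_def hermitian_op_scaleR hermitian_op_id blinfun.scaleR_left)
  assume "continuous_on {c..c} f"
  then have "cfc f (c *\<^sub>R id_blinfun :: 'a \<Rightarrow>\<^sub>L 'a) = cfc (\<lambda>_. f c) (c *\<^sub>R id_blinfun)"
    by (intro cfc_cong[OF A]) auto
  then show "cfc f (c *\<^sub>R id_blinfun :: 'a \<Rightarrow>\<^sub>L 'a) = f c *\<^sub>R id_blinfun"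
    by (simp only: cfc_const[OF A])
qed

section \<open>Strong convergence\<close>

text \<open>The topology is pulled back from pointwise convergence along
  \<open>blinfun_apply\<close>, so all later limits are limits of vector sequences.\<close>

lemma sot_lim_iff: "sot_lim T L \<longleftrightarrow> (\<forall>x. (\<lambda>k. blinfun_apply (T k) x) \<longlonglongrightarrow> blinfun_apply L x)"
proof
  assume "sot_lim T L"
  then have "limitin euclidean ((\<lambda>f. blinfun_apply f x) \<circ> T) (blinfun_apply L x) sequentially" for x
    unfolding sot_lim_def
    by (rule continuous_map_limit[OF strong_operator_topology_continuous_evaluation])
  then show "\<forall>x. (\<lambda>k. blinfun_apply (T k) x) \<longlonglongrightarrow> blinfun_apply L x"
    by (simp add: o_def)
next
  assume "\<forall>x. (\<lambda>k. blinfun_apply (T k) x) \<longlonglongrightarrow> blinfun_apply L x"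
  then have "limitin (product_topology (\<lambda>i. euclidean) UNIV) (\<lambda>k. blinfun_apply (T k)) (blinfun_apply L) sequentially"
    by (subst limitin_componentwise) auto
  then have lim: "(\<lambda>k. blinfun_apply (T k)) \<longlonglongrightarrow> blinfun_apply L"
    by (simp add: euclidean_product_topology)
  have "\<forall>\<^sub>F k in sequentially. T k \<in> U" if "openin strong_operator_topology U" "L \<in> U" for U
  proof -
    from that(1) obtain V where V: "open V" "U = blinfun_apply -` V"
      unfolding strong_operator_topology_def openin_pullback_topology by auto
    then show ?thesis using topological_tendstoD[OF lim V(1)] that(2) by simp
  qed
  then show "sot_lim T L"
    by (simp add: sot_lim_def limitin_def strong_operator_topology_topspace)
qed

text \<open>The uniform bound C makes \<open>S k (y k - y')\<close> vanish in the limit; only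
  \<open>S k y'\<close> remains, which converges by assumption.\<close>

lemma strong_tendsto_compose:
  assumes "\<And>k. norm (S k) \<le> C" "\<And>x. (\<lambda>k. blinfun_apply (S k) x) \<longlonglongrightarrow> blinfun_apply S' x"
    "y \<longlonglongrightarrow> y'"
  shows "(\<lambda>k. blinfun_apply (S k) (y k)) \<longlonglongrightarrow> blinfun_apply S' y'"
proof -
  have "(\<lambda>k. S k (y k - y')) \<longlonglongrightarrow> 0"
  proof (rule Lim_null_comparison)
    show "\<forall>\<^sub>F k in sequentially. norm (S k (y k - y')) \<le> C * norm (y k - y')"
      using assms(1) by (intro always_eventually allI order_trans[OF norm_blinfun] mult_right_mono) auto
    have "(\<lambda>k. C * norm (y k - y')) \<longlonglongrightarrow> C * norm (y' - y')"
      by (intro tendsto_intros assms(3))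
    then show "(\<lambda>k. C * norm (y k - y')) \<longlonglongrightarrow> 0" by simp
  qed
  from tendsto_add[OF this assms(2)[of y']] show ?thesis by (simp add: blinfun.diff_right)
qed

lemma poly_op_strong_tendsto:
  assumes "\<And>k. op_between a b (A k)" "\<And>x. (\<lambda>k. blinfun_apply (A k) x) \<longlonglongrightarrow> blinfun_apply L x"
  shows "(\<lambda>k. blinfun_apply (poly_op p (A k)) x) \<longlonglongrightarrow> blinfun_apply (poly_op p L) x"
proof (induction p)
  case (pCons c p)
  have "(\<lambda>k. A k (poly_op p (A k) x)) \<longlonglongrightarrow> L (poly_op p L x)"
    by (rule strong_tendsto_compose[OF op_between_norm_le[OF assms(1)] assms(2) pCons(2)])
  from tendsto_add[OF tendsto_const[of "c *\<^sub>R x"] this] show ?case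
    by (simp add: poly_op_pCons blinfun.bilinear_simps)
qed simp

text \<open>A polynomial close to f on \<open>{a..b}\<close> is close in norm for every
  \<open>A k\<close> and for the limit simultaneously, which reduces the claim to
  polynomials.\<close>

lemma cfc_strong_tendsto:
  assumes A: "\<And>k. op_between a b (A k)" and f: "continuous_on {a..b} f"
    and lim: "\<And>x. (\<lambda>k. blinfun_apply (A k) x) \<longlonglongrightarrow> blinfun_apply L x"
  shows "(\<lambda>k. blinfun_apply (cfc f (A k)) x) \<longlonglongrightarrow> blinfun_apply (cfc f L) x"
proof (rule LIMSEQ_I)
  fix r :: real assume "0 < r"
  have L: "op_between a b L" by (rule op_between_tendsto[OF A lim])
  \<comment> \<open>The approximation costs 2 e |x|, at most r/4; the summand 1 allows x = 0. Three
    errors of at most r/4 stay below r.\<close>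
  define e where "e = r / (8 * (norm x + 1))"
  have n: "0 < norm x + 1" by (simp add: add_nonneg_pos)
  have e: "0 < e" using \<open>0 < r\<close> n by (simp add: e_def)
  have ex: "2 * e * norm x \<le> r / 4"
  proof -
    have "2 * e * norm x \<le> 2 * e * (norm x + 1)" using e by simp
    also have "\<dots> = r / 4" using n by (simp add: e_def field_simps)
    finally show ?thesis .
  qed
  obtain p where p: "\<And>t. t \<in> {a..b} \<Longrightarrow> \<bar>f t - poly p t\<bar> < e"
    using weierstrass_poly[OF f e] by blast
  have approx: "norm (cfc f B x - poly_op p B x) \<le> r / 4" if "op_between a b B" for B :: "'a \<Rightarrow>\<^sub>L 'a"
  proof -
    have "norm ((cfc f B - poly_op p B) x) \<le> norm (cfc f B - poly_op p B) * norm x" by (rule norm_blinfun)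
    also have "\<dots> \<le> 2 * e * norm x" by (intro mult_right_mono cfc_poly_approx[OF that f p e]) auto
    finally show ?thesis using ex by (simp add: blinfun.diff_left)
  qed
  obtain K where K: "\<And>k. k \<ge> K \<Longrightarrow> norm (poly_op p (A k) x - poly_op p L x) < r / 4"
    using LIMSEQ_D[OF poly_op_strong_tendsto[OF A lim, of p x], of "r / 4"] \<open>0 < r\<close> by auto
  have "norm (cfc f (A k) x - cfc f L x) < r" if "k \<ge> K" for k
  proof -
    define u v w where "u = cfc f (A k) x - poly_op p (A k) x"
      and "v = poly_op p (A k) x - poly_op p L x" and "w = cfc f L x - poly_op p L x"
    have "cfc f (A k) x - cfc f L x = u + v - w" by (simp add: u_def v_def w_def)
    then have "norm (cfc f (A k) x - cfc f L x) \<le> norm u + norm v + norm w"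
      using norm_triangle_ineq4[of "u + v" w] norm_triangle_ineq[of u v] by simp
    then show ?thesis using approx[OF A, of k] approx[OF L] K[OF that] \<open>0 < r\<close>
      unfolding u_def v_def w_def by linarith
  qed
  then show "\<exists>K. \<forall>k\<ge>K. norm (cfc f (A k) x - cfc f L x) < r" by blast
qed

section \<open>Operator monotonicity on arbitrary Hilbert spaces\<close>

lemma cinner_zero_left: "cinner 0 y = 0"
  using cinner_add_left[of 0 0 y] by simp

lemma inner_scaleC_left: "inner (c *\<^sub>C x) y = Re (cnj c * cinner x y)"
  by (simp add: inner_eq_Re_cinner cinner_scaleC_left)

lemma cmod_cinner_le: "cmod (cinner x y) \<le> norm x * norm y"
proof -
  define c where "c = cinner x y"
  have "(cmod c)\<^sup>2 = inner x (cnj c *\<^sub>C y)"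
    by (simp add: inner_scaleC_right c_def cmod_power2 flip: power2_eq_square)
  also have "\<dots> \<le> norm x * norm (cnj c *\<^sub>C y)" by (rule norm_cauchy_schwarz)
  also have "\<dots> = cmod c * (norm x * norm y)" by (simp add: norm_scaleC)
  finally have "cmod c * cmod c \<le> cmod c * (norm x * norm y)" by (simp add: power2_eq_square)
  then show ?thesis
    unfolding c_def[symmetric]
    by (metis mult_le_cancel_left_pos mult_nonneg_nonneg norm_ge_zero not_less not_le order_le_less)
qed

text \<open>The operator |u><v| of Dirac notation. Two spaces are allowed because it extends maps
  between H and \<open>ell2\<close>; for a unit vector e, \<open>rank_one e e\<close> is the
  projection onto its line.\<close>

definition rank_one :: "'a::complex_hilbert \<Rightarrow> 'b::complex_hilbert \<Rightarrow> 'b \<Rightarrow>\<^sub>L 'a" where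
  "rank_one u v = Blinfun (\<lambda>x. cinner v x *\<^sub>C u)"

lemma cinner_scaleR_right: "cinner x (r *\<^sub>R y) = of_real r * cinner x y"
  by (metis cinner_scaleC_right scaleC_of_real)

lemma rank_one_apply [simp]: "blinfun_apply (rank_one u v) x = cinner v x *\<^sub>C u"
proof -
  have "bounded_linear (\<lambda>x. cinner v x *\<^sub>C u)"
  proof (rule bounded_linear_intro)
    show "cinner v (x + y) *\<^sub>C u = cinner v x *\<^sub>C u + cinner v y *\<^sub>C u" for x y
      by (simp add: cinner_add_right scaleC_add_left)
    show "cinner v (r *\<^sub>R x) *\<^sub>C u = r *\<^sub>R (cinner v x *\<^sub>C u)" for r x
      by (simp add: cinner_scaleR_right scaleC_scaleC[symmetric] scaleC_of_real)
    show "norm (cinner v x *\<^sub>C u) \<le> norm x * (norm v * norm u)" for x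
      using mult_right_mono[OF cmod_cinner_le[of v x], of "norm u"] by (simp add: norm_scaleC mult_ac)
  qed
  then show ?thesis by (simp add: rank_one_def bounded_linear_Blinfun_apply)
qed

lemma rank_one_adjoint: "inner (blinfun_apply (rank_one u v) x) y = inner x (blinfun_apply (rank_one v u) y)"
  using cinner_commute[of v x] by (simp add: inner_scaleC_left inner_scaleC_right)

lemma rank_one_scaleC: "blinfun_apply (rank_one u v) (c *\<^sub>C x) = c *\<^sub>C blinfun_apply (rank_one u v) x"
  by (simp add: cinner_scaleC_right scaleC_scaleC)

lift_definition ell2_basis :: "nat \<Rightarrow> ell2" is "\<lambda>n i. if i = n then 1 else 0"
  by (rule summable_finite[of "{_}"]) auto

lemma cinner_ell2_basis: "cinner (ell2_basis n) x = ell2_nth x n"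
  unfolding cinner_ell2_def
  by (subst suminf_finite[of "{n}"]) (auto simp: ell2_basis.rep_eq)

lemma cinner_ell2_basis_basis: "cinner (ell2_basis m) (ell2_basis n) = (if m = n then 1 else 0)"
  by (simp add: cinner_ell2_basis ell2_basis.rep_eq)

lemma norm_ell2_basis: "norm (ell2_basis n) = 1"
  by (simp add: norm_eq_sqrt_inner inner_eq_Re_cinner cinner_ell2_basis_basis)

lemma cinner_adjoint:
  assumes "\<And>x y. inner (blinfun_apply W x) y = inner x (blinfun_apply V y)"
    and "\<And>c y. blinfun_apply V (c *\<^sub>C y) = c *\<^sub>C blinfun_apply V y"
  shows "cinner (blinfun_apply W x) y = cinner x (blinfun_apply V y)"
  by (simp add: cinner_conv_inner assms)

text \<open>Gram--Schmidt, by induction on \<open>F\<close>: the vectors \<open>ell2_basis i\<close> with \<open>i \<ge> m\<close> are still unused.\<close>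

lemma finite_embedding_ell2:
  fixes F :: "'h::complex_hilbert set"
  assumes "finite F"
  shows "\<exists>(W :: 'h \<Rightarrow>\<^sub>L ell2) (V :: ell2 \<Rightarrow>\<^sub>L 'h). (\<forall>c x. W (c *\<^sub>C x) = c *\<^sub>C W x) \<and> (\<forall>c y. V (c *\<^sub>C y) = c *\<^sub>C V y) \<and>
    (\<forall>x y. inner (W x) y = inner x (V y)) \<and> (\<forall>x. W (V (W x)) = W x) \<and>
    (\<exists>m. \<forall>i\<ge>m. V (ell2_basis i) = 0) \<and> (\<forall>v\<in>F. V (W v) = v)"
  using assms
proof (induction F)
  case empty
  show ?case by (intro exI[of _ "0 :: 'h \<Rightarrow>\<^sub>L ell2"] exI[of _ "0 :: ell2 \<Rightarrow>\<^sub>L 'h"]) simp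
next
  case (insert v F)
  then obtain W :: "'h \<Rightarrow>\<^sub>L ell2" and V :: "ell2 \<Rightarrow>\<^sub>L 'h" and m where
    Wc: "\<And>c x. W (c *\<^sub>C x) = c *\<^sub>C W x" and Vc: "\<And>c y. V (c *\<^sub>C y) = c *\<^sub>C V y" and
    adj: "\<And>x y. inner (W x) y = inner x (V y)" and WVW: "\<And>x. W (V (W x)) = W x" and
    m: "\<And>i. i \<ge> m \<Longrightarrow> V (ell2_basis i) = 0" and F: "\<And>v. v \<in> F \<Longrightarrow> V (W v) = v"
    by blast
  \<comment> \<open>V W is the orthogonal projection onto the part of the space already embedded,
    and u is the component of v outside it.\<close>
  define u where "u = v - V (W v)"
  show ?case
  proof (cases "u = 0")
    case True
    then have "V (W v) = v" by (simp add: u_def)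
    then show ?thesis using Wc Vc adj WVW m F by (intro exI[of _ W] exI[of _ V]) auto
  next
    case False
    define e where "e = (1 / norm u) *\<^sub>R u"
    define d where "d = ell2_basis m"
    have cadj: "cinner (W x) y = cinner x (V y)" for x y by (rule cinner_adjoint[OF adj Vc])
    have cadj': "cinner y (W x) = cinner (V y) x" for x y
      using cadj[of x y] cinner_commute by metis
    have We: "W e = 0" by (simp add: e_def u_def blinfun.bilinear_simps WVW)
    have eV: "cinner e (V y) = 0" for y
      using cadj[of e y] by (simp add: We cinner_zero_left)
    have Vd: "V d = 0" by (simp add: d_def m)
    have dW: "cinner d (W x) = 0" for x
      by (simp add: cadj' Vd cinner_zero_left)
    have ee: "cinner e e = 1" using False by (simp add: cinner_self e_def dot_square_norm power2_eq_square)
    have dd: "cinner d d = 1" by (simp add: d_def cinner_ell2_basis_basis)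
    have z1: "0 *\<^sub>C x = 0" for x :: 'h using scaleC_of_real[of 0 x] by simp
    have z2: "0 *\<^sub>C x = 0" for x :: ell2 using scaleC_of_real[of 0 x] by simp
    have o1: "1 *\<^sub>C x = x" for x :: 'h using scaleC_of_real[of 1 x] by simp
    \<comment> \<open>The partial isometry W is extended by sending the unit vector e to the fresh
      basis vector d; V' is the adjoint of W'.\<close>
    define W' where "W' = W + rank_one d e"
    define V' where "V' = V + rank_one e d"
    have W': "W' x = W x + cinner e x *\<^sub>C d" for x by (simp add: W'_def blinfun.add_left)
    have V': "V' y = V y + cinner d y *\<^sub>C e" for y by (simp add: V'_def blinfun.add_left)
    have V'W': "V' (W' x) = V (W x) + cinner e x *\<^sub>C e" for x
      by (simp add: W' V' blinfun.add_right Vc Vd dW cinner_add_right cinner_scaleC_right dd z1 o1)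
    show ?thesis
    proof (intro exI conjI allI ballI impI)
      show "W' (c *\<^sub>C x) = c *\<^sub>C W' x" for c x
        by (simp add: W' Wc cinner_scaleC_right scaleC_add_right scaleC_scaleC)
      show "V' (c *\<^sub>C x) = c *\<^sub>C V' x" for c x
        by (simp add: V' Vc cinner_scaleC_right scaleC_add_right scaleC_scaleC)
      show "inner (W' x) y = inner x (V' y)" for x y
        using adj rank_one_adjoint[of d e x y]
        by (simp add: W'_def V'_def blinfun.add_left inner_add_left inner_add_right)
      show "W' (V' (W' x)) = W' x" for x
        unfolding W'[of "V' (W' x)"] V'W'
        by (simp add: W' blinfun.add_right Wc We WVW eV cinner_add_right cinner_scaleC_right ee z1 z2)
      show "V' (ell2_basis i) = 0" if "Suc m \<le> i" for i
        using that z1[of e] by (simp add: V' m d_def cinner_ell2_basis_basis del: scaleC_zero_right)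
      show "V' (W' w) = w" if "w \<in> insert v F" for w
      proof (cases "w = v")
        case True
        have "v = u + V (W v)" by (simp add: u_def)
        then have "cinner e v = cinner e u" using eV by (metis add.right_neutral cinner_add_right)
        also have "\<dots> = norm u"
        proof -
          have "u = norm u *\<^sub>R e" using False by (simp add: e_def)
          then show ?thesis using cinner_scaleR_right[of e "norm u" e] ee by simp
        qed
        finally have "cinner e v *\<^sub>C e = norm u *\<^sub>R e" by (simp add: scaleC_of_real)
        also have "\<dots> = u" using False by (simp add: e_def)
        finally show ?thesis using True by (simp add: V'W' u_def)
      next
        case False
        then have "V (W w) = w" using that F by auto
        then show ?thesis using eV[of "W w"] by (simp add: V'W' z1)
      qed
    qed
  qed
qed

lemma poly_op_apply: "blinfun_apply (poly_op p A) x = (\<Sum>i\<le>degree p. coeff p i *\<^sub>R (blinfun_apply A ^^ i) x)"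
proof -
  have "blinfun_apply (((\<lambda>T. A o\<^sub>L T) ^^ i) id_blinfun) x = (blinfun_apply A ^^ i) x" for i
    by (induction i) simp_all
  then show ?thesis
    by (simp add: poly_op_def blinfun.sum_left blinfun.scaleR_left)
qed

lemma cfc_poly_approx_inner:
  assumes "op_between a b A" "continuous_on {a..b} f"
    "\<And>t. t \<in> {a..b} \<Longrightarrow> \<bar>f t - poly p t\<bar> < e" "0 < e"
  shows "\<bar>inner x (blinfun_apply (cfc f A) x) - inner x (blinfun_apply (poly_op p A) x)\<bar> \<le> 2 * e * inner x x"
proof -
  have "\<bar>inner x ((cfc f A - poly_op p A) x)\<bar> \<le> norm x * norm ((cfc f A - poly_op p A) x)"
    by (rule Cauchy_Schwarz_ineq2)
  also have "\<dots> \<le> norm x * (2 * e * norm x)"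
    by (intro mult_left_mono order_trans[OF norm_blinfun] mult_right_mono cfc_poly_approx[OF assms]) auto
  finally show ?thesis
    by (simp add: blinfun.diff_left inner_diff_right dot_square_norm power2_eq_square mult_ac)
qed

text \<open>Only finitely many vectors \<open>A\<^sup>i x\<close>, \<open>B\<^sup>i x\<close> are seen by a polynomial approximating \<open>f\<close>, so
  the inequality is inherited from a compression of \<open>A\<close>, \<open>B\<close> living on \<open>\<ell>\<^sup>2\<close>.\<close>

lemma operator_monotoneD:
  fixes A B :: "'h::complex_hilbert \<Rightarrow>\<^sub>L 'h"
  assumes f: "operator_monotone f" and A: "positive_op A" and B: "positive_op B" and AB: "A \<le>\<^sub>o\<^sub>p B"
  shows "cfc f A \<le>\<^sub>o\<^sub>p cfc f B"
proof -
  define b where "b = max (norm A) (norm B)"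
  have b: "0 \<le> b" by (simp add: b_def le_max_iff_disj)
  have bA: "op_between 0 b A" and bB: "op_between 0 b B"
    using positive_op_between[OF A] positive_op_between[OF B]
    by (auto simp: b_def intro: op_between_mono)
  have cont: "continuous_on {0..b} f"
    using f by (auto simp: operator_monotone_def intro: continuous_on_subset)
  have "inner x (cfc f A x) \<le> inner x (cfc f B x)" for x
  proof (rule field_le_epsilon)
    fix r :: real assume "0 < r"
    \<comment> \<open>A polynomial replaces f four times, for A, for B and for their compressions,
      with an error of 2 e |x|^2 each.\<close>
    define e where "e = r / (8 * (inner x x + 1))"
    have n: "0 < inner x x + 1" by (simp add: add_nonneg_pos)
    have e: "0 < e" using \<open>0 < r\<close> n by (simp add: e_def)
    have "8 * e * inner x x \<le> 8 * e * (inner x x + 1)" using e by simp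
    also have "\<dots> = r" using n by (simp add: e_def field_simps)
    finally have er: "8 * e * inner x x \<le> r" .
    obtain p where p: "\<And>t. t \<in> {0..b} \<Longrightarrow> \<bar>f t - poly p t\<bar> < e"
      using weierstrass_poly[OF cont e] by blast
    define F where "F = (\<lambda>i. (blinfun_apply A ^^ i) x) ` {..degree p} \<union> (\<lambda>i. (blinfun_apply B ^^ i) x) ` {..degree p}"
    have "finite F" by (simp add: F_def)
    from finite_embedding_ell2[OF this] obtain W :: "'h \<Rightarrow>\<^sub>L ell2" and V :: "ell2 \<Rightarrow>\<^sub>L 'h" where
      Wc: "\<And>c x. W (c *\<^sub>C x) = c *\<^sub>C W x" and Vc: "\<And>c y. V (c *\<^sub>C y) = c *\<^sub>C V y" and
      adj: "\<And>x y. inner (W x) y = inner x (V y)" and WVW: "\<And>x. W (V (W x)) = W x" and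
      F: "\<And>v. v \<in> F \<Longrightarrow> V (W v) = v"
      by blast
    have "x \<in> F" unfolding F_def by (auto intro!: image_eqI[of _ _ 0])
    then have VWx: "V (W x) = x" by (rule F)
    have Wx: "inner (W x) (W x) = inner x x" using adj[of x "W x"] VWx by simp
    \<comment> \<open>W V is an orthogonal projection, so V is a contraction. Compressions therefore
      stay in the interval {0..b}, on which p approximates f.\<close>
    have V_le: "inner (V y) (V y) \<le> inner y y" for y
    proof -
      define z where "z = W (V y)"
      have VV: "inner (V y) (V y) = inner z y" using adj[of "V y" y] by (simp add: z_def inner_commute)
      have "inner z z = inner y z"
        using adj[of "V y" z] adj[of "V z" y] WVW[of "V y"] by (simp add: z_def inner_commute)
      moreover have "0 \<le> inner (z - y) (z - y)" by simp
      ultimately show ?thesis unfolding VV by (simp add: inner_diff_left inner_diff_right inner_commute)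
    qed
    have compr: "op_between 0 b (W o\<^sub>L C o\<^sub>L V)" if C: "op_between 0 b C" for C
    proof -
      have "W o\<^sub>L C o\<^sub>L V \<in> bounded_ops"
        using hermitian_op_bounded[OF op_between_hermitian[OF C]] by (simp add: bounded_ops_def Wc Vc)
      then have "hermitian_op (W o\<^sub>L C o\<^sub>L V)"
        using hermitian_op_inner[OF op_between_hermitian[OF C]] adj
        by (intro hermitian_opI) (simp_all add: adj, metis adj inner_commute)
      moreover have "inner y (W (C (V y))) = inner (V y) (C (V y))" for y
        using adj[of "C (V y)" y] by (simp add: inner_commute)
      moreover have "inner (V y) (C (V y)) \<le> b * inner y y" for y
        using op_between_upper[OF C, of "V y"] mult_left_mono[OF V_le[of y] b] by linarith
      ultimately show ?thesis using op_between_lower[OF C] by (simp add: op_between_def)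
    qed
    \<comment> \<open>As V W fixes the vectors of the orbit of x under C, applying the compression i
      times to W x amounts to applying C i times to x and then W.\<close>
    have poly_compr: "inner (W x) (poly_op p (W o\<^sub>L C o\<^sub>L V) (W x)) = inner x (poly_op p C x)"
      if C: "\<And>i. i \<le> degree p \<Longrightarrow> V (W ((blinfun_apply C ^^ i) x)) = (blinfun_apply C ^^ i) x" for C
    proof -
      have "(blinfun_apply (W o\<^sub>L C o\<^sub>L V) ^^ i) (W x) = W ((blinfun_apply C ^^ i) x)" if "i \<le> degree p" for i
        using that by (induction i) (simp_all add: C)
      then have "poly_op p (W o\<^sub>L C o\<^sub>L V) (W x) = W (poly_op p C x)"
        by (simp add: poly_op_apply blinfun.sum_right blinfun.scaleR_right)
      then show ?thesis using adj[of "poly_op p C x" "W x"] VWx by (simp add: inner_commute)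
    qed
    have FA: "V (W ((blinfun_apply A ^^ i) x)) = (blinfun_apply A ^^ i) x"
      and FB: "V (W ((blinfun_apply B ^^ i) x)) = (blinfun_apply B ^^ i) x" if "i \<le> degree p" for i
      using that F unfolding F_def by blast+
    have approx: "\<bar>inner x (cfc f C x) - inner (W x) (cfc f (W o\<^sub>L C o\<^sub>L V) (W x))\<bar> \<le> 4 * e * inner x x"
      if C: "op_between 0 b C" and i: "\<And>i. i \<le> degree p \<Longrightarrow> V (W ((blinfun_apply C ^^ i) x)) = (blinfun_apply C ^^ i) x" for C
    proof -
      have "inner (W x) (poly_op p (W o\<^sub>L C o\<^sub>L V) (W x)) = inner x (poly_op p C x)"
        by (rule poly_compr) (rule i)
      then show ?thesis
        using cfc_poly_approx_inner[OF C cont _ e, of p x] cfc_poly_approx_inner[OF compr[OF C] cont _ e, of p "W x"] p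
        by (simp add: abs_le_iff Wx)
    qed
    have "W o\<^sub>L A o\<^sub>L V \<le>\<^sub>o\<^sub>p W o\<^sub>L B o\<^sub>L V"
      using op_le_inner[OF AB] adj[of "A (V _)"] adj[of "B (V _)"]
      by (subst op_le_iff) (auto simp: op_between_hermitian[OF compr] bA bB inner_commute)
    then have "cfc f (W o\<^sub>L A o\<^sub>L V) \<le>\<^sub>o\<^sub>p cfc f (W o\<^sub>L B o\<^sub>L V)"
      using f op_between_positive[OF compr[OF bA]] op_between_positive[OF compr[OF bB]]
      by (simp add: operator_monotone_def)
    from op_le_inner[OF this, of "W x"] show "inner x (cfc f A x) \<le> inner x (cfc f B x) + r"
      using approx[OF bA FA] approx[OF bB FB] er by linarith
  qed
  then show ?thesis
    by (simp add: op_le_iff cfc_hermitian[OF bA cont] cfc_hermitian[OF bB cont])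
qed

section \<open>Hansen's inequality\<close>

text \<open>The Hilbert space direct sum, on which the dilation in
  \<open>hansen_inequality_aux\<close> lives.\<close>

instantiation prod :: (complex_hilbert, complex_hilbert) complex_hilbert
begin

definition scaleC_prod :: "complex \<Rightarrow> 'a \<times> 'b \<Rightarrow> 'a \<times> 'b" where
  "scaleC_prod c z = (c *\<^sub>C fst z, c *\<^sub>C snd z)"

definition cinner_prod :: "'a \<times> 'b \<Rightarrow> 'a \<times> 'b \<Rightarrow> complex" where
  "cinner_prod z w = cinner (fst z) (fst w) + cinner (snd z) (snd w)"

instance
proof
  fix x y z :: "'a \<times> 'b" and c d :: complex and r :: real
  show "c *\<^sub>C (x + y) = c *\<^sub>C x + c *\<^sub>C y" "(c + d) *\<^sub>C x = c *\<^sub>C x + d *\<^sub>C x"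
    "c *\<^sub>C (d *\<^sub>C x) = (c * d) *\<^sub>C x" "complex_of_real r *\<^sub>C x = r *\<^sub>R x"
    by (simp_all add: scaleC_prod_def scaleC_add_right scaleC_add_left scaleC_scaleC scaleC_of_real
        prod_eq_iff)
  show "cinner x y = cnj (cinner y x)"
    using cinner_commute[of "fst x" "fst y"] cinner_commute[of "snd x" "snd y"]
    by (simp add: cinner_prod_def)
  show "cinner x (y + z) = cinner x y + cinner x z" "cinner x (c *\<^sub>C y) = c * cinner x y"
    by (simp_all add: cinner_prod_def scaleC_prod_def cinner_add_right cinner_scaleC_right distrib_left)
  show "inner x y = Re (cinner x y)"
    by (simp add: cinner_prod_def inner_prod_def inner_eq_Re_cinner)
qed

end

definition inl_blinfun :: "'a::real_normed_vector \<Rightarrow>\<^sub>L ('a \<times> 'b::real_normed_vector)" where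
  "inl_blinfun = Blinfun (\<lambda>x. (x, 0))"

definition inr_blinfun :: "'b::real_normed_vector \<Rightarrow>\<^sub>L ('a::real_normed_vector \<times> 'b)" where
  "inr_blinfun = Blinfun (\<lambda>x. (0, x))"

lemma inl_blinfun_apply [simp]: "blinfun_apply inl_blinfun x = (x, 0)"
  unfolding inl_blinfun_def
  by (subst bounded_linear_Blinfun_apply) (auto intro!: bounded_linear_Pair bounded_linear_ident bounded_linear_zero)

lemma inr_blinfun_apply [simp]: "blinfun_apply inr_blinfun x = (0, x)"
  unfolding inr_blinfun_def
  by (subst bounded_linear_Blinfun_apply) (auto intro!: bounded_linear_Pair bounded_linear_ident bounded_linear_zero)

lemma op_between_conj:
  assumes A: "op_between 0 b A" and "0 \<le> b" and K: "K \<in> bounded_ops" "K' \<in> bounded_ops"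
    and adj: "\<And>x y. inner (blinfun_apply K x) y = inner x (blinfun_apply K' y)"
    and contr: "\<And>x. inner (blinfun_apply K x) (blinfun_apply K x) \<le> inner x x"
  shows "op_between 0 b (K' o\<^sub>L A o\<^sub>L K)"
proof -
  have adj': "inner (K' x) y = inner x (K y)" for x y
    using adj[of y x] by (simp add: inner_commute)
  have "hermitian_op (K' o\<^sub>L A o\<^sub>L K)"
  proof (rule hermitian_opI)
    show "K' o\<^sub>L A o\<^sub>L K \<in> bounded_ops"
      using K hermitian_op_bounded[OF op_between_hermitian[OF A]] by (simp add: bounded_ops_def)
    show "inner ((K' o\<^sub>L A o\<^sub>L K) x) y = inner x ((K' o\<^sub>L A o\<^sub>L K) y)" for x y
      by (simp add: adj' adj[symmetric] hermitian_op_inner[OF op_between_hermitian[OF A]])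
  qed
  moreover have "inner x (K' (A (K x))) = inner (K x) (A (K x))" for x
    by (rule adj[symmetric])
  moreover have "inner (K x) (A (K x)) \<le> b * inner x x" for x
    using op_between_upper[OF A, of "K x"] mult_left_mono[OF contr[of x] \<open>0 \<le> b\<close>] by linarith
  ultimately show ?thesis using op_between_lower[OF A] by (simp add: op_between_def)
qed

text \<open>\<open>V x = (K x, D x)\<close> with \<open>D = (1 - K\<^sup>*K)\<^sup>1\<^sup>/\<^sup>2\<close> is an isometry. With \<open>P = V V\<^sup>*\<close>, \<open>Q = 1 - P\<close>
  and \<open>T = A \<oplus> 0\<close> one has \<open>T \<le> (1 + e) P T P + (1 + 1/e) Q T Q\<close>, and the range of \<open>V\<close> reduces
  the right-hand side to \<open>(1 + e) K\<^sup>* A K\<close>.\<close>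

lemma hansen_inequality_aux:
  fixes A K K' :: "'h::complex_hilbert \<Rightarrow>\<^sub>L 'h"
  assumes f: "operator_monotone f" "0 \<le> f 0" and A: "op_between 0 b A" and b: "0 \<le> b"
    and K: "K \<in> bounded_ops" "K' \<in> bounded_ops"
    and adj: "\<And>x y. inner (blinfun_apply K x) y = inner x (blinfun_apply K' y)"
    and contr: "\<And>x. inner (blinfun_apply K x) (blinfun_apply K x) \<le> inner x x" and e: "0 < e"
  shows "inner (blinfun_apply K x) (blinfun_apply (cfc f A) (blinfun_apply K x))
    \<le> inner x (blinfun_apply (cfc f ((1 + e) *\<^sub>R (K' o\<^sub>L A o\<^sub>L K))) x)"
proof -
  have cont: "continuous_on {0..c} f" for c
    using f(1) by (auto simp: operator_monotone_def intro: continuous_on_subset)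
  define S where "S = K' o\<^sub>L A o\<^sub>L K"
  have S: "op_between 0 b S" unfolding S_def by (rule op_between_conj) (fact A b K adj contr)+
  define G where "G = id_blinfun - (K' o\<^sub>L K)"
  have "op_between 0 1 (id_blinfun :: 'h \<Rightarrow>\<^sub>L 'h)" by (simp add: op_between_def hermitian_op_id)
  from op_between_conj[OF this _ K adj contr] have KK: "op_between 0 1 (K' o\<^sub>L K)"
    by (simp add: blinfun_compose_simps)
  then have G: "op_between 0 1 G"
    unfolding op_between_def G_def
    by (auto simp: hermitian_op_diff hermitian_op_id blinfun.diff_left inner_diff_right)
  define D where "D = cfc sqrt G"
  have csq: "continuous_on {0..1} sqrt" by (intro continuous_intros)
  have D: "hermitian_op D" unfolding D_def by (rule cfc_hermitian[OF G csq])
  have "cfc (\<lambda>t. sqrt t * sqrt t) G = cfc (\<lambda>t. t) G"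
    by (rule cfc_cong[OF G]) (auto intro!: continuous_intros)
  then have "D o\<^sub>L D = G" unfolding D_def cfc_mult[OF G csq csq] cfc_ident[OF G] .
  then have DD: "D (D x) = x - K' (K x)" for x
  proof -
    have "(D o\<^sub>L D) x = G x" by (simp only: \<open>D o\<^sub>L D = G\<close>)
    then show ?thesis by (simp add: G_def blinfun.diff_left)
  qed
  define V :: "'h \<Rightarrow>\<^sub>L ('h \<times> 'h)" where "V = (inl_blinfun o\<^sub>L K) + (inr_blinfun o\<^sub>L D)"
  define V' :: "('h \<times> 'h) \<Rightarrow>\<^sub>L 'h" where "V' = (K' o\<^sub>L fst_blinfun) + (D o\<^sub>L snd_blinfun)"
  have V: "V x = (K x, D x)" for x by (simp add: V_def blinfun.add_left)
  have V': "V' z = K' (fst z) + D (snd z)" for z by (simp add: V'_def blinfun.add_left)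
  have V'V: "V' (V x) = x" for x by (simp add: V V' DD)
  have adjV: "inner (V x) z = inner x (V' z)" for x z
    by (simp add: V V' inner_prod_def adj hermitian_op_inner[OF D] inner_add_right)
  have adjV': "inner (V' z) x = inner z (V x)" for x z
    using adjV[of x z] by (simp add: inner_commute)
  have Kc: "K (c *\<^sub>C x) = c *\<^sub>C K x" "K' (c *\<^sub>C x) = c *\<^sub>C K' x" "D (c *\<^sub>C x) = c *\<^sub>C D x"
    "A (c *\<^sub>C x) = c *\<^sub>C A x" for c x
    using K hermitian_op_bounded[OF D] hermitian_op_bounded[OF op_between_hermitian[OF A]]
    by (simp_all add: bounded_ops_def)
  define P where "P = V o\<^sub>L V'"
  define Q where "Q = id_blinfun - P"
  have P: "hermitian_op P"
  proof (rule hermitian_opI)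
    show "P \<in> bounded_ops"
      by (simp add: bounded_ops_def P_def V V' scaleC_prod_def Kc blinfun.add_right scaleC_add_right)
  qed (simp add: P_def adjV adjV')
  then have Q: "hermitian_op Q" by (simp add: Q_def hermitian_op_diff hermitian_op_id)
  define T :: "('h \<times> 'h) \<Rightarrow>\<^sub>L ('h \<times> 'h)" where "T = inl_blinfun o\<^sub>L A o\<^sub>L fst_blinfun"
  have Tz: "T z = (A (fst z), 0)" for z by (simp add: T_def)
  have Th: "hermitian_op T"
  proof (rule hermitian_opI)
    show "T \<in> bounded_ops" by (simp add: bounded_ops_def Tz scaleC_prod_def Kc)
  qed (simp add: Tz inner_prod_def hermitian_op_inner[OF op_between_hermitian[OF A]])
  have Tpos: "0 \<le> inner z (T z)" for z
    using op_between_lower[OF A, of "fst z"] by (simp add: Tz inner_prod_def)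
  have T: "positive_op T" using Th Tpos by (simp add: positive_op_iff)
  define B where "B = (1 + e) *\<^sub>R (P o\<^sub>L T o\<^sub>L P) + (1 + 1 / e) *\<^sub>R (Q o\<^sub>L T o\<^sub>L Q)"
  have Bh: "hermitian_op B"
    unfolding B_def by (intro hermitian_op_add hermitian_op_scaleR hermitian_op_sandwich P Q Th)
  have Bin: "inner z (B z) = (1 + e) * inner (P z) (T (P z)) + (1 + 1 / e) * inner (Q z) (T (Q z))" for z
    by (simp add: B_def blinfun.add_left blinfun.scaleR_left inner_add_right
        hermitian_op_inner[OF P, symmetric] hermitian_op_inner[OF Q, symmetric])
  have B: "positive_op B" using Bh Tpos e by (simp add: positive_op_iff Bin)
  have "inner z (T z) \<le> inner z (B z)" for z
  proof -
    define p q where "p = P z" and "q = Q z"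
    have z: "z = p + q" by (simp add: p_def q_def Q_def blinfun.diff_left)
    have sym: "inner q (T p) = inner p (T q)"
      using hermitian_op_inner[OF Th, of p q] by (simp add: inner_commute)
    \<comment> \<open>Divided by e, this is the Young inequality 2 <p, T q> <= e <p, T p> + <q, T
      q>/e, which removes the mixed terms.\<close>
    have "0 \<le> inner (e *\<^sub>R p - q) (T (e *\<^sub>R p - q))" by (rule Tpos)
    also have "\<dots> = e * (e * inner p (T p)) - 2 * (e * inner p (T q)) + inner q (T q)"
      by (simp add: blinfun.diff_right blinfun.scaleR_right inner_diff_left inner_diff_right sym algebra_simps)
    also have "\<dots> = e * (e * inner p (T p) - 2 * inner p (T q) + inner q (T q) / e)"
      using e by (simp add: algebra_simps)
    finally have "0 \<le> e * inner p (T p) - 2 * inner p (T q) + inner q (T q) / e"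
      using e by (simp add: zero_le_mult_iff)
    moreover have "inner z (T z) = inner p (T p) + 2 * inner p (T q) + inner q (T q)"
      by (simp add: z blinfun.add_right inner_add_left inner_add_right sym)
    ultimately show ?thesis unfolding Bin p_def[symmetric] q_def[symmetric]
      by (simp add: distrib_right)
  qed
  then have "T \<le>\<^sub>o\<^sub>p B" by (simp add: op_le_iff Th Bh)
  from operator_monotoneD[OF f(1) T B this]
  have le: "inner (V x) (cfc f T (V x)) \<le> inner (V x) (cfc f B (V x))" by (rule op_le_inner)
  \<comment> \<open>\<open>cfc_intertwine\<close> asks for one interval containing both operators; c
    serves T, B, A and (1 + e) S at once.\<close>
  define c where "c = max (norm T) (max (norm B) (max b ((1 + e) * b)))"
  have T': "op_between 0 c T" and B': "op_between 0 c B" and A': "op_between 0 c A"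
    by (rule op_between_mono[OF positive_op_between[OF T]] op_between_mono[OF positive_op_between[OF B]]
        op_between_mono[OF A], simp, simp add: c_def)+
  have S': "op_between 0 c ((1 + e) *\<^sub>R S)"
    by (rule op_between_mono[OF op_between_scaleR[OF S, of "1 + e"]]) (use e in \<open>auto simp: c_def\<close>)
  have "0 \<le> c" using b by (simp add: c_def le_max_iff_disj)
  then have Z': "op_between 0 c (0 :: 'h \<Rightarrow>\<^sub>L 'h)" by (simp add: op_between_def hermitian_op_zero)
  \<comment> \<open>T is A on the first summand and 0 on the second, so f(T) acts there as f(A) and
    f(0). The contribution f(0) |D x|^2 of the second summand is discarded below, which is where
    f(0) >= 0 enters.\<close>
  have "T o\<^sub>L inl_blinfun = inl_blinfun o\<^sub>L A" by (rule blinfun_eqI) (simp add: Tz)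
  from cfc_intertwine[OF T' A' cont this] have fTl: "cfc f T (y, 0) = (cfc f A y, 0)" for y
    by (metis blinfun_apply_blinfun_compose inl_blinfun_apply)
  have "T o\<^sub>L inr_blinfun = inr_blinfun o\<^sub>L 0" by (rule blinfun_eqI) (simp add: Tz zero_prod_def)
  from cfc_intertwine[OF T' Z' cont this] have "cfc f T (0, y) = (0, cfc f 0 y)" for y
    by (metis blinfun_apply_blinfun_compose inr_blinfun_apply)
  then have fTr: "cfc f T (0, y) = (0, f 0 *\<^sub>R y)" for y
    using cfc_scalar[of 0 f, where 'a = 'h] by (simp add: blinfun.scaleR_left)
  have "cfc f T (V x) = cfc f T ((K x, 0) + (0, D x))" by (simp add: V)
  then have "inner (V x) (cfc f T (V x)) = inner (K x) (cfc f A (K x)) + f 0 * inner (D x) (D x)"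
    unfolding blinfun.add_right fTl fTr by (simp add: V inner_prod_def)
  then have "inner (K x) (cfc f A (K x)) \<le> inner (V x) (cfc f T (V x))" using f(2) by simp
  moreover have "B o\<^sub>L V = V o\<^sub>L (1 + e) *\<^sub>R S"
  proof (rule blinfun_eqI)
    fix y
    have PV: "P (V y) = V y" for y by (simp add: P_def V'V)
    have QV: "Q (V y) = 0" for y by (simp add: Q_def blinfun.diff_left PV)
    have "V' (T (V y)) = S y" by (simp add: V' Tz V S_def)
    then have "P (T (V y)) = V (S y)" by (simp add: P_def)
    then show "(B o\<^sub>L V) y = (V o\<^sub>L (1 + e) *\<^sub>R S) y"
      by (simp add: B_def blinfun.add_left blinfun.scaleR_left blinfun.scaleR_right PV QV)
  qed
  from cfc_intertwine[OF B' S' cont this] have "cfc f B (V x) = V (cfc f ((1 + e) *\<^sub>R S) x)"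
    by (metis blinfun_apply_blinfun_compose)
  then have "inner (V x) (cfc f B (V x)) = inner x (cfc f ((1 + e) *\<^sub>R S) x)"
    by (simp add: adjV V'V)
  ultimately show ?thesis using le unfolding S_def by linarith
qed

text \<open>The factor 1 + e is removed by letting e = 1/(n+1) tend to 0: the scaled operators all
  lie in [0, 2 b], so \<open>cfc_strong_tendsto\<close> applies.\<close>

lemma hansen_inequality:
  fixes A K K' :: "'h::complex_hilbert \<Rightarrow>\<^sub>L 'h"
  assumes f: "operator_monotone f" "0 \<le> f 0" and A: "positive_op A"
    and K: "K \<in> bounded_ops" "K' \<in> bounded_ops"
    and adj: "\<And>x y. inner (blinfun_apply K x) y = inner x (blinfun_apply K' y)"
    and contr: "\<And>x. inner (blinfun_apply K x) (blinfun_apply K x) \<le> inner x x"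
  shows "inner (blinfun_apply K x) (blinfun_apply (cfc f A) (blinfun_apply K x))
    \<le> inner x (blinfun_apply (cfc f (K' o\<^sub>L A o\<^sub>L K)) x)"
proof -
  define b where "b = norm A"
  have A': "op_between 0 b A" and b: "0 \<le> b" using positive_op_between[OF A] by (simp_all add: b_def)
  define S where "S = K' o\<^sub>L A o\<^sub>L K"
  have S: "op_between 0 b S" unfolding S_def by (rule op_between_conj) (fact A' b K adj contr)+
  have "op_between 0 (2 * b) ((1 + 1 / real (Suc n)) *\<^sub>R S)" for n
    by (rule op_between_mono[OF op_between_scaleR[OF S]]) (auto intro!: mult_right_mono b)
  moreover have "continuous_on {0..2 * b} f"
    using f(1) by (auto simp: operator_monotone_def intro: continuous_on_subset)
  moreover have "(\<lambda>n. ((1 + 1 / real (Suc n)) *\<^sub>R S) x) \<longlonglongrightarrow> S x" for x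
  proof -
    have "(\<lambda>n. (1 + 1 / real (Suc n)) *\<^sub>R S x) \<longlonglongrightarrow> (1 + 0) *\<^sub>R S x"
      by (intro tendsto_intros LIMSEQ_inverse_real_of_nat[unfolded inverse_eq_divide])
    then show ?thesis by (simp add: blinfun.scaleR_left)
  qed
  ultimately have "(\<lambda>n. cfc f ((1 + 1 / real (Suc n)) *\<^sub>R S) x) \<longlonglongrightarrow> cfc f S x"
    by (rule cfc_strong_tendsto)
  then have "(\<lambda>n. inner x (cfc f ((1 + 1 / real (Suc n)) *\<^sub>R S) x)) \<longlonglongrightarrow> inner x (cfc f S x)"
    by (rule tendsto_inner[OF tendsto_const])
  then have "inner (K x) (cfc f A (K x)) \<le> inner x (cfc f S x)"
    by (rule LIMSEQ_le_const)
       (use hansen_inequality_aux[OF f A' b K adj contr] in \<open>auto simp: S_def\<close>)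
  then show ?thesis by (simp add: S_def)
qed

section \<open>Representing functions\<close>

lemma operator_monotone_cont: "operator_monotone f \<Longrightarrow> 0 \<le> a \<Longrightarrow> continuous_on {a..b} f"
  by (auto simp: operator_monotone_def intro: continuous_on_subset)

lemma op_between_scalar: "op_between c c (c *\<^sub>R id_blinfun)"
  by (simp add: op_between_def hermitian_op_scaleR hermitian_op_id blinfun.scaleR_left)

text \<open>Multiples of the identity on \<open>ell2\<close> are compared at a unit vector.\<close>

lemma operator_monotone_imp_mono:
  assumes f: "operator_monotone f" and "0 \<le> s" "s \<le> t"
  shows "f s \<le> f t"
proof -
  let ?I = "id_blinfun :: ell2 \<Rightarrow>\<^sub>L ell2"
  have "s *\<^sub>R ?I \<le>\<^sub>o\<^sub>p t *\<^sub>R ?I"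
    using assms(3)
    by (simp add: op_le_iff hermitian_op_scaleR hermitian_op_id blinfun.scaleR_left mult_right_mono)
  moreover have "positive_op (s *\<^sub>R ?I)" "positive_op (t *\<^sub>R ?I)"
    using assms by (auto intro!: op_between_positive[OF op_between_scalar])
  ultimately have "cfc f (s *\<^sub>R ?I) \<le>\<^sub>o\<^sub>p cfc f (t *\<^sub>R ?I)"
    using f by (simp add: operator_monotone_def)
  then have "inner (ell2_basis 0) ((f s *\<^sub>R ?I) (ell2_basis 0)) \<le> inner (ell2_basis 0) ((f t *\<^sub>R ?I) (ell2_basis 0))"
    using assms by (simp add: cfc_scalar operator_monotone_cont op_le_inner)
  then show ?thesis by (simp add: blinfun.scaleR_left dot_square_norm norm_ell2_basis)
qed

text \<open>Hansen's inequality for the identity and a scalar contraction K with K^2 = s I reads s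
  f(1) <= f(s). It is what keeps f positive on (0, 1].\<close>

lemma representing_function_ge:
  assumes f: "representing_function f" and s: "0 \<le> s" "s \<le> 1"
  shows "s \<le> f s"
proof -
  let ?I = "id_blinfun :: ell2 \<Rightarrow>\<^sub>L ell2"
  define K where "K = sqrt s *\<^sub>R ?I"
  have om: "operator_monotone f" "0 \<le> f 0" "f 1 = 1" using f by (simp_all add: representing_function_def)
  have "op_between 1 1 ?I" using op_between_scalar[of 1, where 'a = ell2] by simp
  then have I: "positive_op ?I" by (rule op_between_positive) simp
  have K: "K \<in> bounded_ops" by (simp add: K_def bounded_ops_scaleR bounded_ops_id)
  have ss: "sqrt s * sqrt s = s" using s by simp
  have "inner (K x) y = inner x (K y)" for x y by (simp add: K_def blinfun.scaleR_left)
  moreover have "inner (K x) (K x) \<le> inner x x" for x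
  proof -
    have "inner (K x) (K x) = s * inner x x"
      using s by (simp add: K_def blinfun.scaleR_left ss flip: mult.assoc)
    then show ?thesis using s mult_right_mono[of s 1 "inner x x"] by simp
  qed
  ultimately have "inner (K x) (cfc f ?I (K x)) \<le> inner x (cfc f (K o\<^sub>L ?I o\<^sub>L K) x)" for x
    by (rule hansen_inequality[OF om(1,2) I K K])
  moreover have "K o\<^sub>L ?I o\<^sub>L K = s *\<^sub>R ?I"
    by (rule blinfun_eqI) (use s in \<open>simp add: K_def blinfun.scaleR_left ss\<close>)
  moreover have "cfc f ?I = ?I"
    using cfc_scalar[of 1 f, where 'a = ell2] om by (simp add: operator_monotone_cont)
  ultimately have "inner (K x) (K x) \<le> inner x ((f s *\<^sub>R ?I) x)" for x
    using om s by (simp add: cfc_scalar operator_monotone_cont)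
  from this[of "ell2_basis 0"] show ?thesis
    using s by (simp add: K_def blinfun.scaleR_left dot_square_norm norm_ell2_basis ss flip: mult.assoc)
qed

lemma representing_function_pos:
  assumes "representing_function f" "0 < s"
  shows "0 < f s"
proof (cases "s \<le> 1")
  case True
  then show ?thesis using representing_function_ge[OF assms(1), of s] assms(2) by simp
next
  case False
  then show ?thesis
    using operator_monotone_imp_mono[of f 1 s] assms by (simp add: representing_function_def)
qed

section \<open>Representing functions of nontrivial means are strictly increasing\<close>

lemma cfc_rank_one_perturbation:
  fixes e :: "'h::complex_hilbert"
  assumes e: "norm e = 1" and f: "continuous_on {0..} f" and ab: "0 \<le> a" "0 \<le> b"
  shows "op_between 0 (a + b) (a *\<^sub>R id_blinfun + (b - a) *\<^sub>R rank_one e e)"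
    and "cfc f (a *\<^sub>R id_blinfun + (b - a) *\<^sub>R rank_one e e) = f a *\<^sub>R id_blinfun + (f b - f a) *\<^sub>R rank_one e e"
proof -
  define P where "P = rank_one e e"
  define R where "R = a *\<^sub>R id_blinfun + (b - a) *\<^sub>R P"
  have ee: "cinner e e = 1" using e by (simp add: cinner_self dot_square_norm)
  have PP: "P (P x) = P x" for x by (simp add: P_def cinner_scaleC_right ee)
  have P: "hermitian_op P"
    by (rule hermitian_opI) (simp_all add: P_def bounded_ops_def rank_one_scaleC rank_one_adjoint del: rank_one_apply)
  have Pin: "inner x (P x) = inner (P x) (P x)" for x
    using hermitian_op_inner[OF P, of x "P x"] by (simp add: PP)
  have Ple: "inner x (P x) \<le> inner x x" for x
  proof -
    have "0 \<le> inner (x - P x) (x - P x)" by simp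
    also have "\<dots> = inner x x - inner x (P x)"
      by (simp add: inner_diff_left inner_diff_right inner_commute[of "P x" x] Pin[symmetric])
    finally show ?thesis by simp
  qed
  have Rx: "inner x (R x) = a * (inner x x - inner x (P x)) + b * inner x (P x)" for x
    by (simp add: R_def blinfun.bilinear_simps inner_add_right algebra_simps)
  \<comment> \<open>R is b along e and a on the orthogonal complement. The upper end a + b avoids
    fixing an order between a and b.\<close>
  have R: "op_between 0 (a + b) R"
    unfolding op_between_def Rx
  proof (intro conjI allI)
    show "hermitian_op R"
      unfolding R_def by (intro hermitian_op_add hermitian_op_scaleR hermitian_op_id P)
    show "0 * inner x x \<le> a * (inner x x - inner x (P x)) + b * inner x (P x)" for x
      using ab Ple[of x] Pin[of x] by simp
    show "a * (inner x x - inner x (P x)) + b * inner x (P x) \<le> (a + b) * inner x x" for x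
      using mult_left_mono[OF Ple[of x] ab(2)] mult_nonneg_nonneg[OF ab(1), of "inner x (P x)"] Pin[of x]
      by (simp add: algebra_simps)
  qed
  then show "op_between 0 (a + b) (a *\<^sub>R id_blinfun + (b - a) *\<^sub>R rank_one e e)"
    by (simp add: R_def P_def)
  have poly: "poly_op p R = poly p a *\<^sub>R id_blinfun + (poly p b - poly p a) *\<^sub>R P" for p
  proof (induction p)
    case (pCons c p)
    show ?case
      by (rule blinfun_eqI)
         (simp add: poly_op_pCons pCons(2), simp add: R_def blinfun.bilinear_simps PP algebra_simps)
  qed simp
  obtain p where p: "uniform_limit {0..a + b} (\<lambda>k. poly (p k)) f sequentially"
    using weierstrass_poly_limit[of 0 "a + b" f] continuous_on_subset[OF f, of "{0..a + b}"] by auto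
  have pt: "(\<lambda>k. poly (p k) t) \<longlonglongrightarrow> f t" if "t \<in> {0..a + b}" for t
    by (rule tendsto_uniform_limitI[OF p that])
  have "(\<lambda>k. poly (p k) a *\<^sub>R id_blinfun + (poly (p k) b - poly (p k) a) *\<^sub>R P)
      \<longlonglongrightarrow> f a *\<^sub>R id_blinfun + (f b - f a) *\<^sub>R P"
    by (intro tendsto_intros pt) (use ab in auto)
  moreover have "(\<lambda>k. poly (p k) a *\<^sub>R id_blinfun + (poly (p k) b - poly (p k) a) *\<^sub>R P) \<longlonglongrightarrow> cfc f R"
    using cfc_tendsto[OF R p] by (simp only: poly)
  ultimately have "cfc f R = f a *\<^sub>R id_blinfun + (f b - f a) *\<^sub>R P"
    by (rule LIMSEQ_unique[rotated])
  then show "cfc f (a *\<^sub>R id_blinfun + (b - a) *\<^sub>R rank_one e e) = f a *\<^sub>R id_blinfun + (f b - f a) *\<^sub>R rank_one e e"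
    by (simp add: R_def P_def)
qed

lemma inner_rank_one_self: "inner x (blinfun_apply (rank_one e e) x) = (cmod (cinner e x))\<^sup>2"
proof -
  have "inner x (blinfun_apply (rank_one e e) x) = Re (cinner e x * cnj (cinner e x))"
    using cinner_commute[of x e] by (simp add: inner_scaleC_right)
  then show ?thesis by (simp add: complex_mult_cnj cmod_power2)
qed

text \<open>\<open>w = c e\<^sub>0 + s e\<^sub>1\<close> with a small \<open>s > 0\<close>, where \<open>e\<^sub>i = ell2_basis i\<close>.\<close>

lemma tilted_projection:
  fixes \<tau> \<delta> \<rho> :: real
  assumes "0 < \<tau>" "0 < \<delta>" "\<tau> < \<delta> + \<rho>"
  obtains w :: ell2 where "norm w = 1" "cinner w (ell2_basis (Suc 0)) \<noteq> 0"
    "\<And>x. \<tau> * (cmod (cinner w x))\<^sup>2 \<le> \<delta> * inner x x + \<rho> * (cmod (cinner (ell2_basis 0) x))\<^sup>2"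
proof -
  \<comment> \<open>The slack in \<tau> < \<delta> + \<rho> is spent on the weight 1 + \<eta> that
    the e0 term receives in the Young inequality for |c p + s q|^2.\<close>
  define \<eta> where "\<eta> = (\<delta> + \<rho> - \<tau>) / \<tau>"
  have \<eta>: "0 < \<eta>" "\<tau> * (1 + \<eta>) = \<delta> + \<rho>" using assms by (simp_all add: \<eta>_def field_simps)
  \<comment> \<open>The tilt is so small that the e1 term, which carries the weight 1 + 1/\<eta>,
    still costs at most \<delta>; the minimum with 1 keeps 1 - s2 nonnegative.\<close>
  define s2 where "s2 = min 1 (\<delta> / (\<tau> * (1 + 1 / \<eta>)))"
  have s2: "0 < s2" "s2 \<le> 1" using assms \<eta> by (simp_all add: s2_def add_pos_pos)
  have s2': "\<tau> * (1 + 1 / \<eta>) * s2 \<le> \<delta>"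
  proof -
    define g where "g = \<tau> * (1 + 1 / \<eta>)"
    have g: "0 < g" using assms \<eta> by (simp add: g_def add_pos_pos)
    have "g * s2 \<le> g * (\<delta> / g)"
      using g by (intro mult_left_mono) (simp_all add: s2_def g_def)
    then show ?thesis using g by (simp add: g_def[symmetric])
  qed
  define s c where "s = sqrt s2" and "c = sqrt (1 - s2)"
  have sc: "s\<^sup>2 = s2" "c\<^sup>2 = 1 - s2" "0 < s" using s2 by (simp_all add: s_def c_def)
  define w where "w = c *\<^sub>R ell2_basis 0 + s *\<^sub>R ell2_basis (Suc 0)"
  have wx: "cinner w x = of_real c * ell2_nth x 0 + of_real s * ell2_nth x 1" for x
    unfolding w_def cinner_add_left
    by (simp add: scaleC_of_real[symmetric] cinner_scaleC_left cinner_ell2_basis)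
  have "cinner w w = of_real (c\<^sup>2 + s\<^sup>2)"
    by (subst wx) (simp add: w_def plus_ell2.rep_eq scaleR_ell2.rep_eq ell2_basis.rep_eq power2_eq_square)
  then have "norm w = 1" by (simp add: norm_eq_sqrt_inner inner_eq_Re_cinner sc)
  moreover have "cinner w (ell2_basis (Suc 0)) \<noteq> 0"
    using sc(3) by (simp add: wx ell2_basis.rep_eq)
  moreover have "\<tau> * (cmod (cinner w x))\<^sup>2 \<le> \<delta> * inner x x + \<rho> * (cmod (cinner (ell2_basis 0) x))\<^sup>2" for x
  proof -
    define p q where "p = cmod (ell2_nth x 0)" and "q = cmod (ell2_nth x 1)"
    have "p\<^sup>2 + q\<^sup>2 \<le> inner x x"
      using ell2_sum_le_norm[of x 2] by (simp add: p_def q_def dot_square_norm numeral_2_eq_2)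
    have c0: "0 \<le> c" using s2 by (simp add: c_def)
    have "cmod (cinner w x) \<le> c * p + s * q"
      unfolding wx p_def q_def by (rule order_trans[OF norm_triangle_ineq]) (use c0 sc(3) in \<open>simp add: norm_mult\<close>)
    then have "(cmod (cinner w x))\<^sup>2 \<le> (c * p + s * q)\<^sup>2" by (intro power_mono) auto
    also have "\<dots> \<le> (1 + \<eta>) * (c\<^sup>2 * p\<^sup>2) + (1 + 1 / \<eta>) * (s\<^sup>2 * q\<^sup>2)"
    proof -
      have "0 \<le> (\<eta> * (c * p) - s * q)\<^sup>2 / \<eta>" using \<eta>(1) by simp
      also have "\<dots> = \<eta> * (c * p)\<^sup>2 - 2 * (c * p) * (s * q) + (s * q)\<^sup>2 / \<eta>"
        using \<eta>(1) by (simp add: power2_diff field_simps power2_eq_square)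
      finally show ?thesis by (simp add: power2_sum power_mult_distrib algebra_simps)
    qed
    finally have "\<tau> * (cmod (cinner w x))\<^sup>2 \<le> \<tau> * ((1 + \<eta>) * (c\<^sup>2 * p\<^sup>2) + (1 + 1 / \<eta>) * (s\<^sup>2 * q\<^sup>2))"
      using assms(1) by (intro mult_left_mono) auto
    also have "\<dots> = (\<tau> * (1 + \<eta>)) * (c\<^sup>2 * p\<^sup>2) + \<tau> * (1 + 1 / \<eta>) * s2 * q\<^sup>2"
      by (simp add: sc algebra_simps)
    also have "\<dots> \<le> (\<delta> + \<rho>) * p\<^sup>2 + \<delta> * q\<^sup>2"
    proof (intro add_mono)
      have "c\<^sup>2 * p\<^sup>2 \<le> 1 * p\<^sup>2" using s2 by (intro mult_right_mono) (auto simp: sc)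
      then show "\<tau> * (1 + \<eta>) * (c\<^sup>2 * p\<^sup>2) \<le> (\<delta> + \<rho>) * p\<^sup>2"
        unfolding \<eta>(2) using assms by (intro mult_left_mono) auto
      show "\<tau> * (1 + 1 / \<eta>) * s2 * q\<^sup>2 \<le> \<delta> * q\<^sup>2"
        using s2' by (intro mult_right_mono) auto
    qed
    also have "\<dots> = \<delta> * (p\<^sup>2 + q\<^sup>2) + \<rho> * p\<^sup>2" by (simp add: algebra_simps)
    also have "\<dots> \<le> \<delta> * inner x x + \<rho> * p\<^sup>2"
      using \<open>p\<^sup>2 + q\<^sup>2 \<le> inner x x\<close> assms(2) by (intro add_right_mono mult_left_mono) auto
    finally show ?thesis by (simp add: p_def cinner_ell2_basis)
  qed
  ultimately show ?thesis by (rule that)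
qed

lemma rank_one_perturbation_le:
  fixes e w y :: ell2
  assumes f: "operator_monotone f" and nonneg: "0 \<le> a" "0 \<le> b" "0 \<le> c" "0 \<le> d"
    and unit: "norm e = 1" "norm w = 1"
    and le: "\<And>x. a * inner x x + (b - a) * (cmod (cinner e x))\<^sup>2 \<le> c * inner x x + (d - c) * (cmod (cinner w x))\<^sup>2"
  shows "f a * inner y y + (f b - f a) * (cmod (cinner e y))\<^sup>2 \<le> f c * inner y y + (f d - f c) * (cmod (cinner w y))\<^sup>2"
proof -
  have cont: "continuous_on {0..} f" using f by (simp add: operator_monotone_def)
  note A = cfc_rank_one_perturbation[OF unit(1) cont nonneg(1,2)]
  note B = cfc_rank_one_perturbation[OF unit(2) cont nonneg(3,4)]
  define A1 where "A1 = a *\<^sub>R id_blinfun + (b - a) *\<^sub>R rank_one e e"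
  define B1 where "B1 = c *\<^sub>R id_blinfun + (d - c) *\<^sub>R rank_one w w"
  have "A1 \<le>\<^sub>o\<^sub>p B1"
    using le op_between_hermitian[OF A(1)] op_between_hermitian[OF B(1)]
    by (simp add: op_le_iff A1_def B1_def blinfun.bilinear_simps inner_add_right inner_rank_one_self del: rank_one_apply)
  then have "cfc f A1 \<le>\<^sub>o\<^sub>p cfc f B1"
    using f op_between_positive[OF A(1)] op_between_positive[OF B(1)]
    by (simp add: operator_monotone_def A1_def B1_def)
  from op_le_inner[OF this, of y] show ?thesis
    by (simp add: A1_def B1_def A(2) B(2) blinfun.bilinear_simps inner_add_right inner_rank_one_self del: rank_one_apply)
qed

text \<open>For suitable rank-one perturbations \<open>A \<le> B\<close> of scalars along \<open>e\<^sub>0\<close> and along a tilted vector \<open>w\<close>,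
  the inequality \<open>f(A) \<le> f(B)\<close> is tested at \<open>e\<^sub>1\<close>, which is orthogonal to \<open>e\<^sub>0\<close> but not to \<open>w\<close>.\<close>

lemma operator_monotone_eq_imp_const:
  assumes f: "operator_monotone f" and st: "0 \<le> s" "s < t" "f s = f t" and v: "0 < v"
  shows "f v = f s"
proof -
  let ?e = "ell2_basis 0" and ?y = "ell2_basis (Suc 0)"
  have ey: "cinner ?e ?y = 0" and yy: "inner ?y ?y = 1"
    by (simp_all add: cinner_ell2_basis_basis inner_eq_Re_cinner)
  have up: "f v \<le> f s" if sv: "s < v"
  proof -
    \<comment> \<open>The larger operator has the value v + 1, not v, along e0. This provides the
      slack for the tilt: v - s < (t - s) + (v + 1 - t).\<close>
    obtain w :: ell2 where w: "norm w = 1" "cinner w ?y \<noteq> 0"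
      "\<And>x. (v - s) * (cmod (cinner w x))\<^sup>2 \<le> (t - s) * inner x x + (v + 1 - t) * (cmod (cinner ?e x))\<^sup>2"
      by (rule tilted_projection[of "v - s" "t - s" "v + 1 - t"]) (use st sv in auto)
    have "f s * inner ?y ?y + (f v - f s) * (cmod (cinner w ?y))\<^sup>2
        \<le> f t * inner ?y ?y + (f (v + 1) - f t) * (cmod (cinner ?e ?y))\<^sup>2"
    proof (rule rank_one_perturbation_le[OF f _ _ _ _ w(1) norm_ell2_basis])
      show "s * inner x x + (v - s) * (cmod (cinner w x))\<^sup>2 \<le> t * inner x x + (v + 1 - t) * (cmod (cinner ?e x))\<^sup>2" for x
        using w(3)[of x] by (simp add: algebra_simps)
    qed (use st sv in auto)
    then have "(f v - f s) * (cmod (cinner w ?y))\<^sup>2 \<le> 0" using st(3) by (simp add: ey yy)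
    then show ?thesis using w(2) by (simp add: mult_le_0_iff)
  qed
  have down: "f t \<le> f v" if vt: "v < t"
  proof -
    \<comment> \<open>Now v/2 < v gives the slack, so v must be positive; the value at 0 is
      recovered by continuity in \<open>representing_function_strict\<close>.\<close>
    obtain w :: ell2 where w: "norm w = 1" "cinner w ?y \<noteq> 0"
      "\<And>x. (t - v) * (cmod (cinner w x))\<^sup>2 \<le> (t - s) * inner x x + (s - v / 2) * (cmod (cinner ?e x))\<^sup>2"
      by (rule tilted_projection[of "t - v" "t - s" "s - v / 2"]) (use st vt v in auto)
    have "f s * inner ?y ?y + (f (v / 2) - f s) * (cmod (cinner ?e ?y))\<^sup>2
        \<le> f t * inner ?y ?y + (f v - f t) * (cmod (cinner w ?y))\<^sup>2"
    proof (rule rank_one_perturbation_le[OF f _ _ _ _ norm_ell2_basis w(1)])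
      show "s * inner x x + (v / 2 - s) * (cmod (cinner ?e x))\<^sup>2 \<le> t * inner x x + (v - t) * (cmod (cinner w x))\<^sup>2" for x
        using w(3)[of x] by (simp add: algebra_simps)
    qed (use st vt v in auto)
    then have "0 \<le> (f v - f t) * (cmod (cinner w ?y))\<^sup>2" using st(3) by (simp add: ey yy)
    then show ?thesis using w(2) by (simp add: zero_le_mult_iff)
  qed
  show ?thesis
  proof (cases "s < v")
    case True
    then show ?thesis using up operator_monotone_imp_mono[OF f, of s v] st by simp
  next
    case False
    then have "v < t" using st by simp
    then show ?thesis using down operator_monotone_imp_mono[OF f, of v t] st v by simp
  qed
qed

text \<open>Equality f s = f t makes f constant on the open half-line, the constant is f 1 = 1, and
  continuity at 0 then makes f left trivial.\<close>

lemma representing_function_strict: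
  assumes f: "representing_function f" "\<not> is_left_trivial f" and st: "0 \<le> s" "s < t"
  shows "f s < f t"
proof (rule ccontr)
  have om: "operator_monotone f" "f 1 = 1" using f(1) by (simp_all add: representing_function_def)
  assume "\<not> f s < f t"
  then have eq: "f s = f t" using operator_monotone_imp_mono[OF om(1), of s t] st by simp
  have one: "f v = 1" if "0 < v" for v
    using operator_monotone_eq_imp_const[OF om(1) st eq, of v] operator_monotone_eq_imp_const[OF om(1) st eq, of 1]
      om(2) that by simp
  have "f 0 = 1"
  proof (rule LIMSEQ_unique)
    have "continuous_on {0..} f" using om(1) by (simp add: operator_monotone_def)
    then show "(\<lambda>n. f (inverse (real (Suc n)))) \<longlonglongrightarrow> f 0"
      by (rule continuous_on_tendsto_compose[OF _ LIMSEQ_inverse_real_of_nat]) auto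
    show "(\<lambda>n. f (inverse (real (Suc n)))) \<longlonglongrightarrow> 1" by (simp add: one)
  qed
  then have "is_left_trivial f" using one by (auto simp: is_left_trivial_def order_le_less)
  with f(2) show False by simp
qed

text \<open>Strict monotonicity gives f(t/\<alpha>) < f(t) pointwise; compactness of the interval,
  which excludes 0, makes the factor uniform.\<close>

lemma representing_function_ratio:
  assumes f: "representing_function f" "\<not> is_left_trivial f" and ab: "0 < a" and \<alpha>: "1 < \<alpha>"
  obtains r where "0 < r" "r < 1" "\<And>t. t \<in> {a..b} \<Longrightarrow> f (t / \<alpha>) \<le> r * f t"
proof (cases "a \<le> b")
  case False
  then show ?thesis using that[of "1/2"] by auto
next
  case True
  have om: "continuous_on {0..} f"
    using f(1) by (simp add: representing_function_def operator_monotone_def)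
  have pos: "0 < f t" if "a \<le> t" for t using representing_function_pos[OF f(1)] ab that by simp
  have "continuous_on {a..b} (\<lambda>t. f (t / \<alpha>) / f t)"
  proof (intro continuous_on_divide)
    show "continuous_on {a..b} (\<lambda>t. f (t / \<alpha>))"
      by (rule continuous_on_compose2[OF om]) (use ab \<alpha> in \<open>auto intro!: continuous_intros divide_nonneg_pos\<close>)
    show "continuous_on {a..b} f" by (rule continuous_on_subset[OF om]) (use ab in auto)
  qed (use pos in fastforce)
  then obtain t0 where t0: "t0 \<in> {a..b}" "\<And>t. t \<in> {a..b} \<Longrightarrow> f (t / \<alpha>) / f t \<le> f (t0 / \<alpha>) / f t0"
    using continuous_attains_sup[of "{a..b}" "\<lambda>t. f (t / \<alpha>) / f t"] True by auto
  define r where "r = f (t0 / \<alpha>) / f t0"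
  have "0 < t0" using t0(1) ab by simp
  then have "t0 / \<alpha> < t0" "0 < t0 / \<alpha>" using \<alpha> by (simp_all add: field_simps)
  then have "f (t0 / \<alpha>) < f t0" "0 < f (t0 / \<alpha>)"
    using representing_function_strict[OF f] representing_function_pos[OF f(1)] by auto
  moreover have "0 < f t0" using pos t0(1) by simp
  ultimately have "0 < r" "r < 1" by (simp_all add: r_def)
  moreover have "f (t / \<alpha>) \<le> r * f t" if "t \<in> {a..b}" for t
    using t0(2)[OF that] pos[of t] that by (simp add: r_def[symmetric] divide_le_eq)
  ultimately show ?thesis by (rule that)
qed

section \<open>Operator means\<close>

lemma hermitian_sandwich_inner:
  "hermitian_op R \<Longrightarrow> inner x (blinfun_apply (R o\<^sub>L T o\<^sub>L R) x) = inner (blinfun_apply R x) (blinfun_apply T (blinfun_apply R x))"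
  by (simp add: hermitian_op_inner)

lemma op_le_sandwich:
  assumes "A \<le>\<^sub>o\<^sub>p B" "hermitian_op R"
  shows "R o\<^sub>L A o\<^sub>L R \<le>\<^sub>o\<^sub>p R o\<^sub>L B o\<^sub>L R"
proof -
  have "(R o\<^sub>L B o\<^sub>L R) - (R o\<^sub>L A o\<^sub>L R) = R o\<^sub>L (B - A) o\<^sub>L R"
    by (rule blinfun_eqI) (simp add: blinfun.diff_left blinfun.diff_right)
  then show ?thesis
    using assms hermitian_op_sandwich[of R "B - A"]
    by (simp add: op_le_def positive_op_iff hermitian_sandwich_inner del: blinfun_apply_blinfun_compose)
qed

lemma cfc_sqrt_between:
  assumes X: "op_between a b X" and a: "0 < a"
  shows "op_between (sqrt a) (sqrt b) (cfc sqrt X)"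
    and "op_between (1 / sqrt b) (1 / sqrt a) (cfc (\<lambda>t. 1 / sqrt t) X)"
proof -
  show "op_between (sqrt a) (sqrt b) (cfc sqrt X)"
    by (rule cfc_between[OF X]) (auto intro!: continuous_intros)
  show "op_between (1 / sqrt b) (1 / sqrt a) (cfc (\<lambda>t. 1 / sqrt t) X)"
    by (rule cfc_between[OF X]) (use a in \<open>auto intro!: continuous_intros divide_left_mono\<close>)
qed

lemma cfc_sqrt_products:
  assumes X: "op_between a b X" and a: "0 < a"
  defines "R \<equiv> cfc sqrt X" and "S \<equiv> cfc (\<lambda>t. 1 / sqrt t) X"
  shows "R o\<^sub>L R = X" "R o\<^sub>L S = id_blinfun" "S o\<^sub>L R = id_blinfun" "op_between (1 / b) (1 / a) (S o\<^sub>L S)"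
proof -
  have c: "continuous_on {a..b} sqrt" "continuous_on {a..b} (\<lambda>t. 1 / sqrt t)"
    using a by (auto intro!: continuous_intros)
  have "cfc (\<lambda>t. sqrt t * sqrt t) X = cfc (\<lambda>t. t) X"
    by (rule cfc_cong[OF X]) (use a in \<open>auto intro!: continuous_intros\<close>)
  then show "R o\<^sub>L R = X" by (simp only: cfc_mult[OF X c(1) c(1)] cfc_ident[OF X] R_def)
  have "cfc (\<lambda>t. sqrt t * (1 / sqrt t)) X = cfc (\<lambda>_. 1) X"
    by (rule cfc_cong[OF X continuous_on_mult[OF c]]) (use a in auto)
  then show "R o\<^sub>L S = id_blinfun" by (simp only: cfc_mult[OF X c(1) c(2)] cfc_const[OF X] R_def S_def scaleR_one)
  have "cfc (\<lambda>t. 1 / sqrt t * sqrt t) X = cfc (\<lambda>_. 1) X"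
    by (rule cfc_cong[OF X continuous_on_mult[OF c(2,1)]]) (use a in auto)
  then show "S o\<^sub>L R = id_blinfun" by (simp only: cfc_mult[OF X c(2) c(1)] cfc_const[OF X] R_def S_def scaleR_one)
  have "op_between (1 / b) (1 / a) (cfc (\<lambda>t. 1 / sqrt t * (1 / sqrt t)) X)"
    by (rule cfc_between[OF X]) (use a in \<open>auto intro!: continuous_intros divide_left_mono\<close>)
  then show "op_between (1 / b) (1 / a) (S o\<^sub>L S)" by (simp only: cfc_mult[OF X c(2) c(2)] S_def)
qed

text \<open>Locates the argument of f in the mean. For b > 0 the interval is a compact set of
  positive numbers, where f is positive and \<open>representing_function_ratio\<close>
  applies.\<close>

lemma op_between_inv_sqrt_sandwich:
  assumes X: "op_between a b X" "0 < a" and A: "op_between c d A" "0 < c" "0 < d"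
  defines "S \<equiv> cfc (\<lambda>t. 1 / sqrt t) X"
  shows "op_between (c / b) (d / a) (S o\<^sub>L A o\<^sub>L S)"
proof -
  have S: "hermitian_op S" unfolding S_def by (rule op_between_hermitian[OF cfc_sqrt_between(2)[OF X]])
  have SS: "op_between (1 / b) (1 / a) (S o\<^sub>L S)"
    unfolding S_def by (rule cfc_sqrt_products(4)[OF X])
  have "inner (S x) (S x) = inner x ((S o\<^sub>L S) x)" for x
    by (simp add: hermitian_op_inner[OF S])
  then have b: "(1 / b) * inner x x \<le> inner (S x) (S x)" "inner (S x) (S x) \<le> (1 / a) * inner x x" for x
    using op_between_lower[OF SS, of x] op_between_upper[OF SS, of x] by simp_all
  have "c / b * inner x x \<le> inner (S x) (A (S x))" for x
    using mult_left_mono[OF b(1)[of x], of c] op_between_lower[OF A(1), of "S x"] A(2) by simp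
  moreover have "inner (S x) (A (S x)) \<le> d / a * inner x x" for x
    using mult_left_mono[OF b(2)[of x], of d] op_between_upper[OF A(1), of "S x"] A(3) by simp
  ultimately show ?thesis
    using hermitian_op_sandwich[OF S op_between_hermitian[OF A(1)]]
    unfolding op_between_def hermitian_sandwich_inner[OF S] by blast
qed

lemma representing_imp_monotone: "representing_function f \<Longrightarrow> operator_monotone f"
  by (simp add: representing_function_def)

lemma op_between_cfc_monotone:
  assumes "operator_monotone f" "op_between a b T" "0 \<le> a"
  shows "op_between (f a) (f b) (cfc f T)"
proof (rule cfc_between[OF assms(2)])
  show "continuous_on {a..b} f" by (rule operator_monotone_cont[OF assms(1,3)])
  fix t assume "t \<in> {a..b}"
  then show "f a \<le> f t" "f t \<le> f b"
    using operator_monotone_imp_mono[OF assms(1), of a t] operator_monotone_imp_mono[OF assms(1), of t b]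
      assms(3) by auto
qed

lemma mean_of_altdef:
  "mean_of f X A = cfc sqrt X o\<^sub>L
     cfc f (cfc (\<lambda>t. 1 / sqrt t) X o\<^sub>L A o\<^sub>L cfc (\<lambda>t. 1 / sqrt t) X) o\<^sub>L cfc sqrt X"
  by (simp add: mean_of_def Let_def)

lemma mean_of_pos_inv:
  assumes f: "representing_function f" and X: "X \<in> pos_inv_ops" and A: "A \<in> pos_inv_ops"
  shows "mean_of f X A \<in> pos_inv_ops"
proof -
  obtain a b where ab: "0 < a" "0 < b" "op_between a b X" using pos_inv_ops_between[OF X] by blast
  obtain c d where cd: "0 < c" "0 < d" "op_between c d A" using pos_inv_ops_between[OF A] by blast
  define R where "R = cfc sqrt X"
  define T where "T = cfc (\<lambda>t. 1 / sqrt t) X o\<^sub>L A o\<^sub>L cfc (\<lambda>t. 1 / sqrt t) X"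
  have R: "hermitian_op R" unfolding R_def by (rule op_between_hermitian[OF cfc_sqrt_between(1)[OF ab(3,1)]])
  have T: "op_between (c / b) (d / a) T"
    unfolding T_def by (rule op_between_inv_sqrt_sandwich[OF ab(3,1) cd(3,1,2)])
  have p: "0 < c / b" using ab cd by simp
  note om = representing_imp_monotone[OF f]
  have fT: "op_between (f (c / b)) (f (d / a)) (cfc f T)"
    by (rule op_between_cfc_monotone[OF om T less_imp_le[OF p]])
  have fp: "0 < f (c / b)" by (rule representing_function_pos[OF f p])
  have m: "mean_of f X A = R o\<^sub>L cfc f T o\<^sub>L R" by (simp add: mean_of_altdef R_def T_def)
  show ?thesis
  proof (rule pos_inv_opsI)
    show "hermitian_op (mean_of f X A)"
      unfolding m by (rule hermitian_op_sandwich[OF R op_between_hermitian[OF fT]])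
    show "0 < f (c / b) * a" using fp ab by simp
    fix x
    have "inner (R x) (R x) = inner x ((R o\<^sub>L R) x)" by (simp add: hermitian_op_inner[OF R])
    then have "a * inner x x \<le> inner (R x) (R x)"
      using op_between_lower[OF ab(3), of x] by (simp only: R_def cfc_sqrt_products(1)[OF ab(3,1)])
    then have "f (c / b) * (a * inner x x) \<le> f (c / b) * inner (R x) (R x)"
      using fp by (intro mult_left_mono) auto
    also have "\<dots> \<le> inner (R x) (cfc f T (R x))" by (rule op_between_lower[OF fT])
    finally show "f (c / b) * a * inner x x \<le> inner x (mean_of f X A x)"
      unfolding m hermitian_sandwich_inner[OF R] by (simp add: mult.assoc)
  qed
qed

lemma mean_of_mono_right:
  assumes f: "representing_function f" and X: "X \<in> pos_inv_ops" and A: "A \<in> pos_inv_ops"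
    and B: "B \<in> pos_inv_ops" and AB: "A \<le>\<^sub>o\<^sub>p B"
  shows "mean_of f X A \<le>\<^sub>o\<^sub>p mean_of f X B"
proof -
  obtain a b where ab: "0 < a" "0 < b" "op_between a b X" using pos_inv_ops_between[OF X] by blast
  define S where "S = cfc (\<lambda>t. 1 / sqrt t) X"
  have S: "hermitian_op S" unfolding S_def by (rule op_between_hermitian[OF cfc_sqrt_between(2)[OF ab(3,1)]])
  have "positive_op (S o\<^sub>L C o\<^sub>L S)" if "C \<in> pos_inv_ops" for C
    using that hermitian_op_sandwich[OF S, of C] unfolding positive_op_iff hermitian_sandwich_inner[OF S]
    by (auto simp: pos_inv_ops_def positive_op_iff)
  then have "cfc f (S o\<^sub>L A o\<^sub>L S) \<le>\<^sub>o\<^sub>p cfc f (S o\<^sub>L B o\<^sub>L S)"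
    using A B op_le_sandwich[OF AB S] by (intro operator_monotoneD[OF representing_imp_monotone[OF f]])
  then show ?thesis
    unfolding mean_of_altdef S_def[symmetric]
    by (rule op_le_sandwich) (rule op_between_hermitian[OF cfc_sqrt_between(1)[OF ab(3,1)]])
qed

lemma mean_of_mono_left:
  assumes f: "representing_function f" and X: "X \<in> pos_inv_ops" and Y: "Y \<in> pos_inv_ops"
    and A: "A \<in> pos_inv_ops" and XY: "X \<le>\<^sub>o\<^sub>p Y"
  shows "mean_of f X A \<le>\<^sub>o\<^sub>p mean_of f Y A"
proof -
  obtain a b where ab: "0 < a" "0 < b" "op_between a b X" using pos_inv_ops_between[OF X] by blast
  obtain c d where cd: "0 < c" "0 < d" "op_between c d Y" using pos_inv_ops_between[OF Y] by blast
  define R1 S1 R2 S2 where "R1 = cfc sqrt X" and "S1 = cfc (\<lambda>t. 1 / sqrt t) X"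
    and "R2 = cfc sqrt Y" and "S2 = cfc (\<lambda>t. 1 / sqrt t) Y"
  have h: "hermitian_op R1" "hermitian_op S1" "hermitian_op R2" "hermitian_op S2"
    unfolding R1_def S1_def R2_def S2_def
    by (rule op_between_hermitian[OF cfc_sqrt_between(1)[OF ab(3,1)]]
        op_between_hermitian[OF cfc_sqrt_between(2)[OF ab(3,1)]]
        op_between_hermitian[OF cfc_sqrt_between(1)[OF cd(3,1)]]
        op_between_hermitian[OF cfc_sqrt_between(2)[OF cd(3,1)]])+
  note prod1 = cfc_sqrt_products[OF ab(3,1), folded R1_def S1_def]
  note prod2 = cfc_sqrt_products[OF cd(3,1), folded R2_def S2_def]
  have RR1: "R1 (R1 x) = X x" and RS1: "R1 (S1 x) = x" and SR1: "S1 (R1 x) = x"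
    and RR2: "R2 (R2 x) = Y x" and RS2: "R2 (S2 x) = x" and SR2: "S2 (R2 x) = x" for x
    using prod1 prod2 by (metis blinfun_apply_blinfun_compose blinfun_apply_id_blinfun)+
  define K K' where "K = R1 o\<^sub>L S2" and "K' = S2 o\<^sub>L R1"
  define T where "T = S1 o\<^sub>L A o\<^sub>L S1"
  have K: "K \<in> bounded_ops" "K' \<in> bounded_ops"
    using h hermitian_op_bounded unfolding K_def K'_def by (blast intro: bounded_ops_compose)+
  have adj: "inner (K x) y = inner x (K' y)" for x y
    by (simp add: K_def K'_def hermitian_op_inner[OF h(1)] hermitian_op_inner[OF h(4)])
  have contr: "inner (K x) (K x) \<le> inner x x" for x
  proof -
    have "inner (K x) (K x) = inner (S2 x) (X (S2 x))"
      by (simp add: K_def hermitian_op_inner[OF h(1)] RR1)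
    also have "\<dots> \<le> inner (S2 x) (Y (S2 x))" by (rule op_le_inner[OF XY])
    also have "\<dots> = inner (R2 (S2 x)) (R2 (S2 x))" by (simp only: hermitian_op_inner[OF h(3)] RR2)
    finally show ?thesis by (simp add: RS2)
  qed
  have T: "positive_op T"
    using A hermitian_op_sandwich[OF h(2), of A] unfolding T_def positive_op_iff hermitian_sandwich_inner[OF h(2)]
    by (auto simp: pos_inv_ops_def positive_op_iff)
  \<comment> \<open>The adjacent factors X^(1/2) and X^(-1/2) cancel, so the compressed operator is
    the argument of f in the mean with Y.\<close>
  have KTK: "K' o\<^sub>L T o\<^sub>L K = S2 o\<^sub>L A o\<^sub>L S2"
    by (rule blinfun_eqI) (simp add: K_def K'_def T_def RS1 SR1)
  have f0: "0 \<le> f 0" using f by (simp add: representing_function_def)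
  have KR: "K (R2 x) = R1 x" for x by (simp add: K_def SR2)
  \<comment> \<open>Testing at Y^(1/2) x instead of x turns K into X^(1/2), and both sides become
    quadratic forms of the two means at x.\<close>
  have le: "inner (R1 x) (cfc f T (R1 x)) \<le> inner (R2 x) (cfc f (S2 o\<^sub>L A o\<^sub>L S2) (R2 x))" for x
    using hansen_inequality[OF representing_imp_monotone[OF f] f0 T K adj contr, of "R2 x"]
    by (simp add: KR KTK)
  have m: "mean_of f X A = R1 o\<^sub>L cfc f T o\<^sub>L R1" "mean_of f Y A = R2 o\<^sub>L cfc f (S2 o\<^sub>L A o\<^sub>L S2) o\<^sub>L R2"
    by (simp_all add: mean_of_altdef R1_def S1_def R2_def S2_def T_def)
  have "hermitian_op (mean_of f X A)" "hermitian_op (mean_of f Y A)"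
    using mean_of_pos_inv[OF f] X Y A pos_inv_hermitian by blast+
  then show ?thesis
    using le
    by (simp add: op_le_iff)
       (simp add: m hermitian_sandwich_inner[OF h(1)] hermitian_sandwich_inner[OF h(3)]
        del: blinfun_apply_blinfun_compose)
qed

lemma mean_of_mono:
  assumes "representing_function f" "X \<in> pos_inv_ops" "Y \<in> pos_inv_ops" "A \<in> pos_inv_ops" "B \<in> pos_inv_ops"
    "X \<le>\<^sub>o\<^sub>p Y" "A \<le>\<^sub>o\<^sub>p B"
  shows "mean_of f X A \<le>\<^sub>o\<^sub>p mean_of f Y B"
  using mean_of_mono_left[of f X Y A] mean_of_mono_right[of f Y A B] assms op_le_trans by blast

lemma mean_of_scaleR:
  assumes X: "X \<in> pos_inv_ops" and c: "0 < c"
  shows "mean_of f (c *\<^sub>R X) (c *\<^sub>R A) = c *\<^sub>R mean_of f X A"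
proof -
  obtain a b where ab: "0 < a" "0 < b" "op_between a b X" using pos_inv_ops_between[OF X] by blast
  have cont: "continuous_on {c * a..c * b} sqrt" "continuous_on {c * a..c * b} (\<lambda>t. 1 / sqrt t)"
    "continuous_on {a..b} sqrt" "continuous_on {a..b} (\<lambda>t. 1 / sqrt t)"
    using ab c by (auto intro!: continuous_intros simp: mult_le_0_iff)
  have R: "cfc sqrt (c *\<^sub>R X) = sqrt c *\<^sub>R cfc sqrt X"
    using cfc_scale[OF ab(3) cont(1) c] cfc_cmult[OF ab(3) cont(3), of "sqrt c"]
    by (simp add: real_sqrt_mult)
  have S: "cfc (\<lambda>t. 1 / sqrt t) (c *\<^sub>R X) = (1 / sqrt c) *\<^sub>R cfc (\<lambda>t. 1 / sqrt t) X"
    using cfc_scale[OF ab(3) cont(2) c] cfc_cmult[OF ab(3) cont(4), of "1 / sqrt c"]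
    by (simp add: real_sqrt_mult)
  have s: "sqrt c * sqrt c = c" "sqrt c \<noteq> 0" using c by simp_all
  show ?thesis
    unfolding mean_of_altdef R S using s c
    by (simp add: blinfun_compose_simps)
qed

lemma mean_of_self:
  assumes f: "representing_function f" and X: "X \<in> pos_inv_ops"
  shows "mean_of f X X = X"
proof -
  obtain a b where ab: "0 < a" "0 < b" "op_between a b X" using pos_inv_ops_between[OF X] by blast
  define R S where "R = cfc sqrt X" and "S = cfc (\<lambda>t. 1 / sqrt t) X"
  note prods = cfc_sqrt_products[OF ab(3,1), folded R_def S_def]
  have "S o\<^sub>L X o\<^sub>L S = (S o\<^sub>L R) o\<^sub>L (R o\<^sub>L S)"
    unfolding prods(1)[symmetric] by (simp add: blinfun_compose_assoc)
  then have SXS: "S o\<^sub>L X o\<^sub>L S = 1 *\<^sub>R id_blinfun" by (simp add: prods blinfun_compose_simps)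
  have "cfc f (1 *\<^sub>R id_blinfun :: 'a \<Rightarrow>\<^sub>L 'a) = f 1 *\<^sub>R id_blinfun"
    by (rule cfc_scalar, rule operator_monotone_cont[OF representing_imp_monotone[OF f]]) simp
  then have "mean_of f X X = R o\<^sub>L id_blinfun o\<^sub>L R"
    using f unfolding mean_of_altdef R_def[symmetric] S_def[symmetric] SXS
    by (simp add: representing_function_def)
  then show ?thesis by (simp add: blinfun_compose_simps prods)
qed

text \<open>The scalar bound of \<open>representing_function_ratio\<close> is lifted through the
  calculus to T = X^(-1/2) A X^(-1/2). The factor r may depend on X, A and \<alpha>; the comparison
  argument only uses it at one fixed choice of them.\<close>

lemma mean_of_contraction:
  fixes X A :: "'h::complex_hilbert \<Rightarrow>\<^sub>L 'h"
  assumes f: "representing_function f" "\<not> is_left_trivial f"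
    and X: "X \<in> pos_inv_ops" and A: "A \<in> pos_inv_ops" and \<alpha>: "1 < \<alpha>"
  shows "\<exists>r>0. r < 1 \<and> mean_of f (\<alpha> *\<^sub>R X) A \<le>\<^sub>o\<^sub>p (r * \<alpha>) *\<^sub>R mean_of f X A"
proof -
  obtain a b where ab: "0 < a" "0 < b" "op_between a b X" using pos_inv_ops_between[OF X] by blast
  obtain c d where cd: "0 < c" "0 < d" "op_between c d A" using pos_inv_ops_between[OF A] by blast
  define R S where "R = cfc sqrt X" and "S = cfc (\<lambda>t. 1 / sqrt t) X"
  define T where "T = S o\<^sub>L A o\<^sub>L S"
  have R: "hermitian_op R" unfolding R_def by (rule op_between_hermitian[OF cfc_sqrt_between(1)[OF ab(3,1)]])
  have T: "op_between (c / b) (d / a) T"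
    unfolding T_def S_def by (rule op_between_inv_sqrt_sandwich[OF ab(3,1) cd(3,1,2)])
  have p: "0 < c / b" using ab cd by simp
  obtain r where r: "0 < r" "r < 1" "\<And>t. t \<in> {c / b..d / a} \<Longrightarrow> f (t / \<alpha>) \<le> r * f t"
    using representing_function_ratio[OF f p \<alpha>] by blast
  note om = representing_imp_monotone[OF f(1)]
  have cont: "continuous_on {c / b..d / a} f" by (rule operator_monotone_cont[OF om]) (use p in simp)
  have cont': "continuous_on {1 / \<alpha> * (c / b)..1 / \<alpha> * (d / a)} f"
    by (rule operator_monotone_cont[OF om]) (use ab cd \<alpha> in simp)
  have cont2: "continuous_on {c / b..d / a} (\<lambda>t. f (1 / \<alpha> * t))"
  proof (rule continuous_on_compose2[OF cont'])
    show "continuous_on {c / b..d / a} (\<lambda>t. 1 / \<alpha> * t)" by (intro continuous_intros)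
    show "(\<lambda>t. 1 / \<alpha> * t) ` {c / b..d / a} \<subseteq> {1 / \<alpha> * (c / b)..1 / \<alpha> * (d / a)}"
      using \<alpha> by (intro image_subsetI) (auto intro!: mult_left_mono simp del: times_divide_eq_right times_divide_eq_left)
  qed
  have "0 \<le> inner x (blinfun_apply (cfc (\<lambda>t. r * f t - f (1 / \<alpha> * t)) T) x)" for x
    by (rule cfc_nonneg[OF T continuous_on_diff[OF continuous_on_mult_left[OF cont] cont2]])
       (use r(3) in simp)
  moreover have "cfc (\<lambda>t. r * f t - f (1 / \<alpha> * t)) T = r *\<^sub>R cfc f T - cfc f ((1 / \<alpha>) *\<^sub>R T)"
    using cfc_diff[OF T continuous_on_mult_left[OF cont] cont2, of r] cfc_cmult[OF T cont, of r]
      cfc_scale[OF T cont'] \<alpha> by simp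
  ultimately have "cfc f ((1 / \<alpha>) *\<^sub>R T) \<le>\<^sub>o\<^sub>p r *\<^sub>R cfc f T"
    using cfc_hermitian[OF op_between_scaleR[OF T, of "1 / \<alpha>"] cont'] cfc_hermitian[OF T cont] \<alpha>
    by (simp add: op_le_iff hermitian_op_scaleR blinfun.diff_left inner_diff_right)
  from op_le_sandwich[OF this R]
  have "R o\<^sub>L cfc f ((1 / \<alpha>) *\<^sub>R T) o\<^sub>L R \<le>\<^sub>o\<^sub>p r *\<^sub>R mean_of f X A"
    by (simp add: mean_of_altdef R_def S_def T_def blinfun_compose_simps)
  moreover have "mean_of f X ((1 / \<alpha>) *\<^sub>R A) = R o\<^sub>L cfc f ((1 / \<alpha>) *\<^sub>R T) o\<^sub>L R"
    by (simp add: mean_of_altdef R_def S_def T_def blinfun_compose_simps)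
  ultimately have "\<alpha> *\<^sub>R mean_of f X ((1 / \<alpha>) *\<^sub>R A) \<le>\<^sub>o\<^sub>p \<alpha> *\<^sub>R (r *\<^sub>R mean_of f X A)"
    using \<alpha> by (intro op_le_scaleR) auto
  moreover have "\<alpha> *\<^sub>R mean_of f X ((1 / \<alpha>) *\<^sub>R A) = mean_of f (\<alpha> *\<^sub>R X) A"
    using mean_of_scaleR[OF X, of \<alpha> f "(1 / \<alpha>) *\<^sub>R A"] \<alpha> by simp
  ultimately show ?thesis using r(1,2) by (auto simp: mult.commute intro!: exI[of _ r])
qed

text \<open>The common positive bounds keep all arguments in compact intervals on which root,
  inverse root and f are continuous, and they bound the factors uniformly, as
  \<open>strong_tendsto_compose\<close> demands.\<close>

lemma mean_of_strong_tendsto: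
  assumes f: "representing_function f"
    and X: "\<And>k. op_between a b (X k)" and A: "\<And>k. op_between a b (A k)" and ab: "0 < a" "0 < b"
    and limX: "\<And>x. (\<lambda>k. blinfun_apply (X k) x) \<longlonglongrightarrow> blinfun_apply X' x"
    and limA: "\<And>x. (\<lambda>k. blinfun_apply (A k) x) \<longlonglongrightarrow> blinfun_apply A' x"
  shows "(\<lambda>k. blinfun_apply (mean_of f (X k) (A k)) x) \<longlonglongrightarrow> blinfun_apply (mean_of f X' A') x"
proof -
  define R S where "R = (\<lambda>X :: 'a \<Rightarrow>\<^sub>L 'a. cfc sqrt X)" and "S = (\<lambda>X :: 'a \<Rightarrow>\<^sub>L 'a. cfc (\<lambda>t. 1 / sqrt t) X)"
  define T where "T = (\<lambda>X A. S X o\<^sub>L A o\<^sub>L S X)"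
  have limR: "(\<lambda>k. R (X k) x) \<longlonglongrightarrow> R X' x" for x
    unfolding R_def by (rule cfc_strong_tendsto[OF X _ limX]) (intro continuous_intros)
  have limS: "(\<lambda>k. S (X k) x) \<longlonglongrightarrow> S X' x" for x
    unfolding S_def by (rule cfc_strong_tendsto[OF X _ limX]) (use ab in \<open>auto intro!: continuous_intros\<close>)
  have nR: "norm (R (X k)) \<le> \<bar>sqrt a\<bar> + \<bar>sqrt b\<bar>" for k
    unfolding R_def by (rule op_between_norm_le[OF cfc_sqrt_between(1)[OF X ab(1)]])
  have nS: "norm (S (X k)) \<le> \<bar>1 / sqrt b\<bar> + \<bar>1 / sqrt a\<bar>" for k
    unfolding S_def by (rule op_between_norm_le[OF cfc_sqrt_between(2)[OF X ab(1)]])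
  have T: "op_between (a / b) (b / a) (T (X k) (A k))" for k
    unfolding T_def S_def by (rule op_between_inv_sqrt_sandwich[OF X ab(1) A ab])
  have limT: "(\<lambda>k. T (X k) (A k) x) \<longlonglongrightarrow> T X' A' x" for x
  proof -
    have "(\<lambda>k. A k (S (X k) x)) \<longlonglongrightarrow> A' (S X' x)"
      by (rule strong_tendsto_compose[OF op_between_norm_le[OF A] limA limS])
    from strong_tendsto_compose[OF nS limS this] show ?thesis by (simp add: T_def)
  qed
  have cont: "continuous_on {a / b..b / a} f"
    by (rule operator_monotone_cont[OF representing_imp_monotone[OF f]]) (use ab in simp)
  have fT: "op_between (f (a / b)) (f (b / a)) (cfc f (T (X k) (A k)))" for k
    by (rule op_between_cfc_monotone[OF representing_imp_monotone[OF f] T]) (use ab in simp)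
  have "(\<lambda>k. cfc f (T (X k) (A k)) (R (X k) x)) \<longlonglongrightarrow> cfc f (T X' A') (R X' x)"
    by (rule strong_tendsto_compose[OF op_between_norm_le[OF fT] cfc_strong_tendsto[OF T cont limT] limR])
  from strong_tendsto_compose[OF nR limR this] show ?thesis
    by (simp add: mean_of_altdef R_def S_def T_def)
qed

section \<open>Monotone sequences of operators\<close>

lemma op_decreasing_le:
  assumes "\<And>k. T (Suc k) \<le>\<^sub>o\<^sub>p T k" "m \<le> n"
  shows "T n \<le>\<^sub>o\<^sub>p T m"
  using assms(2) by (induction n rule: dec_induct) (auto intro: op_le_refl op_le_trans assms(1))

lemma op_le_minus: "- A \<le>\<^sub>o\<^sub>p - B \<longleftrightarrow> B \<le>\<^sub>o\<^sub>p A"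
  by (simp add: op_le_def)

text \<open>Vigier: \<open>\<parallel>(T\<^sub>m - T\<^sub>n) x\<parallel>\<^sup>2\<close> is controlled by the scalar sequence \<open>\<langle>x, T\<^sub>k x\<rangle>\<close>.\<close>

lemma decreasing_strong_convergent:
  fixes T :: "nat \<Rightarrow> 'h::complex_hilbert \<Rightarrow>\<^sub>L 'h"
  assumes T: "\<And>k. op_between a b (T k)" and dec: "\<And>k. T (Suc k) \<le>\<^sub>o\<^sub>p T k"
  obtains L where "\<And>x. (\<lambda>k. blinfun_apply (T k) x) \<longlonglongrightarrow> blinfun_apply L x"
proof -
  define c where "c = \<bar>a\<bar> + \<bar>b\<bar> + 1"
  have c: "0 < c" "b - a \<le> c" by (simp_all add: c_def)
  note le = op_decreasing_le[where T = T, OF dec]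
  \<comment> \<open>T m - T n lies between 0 and c I, so the inequality A^2 <= c A of
    \<open>op_between_norm_apply\<close> applies to it.\<close>
  have sq: "inner (T m x - T n x) (T m x - T n x) \<le> c * (inner x (T m x) - inner x (T n x))" if "m \<le> n" for m n x
  proof -
    have "inner x (T m x) - inner x (T n x) \<le> c * inner x x" for x
      using op_between_upper[OF T, of x m] op_between_lower[OF T, of x n] mult_right_mono[OF c(2), of "inner x x"]
      by (simp add: left_diff_distrib)
    then have "op_between 0 c (T m - T n)"
      using op_le_inner[OF le[OF that]]
      by (simp add: op_between_def hermitian_op_diff op_between_hermitian[OF T] blinfun.diff_left inner_diff_right)
    from op_between_norm_apply[OF this c(1), of x] show ?thesis
      by (simp add: blinfun.diff_left inner_diff_right)
  qed
  have "convergent (\<lambda>k. T k x)" for x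
  proof -
    have "decseq (\<lambda>k. inner x (T k x))"
      unfolding decseq_def using op_le_inner[OF le] by blast
    then have cg: "Cauchy (\<lambda>k. inner x (T k x))"
      using decseq_convergent[of "\<lambda>k. inner x (T k x)" "a * inner x x"] op_between_lower[OF T]
      by (metis convergentI convergent_Cauchy)
    have "Cauchy (\<lambda>k. T k x)"
    proof (rule metric_CauchyI)
      fix e :: real assume "0 < e"
      then have "0 < e\<^sup>2 / c" using c by simp
      then obtain K where K: "\<And>m n. m \<ge> K \<Longrightarrow> n \<ge> K \<Longrightarrow> dist (inner x (T m x)) (inner x (T n x)) < e\<^sup>2 / c"
        using metric_CauchyD[OF cg] by meson
      have half: "dist (T m x) (T n x) < e" if "m \<ge> K" "m \<le> n" for m n
      proof -
        have "inner x (T m x) - inner x (T n x) < e\<^sup>2 / c"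
          using K[of m n] that by (simp add: dist_real_def)
        then have "c * (inner x (T m x) - inner x (T n x)) < e\<^sup>2" using c by (simp add: field_simps)
        then have "(norm (T m x - T n x))\<^sup>2 < e\<^sup>2"
          using sq[OF that(2), of x] by (simp add: power2_norm_eq_inner)
        then show ?thesis using \<open>0 < e\<close> by (simp add: dist_norm power2_less_imp_less)
      qed
      have "dist (T m x) (T n x) < e" if "m \<ge> K" "n \<ge> K" for m n
        using half[of m n] half[of n m] that by (cases "m \<le> n") (auto simp: dist_commute)
      then show "\<exists>K. \<forall>m\<ge>K. \<forall>n\<ge>K. dist (T m x) (T n x) < e" by blast
    qed
    then show ?thesis by (simp add: Cauchy_convergent_iff)
  qed
  then have lim: "(\<lambda>k. T k x) \<longlonglongrightarrow> lim (\<lambda>k. T k x)" for x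
    by (simp add: convergent_LIMSEQ_iff)
  have "bounded_linear (\<lambda>x. lim (\<lambda>k. T k x))"
  proof (rule bounded_linear_intro)
    show "lim (\<lambda>k. T k (x + y)) = lim (\<lambda>k. T k x) + lim (\<lambda>k. T k y)" for x y
      using LIMSEQ_unique[OF lim[of "x + y"]] tendsto_add[OF lim[of x] lim[of y]] by (simp add: blinfun.add_right)
    show "lim (\<lambda>k. T k (r *\<^sub>R x)) = r *\<^sub>R lim (\<lambda>k. T k x)" for r x
      using LIMSEQ_unique[OF lim[of "r *\<^sub>R x"]] tendsto_scaleR[OF tendsto_const lim[of x]]
      by (simp add: blinfun.scaleR_right)
    have "norm (T k x) \<le> norm x * c" for k x
    proof -
      have "norm (T k x) \<le> norm (T k) * norm x" by (rule norm_blinfun)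
      also have "\<dots> \<le> c * norm x"
        using op_between_norm_le[OF T, of k] by (intro mult_right_mono) (simp_all add: c_def)
      finally show ?thesis by (simp add: mult.commute)
    qed
    then show "norm (lim (\<lambda>k. T k x)) \<le> norm x * c" for x
      by (intro LIMSEQ_le_const2[OF tendsto_norm[OF lim]]) auto
  qed
  then have "(\<lambda>k. T k x) \<longlonglongrightarrow> Blinfun (\<lambda>x. lim (\<lambda>k. T k x)) x" for x
    using lim by (simp add: bounded_linear_Blinfun_apply)
  then show ?thesis by (rule that)
qed

lemma increasing_strong_convergent:
  fixes T :: "nat \<Rightarrow> 'h::complex_hilbert \<Rightarrow>\<^sub>L 'h"
  assumes T: "\<And>k. op_between a b (T k)" and inc: "\<And>k. T k \<le>\<^sub>o\<^sub>p T (Suc k)"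
  obtains L where "\<And>x. (\<lambda>k. blinfun_apply (T k) x) \<longlonglongrightarrow> blinfun_apply L x"
proof -
  have T': "op_between (- b) (- a) (- T k)" for k
    using T[of k] by (auto simp: op_between_def hermitian_op_minus blinfun.minus_left)
  have dec: "- T (Suc k) \<le>\<^sub>o\<^sub>p - T k" for k by (simp add: op_le_minus inc)
  obtain L :: "'h \<Rightarrow>\<^sub>L 'h" where L: "\<And>x. (\<lambda>k. (- T k) x) \<longlonglongrightarrow> L x"
    using decreasing_strong_convergent[where T = "\<lambda>k. - T k", OF T' dec] by blast
  have "(\<lambda>k. T k x) \<longlonglongrightarrow> (- L) x" for x
    using tendsto_minus[OF L[of x]] by (simp add: blinfun.minus_left)
  then show ?thesis by (rule that)
qed

lemma op_decreasing_limit_le: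
  assumes "\<And>k. hermitian_op (T k)" "\<And>k. T (Suc k) \<le>\<^sub>o\<^sub>p T k"
    "\<And>x. (\<lambda>k. blinfun_apply (T k) x) \<longlonglongrightarrow> blinfun_apply L x"
  shows "L \<le>\<^sub>o\<^sub>p T k"
proof -
  have "inner x (L x) \<le> inner x (T k x)" for x
  proof (rule LIMSEQ_le_const2)
    show "(\<lambda>k. inner x (T k x)) \<longlonglongrightarrow> inner x (L x)" by (intro tendsto_intros assms(3))
    show "\<exists>N. \<forall>n\<ge>N. inner x (T n x) \<le> inner x (T k x)"
      using op_le_inner[OF op_decreasing_le[where T = T, OF assms(2)]] by blast
  qed
  then show ?thesis using op_le_iff[OF hermitian_op_tendsto[OF assms(1,3)] assms(1)] by blast
qed

lemma op_increasing_limit_ge: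
  assumes "\<And>k. hermitian_op (T k)" "\<And>k. T k \<le>\<^sub>o\<^sub>p T (Suc k)"
    "\<And>x. (\<lambda>k. blinfun_apply (T k) x) \<longlonglongrightarrow> blinfun_apply L x"
  shows "T k \<le>\<^sub>o\<^sub>p L"
proof -
  have "- L \<le>\<^sub>o\<^sub>p - T k"
  proof (rule op_decreasing_limit_le[where T = "\<lambda>k. - T k"])
    show "hermitian_op (- T k)" for k by (rule hermitian_op_minus[OF assms(1)])
    show "- T (Suc k) \<le>\<^sub>o\<^sub>p - T k" for k by (simp add: op_le_minus assms(2))
    show "(\<lambda>k. blinfun_apply (- T k) x) \<longlonglongrightarrow> blinfun_apply (- L) x" for x
      unfolding blinfun.minus_left by (rule tendsto_minus[OF assms(3)])
  qed
  then show ?thesis by (simp add: op_le_minus)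
qed

section \<open>The fixed point equation\<close>

lemma jointly_monotoneD:
  assumes "jointly_monotone M" "\<And>j. A j \<in> pos_inv_ops" "\<And>j. B j \<in> pos_inv_ops" "\<And>j. A j \<le>\<^sub>o\<^sub>p B j"
  shows "M A \<le>\<^sub>o\<^sub>p M B"
  using assms by (simp add: jointly_monotone_def)

lemma homogeneous_mapD:
  assumes "homogeneous_map M" "\<And>j. A j \<in> pos_inv_ops" "0 < \<alpha>"
  shows "M (\<lambda>j. \<alpha> *\<^sub>R A j) = \<alpha> *\<^sub>R M A"
  using assms by (simp add: homogeneous_map_def)

text \<open>This is F_A(X) of the overview; its fixed points in \<open>pos_inv_ops\<close> are the
  solutions described in \<open>deformed_mean\<close>.\<close>

definition deformed_map :: "('i::finite, 'h::complex_hilbert) op_map \<Rightarrow> ('i \<Rightarrow> real \<Rightarrow> real)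
    \<Rightarrow> ('i \<Rightarrow> 'h \<Rightarrow>\<^sub>L 'h) \<Rightarrow> ('h \<Rightarrow>\<^sub>L 'h) \<Rightarrow> ('h \<Rightarrow>\<^sub>L 'h)" where
  "deformed_map M f A X = M (\<lambda>j. mean_of (f j) X (A j))"

lemma deformed_map_pos_inv:
  assumes "maps_pos_inv M" "\<And>j. representing_function (f j)" "X \<in> pos_inv_ops" "\<And>j. A j \<in> pos_inv_ops"
  shows "deformed_map M f A X \<in> pos_inv_ops"
  using assms by (simp add: deformed_map_def maps_pos_inv_def mean_of_pos_inv)

lemma deformed_map_mono:
  assumes "jointly_monotone M" "\<And>j. representing_function (f j)" "X \<in> pos_inv_ops" "Y \<in> pos_inv_ops"
    "\<And>j. A j \<in> pos_inv_ops" "\<And>j. B j \<in> pos_inv_ops" "X \<le>\<^sub>o\<^sub>p Y" "\<And>j. A j \<le>\<^sub>o\<^sub>p B j"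
  shows "deformed_map M f A X \<le>\<^sub>o\<^sub>p deformed_map M f B Y"
  unfolding deformed_map_def
  by (rule jointly_monotoneD[OF assms(1)]) (use assms in \<open>auto intro: mean_of_pos_inv mean_of_mono\<close>)

lemma pos_inv_ops_common_bounds:
  fixes A :: "'i::finite \<Rightarrow> 'h::complex_hilbert \<Rightarrow>\<^sub>L 'h"
  assumes "\<And>j. A j \<in> pos_inv_ops"
  obtains a b where "0 < a" "0 < b" "\<And>j. op_between a b (A j)"
proof -
  have "\<forall>j. \<exists>a b. 0 < a \<and> 0 < b \<and> op_between a b (A j)"
    using pos_inv_ops_between[OF assms] by blast
  then obtain a b where ab: "\<And>j. 0 < a j" "\<And>j. 0 < b j" "\<And>j. op_between (a j) (b j) (A j)" by metis
  have "op_between (Min (range a)) (Max (range b)) (A j)" for j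
    by (rule op_between_mono[OF ab(3)]) simp_all
  moreover have "0 < Min (range a)" using ab(1) by simp
  moreover have "0 < Max (range b)" using ab(2) by (simp add: Max_gr_iff)
  ultimately show ?thesis by (rule that[rotated 2])
qed

text \<open>If \<open>\<alpha> > 1\<close> were the least number with
  \<open>Y \<le> \<alpha> X\<close>, then \<open>mean_of_contraction\<close> and homogeneity would give \<open>Y \<le> r \<alpha> X\<close> with \<open>r < 1\<close>.\<close>

lemma deformed_map_comparison:
  fixes M :: "('i::finite, 'h::complex_hilbert) op_map"
  assumes M: "maps_pos_inv M" "jointly_monotone M" "homogeneous_map M"
    and f: "\<And>j. representing_function (f j)" "\<And>j. \<not> is_left_trivial (f j)"
    and A: "\<And>j. A j \<in> pos_inv_ops" and B: "\<And>j. B j \<in> pos_inv_ops" and AB: "\<And>j. A j \<le>\<^sub>o\<^sub>p B j"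
    and X: "X \<in> pos_inv_ops" "deformed_map M f B X \<le>\<^sub>o\<^sub>p X"
    and Y: "Y \<in> pos_inv_ops" "Y \<le>\<^sub>o\<^sub>p deformed_map M f A Y"
  shows "Y \<le>\<^sub>o\<^sub>p X"
proof -
  note h = pos_inv_hermitian[OF X(1)] pos_inv_hermitian[OF Y(1)]
  define I where "I = {\<alpha>. 0 < \<alpha> \<and> Y \<le>\<^sub>o\<^sub>p \<alpha> *\<^sub>R X}"
  have I_iff: "\<alpha> \<in> I \<longleftrightarrow> 0 < \<alpha> \<and> (\<forall>x. inner x (Y x) \<le> \<alpha> * inner x (X x))" for \<alpha>
    using h by (simp add: I_def op_le_iff hermitian_op_scaleR blinfun.scaleR_left)
  obtain a b where ab: "0 < a" "op_between a b X" using pos_inv_ops_between[OF X(1)] by blast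
  obtain c d where cd: "0 < d" "op_between c d Y" using pos_inv_ops_between[OF Y(1)] by blast
  have "inner x (Y x) \<le> d / a * inner x (X x)" for x
  proof -
    have "inner x (Y x) \<le> d / a * (a * inner x x)" using op_between_upper[OF cd(2), of x] ab(1) by simp
    also have "\<dots> \<le> d / a * inner x (X x)"
      using op_between_lower[OF ab(2), of x] ab(1) cd(1) by (intro mult_left_mono) auto
    finally show ?thesis .
  qed
  then have ne: "I \<noteq> {}" using ab(1) cd(1) I_iff[of "d / a"] by auto
  have bdd: "bdd_below I" by (rule bdd_belowI[of _ 0]) (simp add: I_def)
  define \<alpha> where "\<alpha> = Inf I"
  \<comment> \<open>The infimum is attained: for every nonzero x the quotient <x, Y x> / <x, X x> is
    a lower bound of I.\<close>
  have le: "inner x (Y x) \<le> \<alpha> * inner x (X x)" for x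
  proof (cases "x = 0")
    case False
    then have "0 < a * inner x x" using ab(1) by simp
    then have q: "0 < inner x (X x)" using op_between_lower[OF ab(2), of x] by linarith
    have "inner x (Y x) / inner x (X x) \<le> \<alpha>"
      unfolding \<alpha>_def by (rule cInf_greatest[OF ne]) (use q I_iff in \<open>simp add: divide_le_eq\<close>)
    then show ?thesis using q by (simp add: divide_le_eq)
  qed simp
  have "\<alpha> \<le> 1"
  proof (rule ccontr)
    assume "\<not> \<alpha> \<le> 1"
    then have \<alpha>: "1 < \<alpha>" by simp
    have aX: "\<alpha> *\<^sub>R X \<in> pos_inv_ops" using \<alpha> by (intro pos_inv_ops_scaleR X) simp
    have "\<forall>j. \<exists>r>0. r < 1 \<and> mean_of (f j) (\<alpha> *\<^sub>R X) (B j) \<le>\<^sub>o\<^sub>p (r * \<alpha>) *\<^sub>R mean_of (f j) X (B j)"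
      using mean_of_contraction[OF f X(1) B \<alpha>] by blast
    then obtain r where r: "\<And>j. 0 < r j" "\<And>j. r j < 1"
      "\<And>j. mean_of (f j) (\<alpha> *\<^sub>R X) (B j) \<le>\<^sub>o\<^sub>p (r j * \<alpha>) *\<^sub>R mean_of (f j) X (B j)"
      by metis
    \<comment> \<open>Homogeneity of M can extract only a factor common to all arguments, so the
      factors of the single means are replaced by the largest one; it is below 1 because there are
      finitely many.\<close>
    define s where "s = Max (range r)"
    have rs: "r j \<le> s" for j by (simp add: s_def)
    have s: "0 < s" "s < 1" using r(1,2) by (simp_all add: s_def Max_gr_iff)
    have sa: "0 < s * \<alpha>" using s \<alpha> by simp
    have mP: "mean_of (f j) X (B j) \<in> pos_inv_ops" for j by (rule mean_of_pos_inv[OF f(1) X(1) B])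
    have "mean_of (f j) (\<alpha> *\<^sub>R X) (B j) \<le>\<^sub>o\<^sub>p (s * \<alpha>) *\<^sub>R mean_of (f j) X (B j)" for j
    proof (rule op_le_trans[OF r(3)])
      have "0 \<le> inner x (mean_of (f j) X (B j) x)" for x
        using mP[of j] by (simp add: pos_inv_ops_def positive_op_iff)
      then show "(r j * \<alpha>) *\<^sub>R mean_of (f j) X (B j) \<le>\<^sub>o\<^sub>p (s * \<alpha>) *\<^sub>R mean_of (f j) X (B j)"
        using rs[of j] \<alpha> pos_inv_hermitian[OF mP[of j]]
        by (simp add: op_le_iff hermitian_op_scaleR blinfun.scaleR_left mult_right_mono)
    qed
    then have "deformed_map M f B (\<alpha> *\<^sub>R X) \<le>\<^sub>o\<^sub>p M (\<lambda>j. (s * \<alpha>) *\<^sub>R mean_of (f j) X (B j))"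
      unfolding deformed_map_def
      by (intro jointly_monotoneD[OF M(2)] mean_of_pos_inv[OF f(1) aX B] pos_inv_ops_scaleR[OF mP sa])
    also have "M (\<lambda>j. (s * \<alpha>) *\<^sub>R mean_of (f j) X (B j)) = (s * \<alpha>) *\<^sub>R deformed_map M f B X"
      unfolding deformed_map_def by (rule homogeneous_mapD[OF M(3) mP sa])
    finally have 1: "deformed_map M f B (\<alpha> *\<^sub>R X) \<le>\<^sub>o\<^sub>p (s * \<alpha>) *\<^sub>R deformed_map M f B X" .
    have "Y \<le>\<^sub>o\<^sub>p \<alpha> *\<^sub>R X"
      using le h by (simp add: op_le_iff hermitian_op_scaleR blinfun.scaleR_left)
    then have "deformed_map M f A Y \<le>\<^sub>o\<^sub>p deformed_map M f B (\<alpha> *\<^sub>R X)"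
      by (intro deformed_map_mono M f Y aX A B AB)
    moreover have "(s * \<alpha>) *\<^sub>R deformed_map M f B X \<le>\<^sub>o\<^sub>p (s * \<alpha>) *\<^sub>R X"
      using sa by (intro op_le_scaleR X) simp
    \<comment> \<open>With F for the deformed map, the chain is Y <= F_A(Y) <= F_B(\<alpha> X) <= s
      \<alpha> F_B(X) <= s \<alpha> X, contradicting the minimality of \<alpha>.\<close>
    ultimately have "Y \<le>\<^sub>o\<^sub>p (s * \<alpha>) *\<^sub>R X"
      using Y(2) 1 op_le_trans by blast
    then have "s * \<alpha> \<in> I" using sa by (simp add: I_def)
    then have "\<alpha> \<le> s * \<alpha>" unfolding \<alpha>_def by (rule cInf_lower[OF _ bdd])
    then show False using s \<alpha> by simp
  qed
  have "inner x (Y x) \<le> inner x (X x)" for x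
    using le[of x] mult_right_mono[OF \<open>\<alpha> \<le> 1\<close>, of "inner x (X x)"] X(1)
    by (simp add: pos_inv_ops_def positive_op_iff)
  then show ?thesis using h by (simp add: op_le_iff)
qed

text \<open>Since M is continuous only along monotone families, X and the tuple must move in the
  same direction. Then the operators inserted into M are monotone by \<open>mean_of_mono\<close> and
  converge by \<open>mean_of_strong_tendsto\<close>.\<close>

lemma deformed_map_sot_lim:
  fixes M :: "('i::finite, 'h::complex_hilbert) op_map"
  assumes M: "monotone_continuous M" and f: "\<And>j. representing_function (f j)"
    and ab: "0 < a" "0 < b"
    and X: "\<And>k. op_between a b (X k)" and A: "\<And>j k. op_between a b (A j k)"
    and limX: "\<And>x. (\<lambda>k. blinfun_apply (X k) x) \<longlonglongrightarrow> blinfun_apply X' x"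
    and limA: "\<And>j x. (\<lambda>k. blinfun_apply (A j k) x) \<longlonglongrightarrow> blinfun_apply (L j) x"
    and mono: "(\<forall>k. X (Suc k) \<le>\<^sub>o\<^sub>p X k \<and> (\<forall>j. A j (Suc k) \<le>\<^sub>o\<^sub>p A j k)) \<or>
      (\<forall>k. X k \<le>\<^sub>o\<^sub>p X (Suc k) \<and> (\<forall>j. A j k \<le>\<^sub>o\<^sub>p A j (Suc k)))"
  shows "sot_lim (\<lambda>k. deformed_map M f (\<lambda>j. A j k) (X k)) (deformed_map M f L X')"
proof -
  define m where "m = (\<lambda>j k. mean_of (f j) (X k) (A j k))"
  define l where "l = (\<lambda>j. mean_of (f j) X' (L j))"
  have P: "X k \<in> pos_inv_ops" "A j k \<in> pos_inv_ops" "X' \<in> pos_inv_ops" "L j \<in> pos_inv_ops" for j k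
    using op_between_pos_inv[OF X ab(1)] op_between_pos_inv[OF A ab(1)]
      op_between_pos_inv[OF op_between_tendsto[OF X limX] ab(1)]
      op_between_pos_inv[OF op_between_tendsto[OF A limA] ab(1)] by blast+
  have mP: "\<forall>j k. m j k \<in> pos_inv_ops" "\<forall>j. l j \<in> pos_inv_ops"
    unfolding m_def l_def using mean_of_pos_inv f P by blast+
  have "sot_lim (m j) (l j)" for j
    unfolding sot_lim_iff m_def l_def
    using mean_of_strong_tendsto[OF f X A ab limX limA] by blast
  then have "(\<forall>j. sot_decreasing (m j) (l j)) \<or> (\<forall>j. sot_increasing (m j) (l j))"
    using mono mean_of_mono[OF f P(1) P(1) P(2) P(2)]
    unfolding sot_decreasing_def sot_increasing_def m_def by blast
  then have "sot_lim (\<lambda>k. M (\<lambda>j. m j k)) (M l)"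
    using M mP unfolding monotone_continuous_def by blast
  then show ?thesis by (simp add: deformed_map_def m_def l_def)
qed

lemma sot_lim_unique: "sot_lim T L \<Longrightarrow> sot_lim T L' \<Longrightarrow> L = L'"
  unfolding sot_lim_iff by (intro blinfun_eqI) (blast intro: LIMSEQ_unique)

lemma deformed_map_fixed_point:
  fixes M :: "('i::finite, 'h::complex_hilbert) op_map"
  assumes M: "maps_pos_inv M" "jointly_monotone M" "homogeneous_map M" "monotone_continuous M" "normalized_map M"
    and f: "\<And>j. representing_function (f j)" and A: "\<And>j. A j \<in> pos_inv_ops"
  obtains X where "X \<in> pos_inv_ops" "deformed_map M f A X = X"
proof -
  obtain a b where ab: "0 < a" "0 < b" "\<And>j. op_between a b (A j)"
    using pos_inv_ops_common_bounds[of A, OF A] by blast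
  define S where "S c = c *\<^sub>R (id_blinfun :: 'h \<Rightarrow>\<^sub>L 'h)" for c
  have SP: "S c \<in> pos_inv_ops" if "0 < c" for c
    unfolding S_def by (rule op_between_pos_inv[OF op_between_scalar that])
  have S_h: "hermitian_op (S c)" for c by (simp add: S_def hermitian_op_scaleR hermitian_op_id)
  have SI: "inner x (S c x) = c * inner x x" for c x by (simp add: S_def blinfun.scaleR_left)
  \<comment> \<open>A scalar is the fixed point for the constant tuple with the same value:
    \<open>mean_of_self\<close> first, then (B) and (D). Monotonicity in the tuple turns this into
    the barriers \<open>top\<close> and \<open>bot\<close>.\<close>
  have F_S: "deformed_map M f (\<lambda>_. S c) (S c) = S c" if "0 < c" for c
  proof -
    have "deformed_map M f (\<lambda>_. S c) (S c) = M (\<lambda>_. c *\<^sub>R id_blinfun)"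
      by (simp add: deformed_map_def mean_of_self[OF f SP[OF that]]) (simp add: S_def)
    also have "\<dots> = c *\<^sub>R M (\<lambda>_. id_blinfun)"
      using M(3) that SP[of 1] unfolding homogeneous_map_def S_def by simp
    finally show ?thesis using M(5) by (simp add: normalized_map_def S_def)
  qed
  have A_le: "A j \<le>\<^sub>o\<^sub>p S b" and le_A: "S a \<le>\<^sub>o\<^sub>p A j" for j
    using op_between_upper[OF ab(3)] op_between_lower[OF ab(3)] pos_inv_hermitian[OF A] S_h
    by (simp_all add: op_le_iff SI)
  let ?F = "deformed_map M f A"
  have mono: "?F X \<le>\<^sub>o\<^sub>p ?F Y" if "X \<in> pos_inv_ops" "Y \<in> pos_inv_ops" "X \<le>\<^sub>o\<^sub>p Y" for X Y
    by (rule deformed_map_mono[OF M(2) f that(1,2) A A that(3) op_le_refl])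
  have top: "?F (S b) \<le>\<^sub>o\<^sub>p S b"
    using deformed_map_mono[of M f "S b" "S b" A "\<lambda>_. S b"] M(2) f SP[OF ab(2)] A A_le F_S[OF ab(2)]
    by (simp add: op_le_refl)
  have bot: "S a \<le>\<^sub>o\<^sub>p ?F (S a)"
    using deformed_map_mono[of M f "S a" "S a" "\<lambda>_. S a" A] M(2) f SP[OF ab(1)] A le_A F_S[OF ab(1)]
    by (simp add: op_le_refl)
  define X where "X k = (?F ^^ k) (S b)" for k
  have XS: "X (Suc k) = ?F (X k)" for k by (simp add: X_def)
  have XP: "X k \<in> pos_inv_ops" for k
    by (induction k) (simp_all add: X_def SP ab deformed_map_pos_inv[OF M(1) f _ A])
  have dec: "X (Suc k) \<le>\<^sub>o\<^sub>p X k" for k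
  proof (induction k)
    case 0
    then show ?case using top by (simp add: X_def)
  next
    case (Suc k)
    from mono[OF XP XP Suc] show ?case by (simp only: XS)
  qed
  \<comment> \<open>The lower barrier keeps the iterates uniformly away from 0, which makes their
    strong limit invertible.\<close>
  have low: "S a \<le>\<^sub>o\<^sub>p X k" for k
  proof (induction k)
    case 0
    show ?case using op_le_trans[OF le_A A_le] by (simp add: X_def)
  next
    case (Suc k)
    then show ?case unfolding XS using op_le_trans[OF bot mono[OF SP[OF ab(1)] XP]] by blast
  qed
  have "X k \<le>\<^sub>o\<^sub>p S b" for k using op_decreasing_le[where T = X, OF dec, of 0 k] by (simp add: X_def)
  then have Xb: "op_between a b (X k)" for k
    using op_le_inner[OF low] op_le_inner[of "X k" "S b"] pos_inv_hermitian[OF XP]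
    by (simp add: op_between_def SI)
  obtain L :: "'h \<Rightarrow>\<^sub>L 'h" where L: "\<And>x. (\<lambda>k. X k x) \<longlonglongrightarrow> L x"
    using decreasing_strong_convergent[where T = X, OF Xb dec] by blast
  \<comment> \<open>The constant tuple A counts as decreasing, so it may accompany the decreasing
    iterates.\<close>
  have "sot_lim (\<lambda>k. ?F (X k)) (?F L)"
    by (rule deformed_map_sot_lim[OF M(4) f ab(1,2) Xb ab(3) L tendsto_const])
       (use dec op_le_refl in blast)
  moreover have "sot_lim (\<lambda>k. ?F (X k)) L"
    unfolding sot_lim_iff XS[symmetric] using LIMSEQ_Suc[OF L] by blast
  ultimately have "?F L = L" by (rule sot_lim_unique)
  moreover have "L \<in> pos_inv_ops"
    by (rule op_between_pos_inv[OF op_between_tendsto[OF Xb L] ab(1)])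
  ultimately show ?thesis using that by blast
qed

theorem lemma4p5:
  fixes M :: "('i::finite, 'h::complex_hilbert) op_map"
    and f :: "'i \<Rightarrow> real \<Rightarrow> real"
  assumes "CARD('i) \<ge> 2"
    and "maps_pos_inv M"
    and "jointly_monotone M" and "homogeneous_map M"
    and "monotone_continuous M" and "normalized_map M"
    and "\<And>j. representing_function (f j)"
    and "\<And>j. \<not> is_left_trivial (f j)"
  shows "maps_pos_inv (deformed_mean M f) \<and>
         jointly_monotone (deformed_mean M f) \<and> homogeneous_map (deformed_mean M f) \<and>
         monotone_continuous (deformed_mean M f) \<and> normalized_map (deformed_mean M f)"
proof -
  note M = assms(2-6) and f = assms(7,8)
  let ?G = "deformed_mean M f"
  have compare: "Y \<le>\<^sub>o\<^sub>p X"
    if "\<And>j. A j \<in> pos_inv_ops" "\<And>j. B j \<in> pos_inv_ops" "\<And>j. A j \<le>\<^sub>o\<^sub>p B j"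
      "X \<in> pos_inv_ops" "deformed_map M f B X = X" "Y \<in> pos_inv_ops" "deformed_map M f A Y = Y" for A B X Y
    by (rule deformed_map_comparison[of M f A B]) (use M f that op_le_refl in auto)
  have uniq: "X = Y"
    if A: "\<And>j. A j \<in> pos_inv_ops" and X: "X \<in> pos_inv_ops" "deformed_map M f A X = X"
      and Y: "Y \<in> pos_inv_ops" "deformed_map M f A Y = Y" for A X Y
    using compare[OF A A op_le_refl X Y] compare[OF A A op_le_refl Y X]
      pos_inv_hermitian[OF X(1)] pos_inv_hermitian[OF Y(1)] by (simp add: op_le_antisym)
  \<comment> \<open>Existence and uniqueness together validate the definite description in
    \<open>deformed_mean\<close>.\<close>
  have G: "?G A \<in> pos_inv_ops \<and> deformed_map M f A (?G A) = ?G A" if A: "\<And>j. A j \<in> pos_inv_ops" for A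
  proof -
    obtain X where X: "X \<in> pos_inv_ops" "deformed_map M f A X = X"
      using deformed_map_fixed_point[of M f A] M f A by metis
    have "?G A = X"
      unfolding deformed_mean_def
    proof (rule the_equality)
      show "X \<in> pos_inv_ops \<and> X = M (\<lambda>j. mean_of (f j) X (A j))"
        using X by (simp add: deformed_map_def)
      fix Y assume "Y \<in> pos_inv_ops \<and> Y = M (\<lambda>j. mean_of (f j) Y (A j))"
      then have "Y \<in> pos_inv_ops" "deformed_map M f A Y = Y" by (simp_all add: deformed_map_def)
      then show "Y = X" using uniq[of A Y X] A X by blast
    qed
    then show ?thesis using X by simp
  qed
  have G_eq: "?G A = X" if "\<And>j. A j \<in> pos_inv_ops" "X \<in> pos_inv_ops" "deformed_map M f A X = X" for A X
    using uniq[of A "?G A" X] G[of A] that by blast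
  have pos: "maps_pos_inv ?G" using G by (simp add: maps_pos_inv_def)
  have mono: "?G A \<le>\<^sub>o\<^sub>p ?G B"
    if "\<And>j. A j \<in> pos_inv_ops" "\<And>j. B j \<in> pos_inv_ops" "\<And>j. A j \<le>\<^sub>o\<^sub>p B j" for A B
    by (rule compare[of A B]) (use that G[of A] G[of B] in auto)
  have hom: "homogeneous_map ?G"
    unfolding homogeneous_map_def
  proof (intro allI impI)
    fix A :: "'i \<Rightarrow> 'h \<Rightarrow>\<^sub>L 'h" and \<alpha> :: real assume A: "\<forall>j. A j \<in> pos_inv_ops" and \<alpha>: "0 < \<alpha>"
    then have GA: "?G A \<in> pos_inv_ops" "deformed_map M f A (?G A) = ?G A" using G by blast+
    \<comment> \<open>The scaled solution solves the scaled equation because each binary mean is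
      homogeneous in both arguments jointly.\<close>
    have "deformed_map M f (\<lambda>j. \<alpha> *\<^sub>R A j) (\<alpha> *\<^sub>R ?G A) = M (\<lambda>j. \<alpha> *\<^sub>R mean_of (f j) (?G A) (A j))"
      by (simp add: deformed_map_def mean_of_scaleR[OF GA(1) \<alpha>])
    also have "\<dots> = \<alpha> *\<^sub>R deformed_map M f A (?G A)"
      unfolding deformed_map_def
      by (rule homogeneous_mapD[OF M(3) mean_of_pos_inv[OF f(1) GA(1)] \<alpha>]) (use A in blast)
    finally show "?G (\<lambda>j. \<alpha> *\<^sub>R A j) = \<alpha> *\<^sub>R ?G A"
      using A \<alpha> GA by (intro G_eq pos_inv_ops_scaleR) auto
  qed
  have cont: "monotone_continuous ?G"
    unfolding monotone_continuous_def
  proof (intro allI impI)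
    fix A :: "'i \<Rightarrow> nat \<Rightarrow> 'h \<Rightarrow>\<^sub>L 'h" and L
    assume A: "\<forall>j k. A j k \<in> pos_inv_ops" and L: "\<forall>j. L j \<in> pos_inv_ops"
      and dir: "(\<forall>j. sot_decreasing (A j) (L j)) \<or> (\<forall>j. sot_increasing (A j) (L j))"
    define X where "X k = ?G (\<lambda>j. A j k)" for k
    have XP: "X k \<in> pos_inv_ops" and XF: "deformed_map M f (\<lambda>j. A j k) (X k) = X k" for k
      using G[of "\<lambda>j. A j k"] A by (auto simp: X_def)
    have GL: "?G L \<in> pos_inv_ops" using G L by blast
    have limA: "(\<lambda>k. A j k x) \<longlonglongrightarrow> L j x" for j x
      using dir by (auto simp: sot_decreasing_def sot_increasing_def sot_lim_iff)
    have herm: "hermitian_op (A j k)" for j k using A pos_inv_hermitian by blast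
    obtain a1 b1 where L1: "0 < a1" "0 < b1" "\<And>j. op_between a1 b1 (L j)"
      using pos_inv_ops_common_bounds[of L] L by blast
    obtain a2 b2 where A2: "0 < a2" "0 < b2" "\<And>j. op_between a2 b2 (A j 0)"
      using pos_inv_ops_common_bounds[of "\<lambda>j. A j 0"] A by blast
    obtain a3 b3 where G3: "0 < a3" "0 < b3" "op_between a3 b3 (?G L)" using pos_inv_ops_between[OF GL] by blast
    obtain a4 b4 where X4: "0 < a4" "0 < b4" "op_between a4 b4 (X 0)" using pos_inv_ops_between[OF XP] by blast
    \<comment> \<open>Along a monotone sequence the first term and the candidate limit bound all
      other terms. Bounds for these ends, for the tuples and for the solutions, therefore give an
      interval valid for every k.\<close>
    define a where "a = min (min a1 a2) (min a3 a4)"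
    define b where "b = max (max b1 b2) (max b3 b4)"
    have ab: "0 < a" "0 < b" using L1 A2 G3 X4 by (simp_all add: a_def b_def)
    have bL: "op_between a b (L j)" "op_between a b (A j 0)" "op_between a b (?G L)" "op_between a b (X 0)" for j
      by (rule op_between_mono[OF L1(3)] op_between_mono[OF A2(3)] op_between_mono[OF G3(3)]
          op_between_mono[OF X4(3)], simp add: a_def, simp add: b_def)+
    have btw: "op_between a b T"
      if "hermitian_op T" "S \<le>\<^sub>o\<^sub>p T" "T \<le>\<^sub>o\<^sub>p U" "op_between a b S" "op_between a b U" for S T U :: "'h \<Rightarrow>\<^sub>L 'h"
      using that(1) order_trans[OF op_between_lower[OF that(4)] op_le_inner[OF that(2)]]
        order_trans[OF op_le_inner[OF that(3)] op_between_upper[OF that(5)]]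
      by (simp add: op_between_def)
    \<comment> \<open>By \<open>XF\<close> the images of the \<open>X k\<close> are the
      \<open>X k\<close> themselves, so the limit X' and the value of the limiting map at X'
      coincide; uniqueness identifies X' with \<open>?G L\<close>. Both directions of (C) end
      here.\<close>
    have finish: "sot_lim (\<lambda>k. ?G (\<lambda>j. A j k)) (?G L)"
      if Xb: "\<And>k. op_between a b (X k)" and Ab: "\<And>j k. op_between a b (A j k)"
        and limX: "\<And>x. (\<lambda>k. X k x) \<longlonglongrightarrow> blinfun_apply X' x"
        and mon: "(\<forall>k. X (Suc k) \<le>\<^sub>o\<^sub>p X k \<and> (\<forall>j. A j (Suc k) \<le>\<^sub>o\<^sub>p A j k)) \<or>
          (\<forall>k. X k \<le>\<^sub>o\<^sub>p X (Suc k) \<and> (\<forall>j. A j k \<le>\<^sub>o\<^sub>p A j (Suc k)))" for X'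
    proof -
      have lim: "sot_lim X X'" using limX by (simp add: sot_lim_iff)
      have "sot_lim X (deformed_map M f L X')"
        using deformed_map_sot_lim[of M f, OF M(4) f(1) ab Xb Ab limX limA mon] by (simp add: XF)
      with lim have "deformed_map M f L X' = X'" using sot_lim_unique by blast
      moreover have "X' \<in> pos_inv_ops" by (rule op_between_pos_inv[OF op_between_tendsto[OF Xb limX] ab(1)])
      ultimately have "?G L = X'" using G_eq L by blast
      moreover have "X = (\<lambda>k. ?G (\<lambda>j. A j k))" by (rule ext) (simp add: X_def)
      ultimately show ?thesis using lim by simp
    qed
    from dir show "sot_lim (\<lambda>k. ?G (\<lambda>j. A j k)) (?G L)"
    proof
      assume "\<forall>j. sot_decreasing (A j) (L j)"
      then have dA: "A j (Suc k) \<le>\<^sub>o\<^sub>p A j k" for j k by (simp add: sot_decreasing_def)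
      have LA: "L j \<le>\<^sub>o\<^sub>p A j k" for j k by (rule op_decreasing_limit_le[where T = "A j", OF herm dA limA])
      have dX: "X (Suc k) \<le>\<^sub>o\<^sub>p X k" for k unfolding X_def by (rule mono) (use A dA in auto)
      \<comment> \<open>Monotonicity, applied to the limit tuple, supplies an invertible lower bound
        independent of k; a decreasing sequence alone might lose invertibility in the limit.\<close>
      have LX: "?G L \<le>\<^sub>o\<^sub>p X k" for k unfolding X_def by (rule mono) (use A L LA in auto)
      have Xb: "op_between a b (X k)" for k
        by (rule btw[OF pos_inv_hermitian[OF XP] LX op_decreasing_le[where T = X, OF dX] bL(3,4)]) simp
      have Ab: "op_between a b (A j k)" for j k
        by (rule btw[OF herm LA op_decreasing_le[where T = "A j", OF dA] bL(1,2)]) simp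
      obtain X' :: "'h \<Rightarrow>\<^sub>L 'h" where "\<And>x. (\<lambda>k. X k x) \<longlonglongrightarrow> X' x"
        using decreasing_strong_convergent[where T = X, OF Xb dX] by blast
      then show ?thesis using dX dA by (intro finish[OF Xb Ab]) auto
    next
      assume "\<forall>j. sot_increasing (A j) (L j)"
      then have iA: "A j k \<le>\<^sub>o\<^sub>p A j (Suc k)" for j k by (simp add: sot_increasing_def)
      have AL: "A j k \<le>\<^sub>o\<^sub>p L j" for j k by (rule op_increasing_limit_ge[where T = "A j", OF herm iA limA])
      have iX: "X k \<le>\<^sub>o\<^sub>p X (Suc k)" for k unfolding X_def by (rule mono) (use A iA in auto)
      have XL: "X k \<le>\<^sub>o\<^sub>p ?G L" for k unfolding X_def by (rule mono) (use A L AL in auto)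
      have A0: "A j 0 \<le>\<^sub>o\<^sub>p A j k" for j k
        by (induction k) (rule op_le_refl, erule op_le_trans, rule iA)
      have X0: "X 0 \<le>\<^sub>o\<^sub>p X k" for k
        by (induction k) (rule op_le_refl, erule op_le_trans, rule iX)
      have Xb: "op_between a b (X k)" for k
        by (rule btw[OF pos_inv_hermitian[OF XP] X0 XL bL(4,3)])
      have Ab: "op_between a b (A j k)" for j k
        by (rule btw[OF herm A0 AL bL(2,1)])
      obtain X' :: "'h \<Rightarrow>\<^sub>L 'h" where "\<And>x. (\<lambda>k. X k x) \<longlonglongrightarrow> X' x"
        using increasing_strong_convergent[where T = X, OF Xb iX] by blast
      then show ?thesis using iX iA by (intro finish[OF Xb Ab]) auto
    qed
  qed
  have "id_blinfun \<in> (pos_inv_ops :: ('h \<Rightarrow>\<^sub>L 'h) set)"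
    using op_between_pos_inv[OF op_between_scalar[of 1]] by simp
  then have "normalized_map ?G"
    unfolding normalized_map_def using M(5) f(1)
    by (intro G_eq) (simp_all add: deformed_map_def mean_of_self normalized_map_def)
  with pos mono hom cont show ?thesis by (auto simp: jointly_monotone_def)
qed

end
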